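(* Let $(\Sigma_1,g_1)$ and $(\Sigma_2,g_2)$ be Lorentzian surfaces with Gauss curvatures $\kappa_1,\kappa_2$. For $\epsilon\in\{-1,1\}$ let $(G^{\epsilon},J,\Omega^{\epsilon})$ be the product para-Kähler structure on $\Sigma_1\times\Sigma_2$, and consider the condition $(C_\epsilon)$: either (1) $g_1$ and $g_2$ are both non-flat almost everywhere and away from flat points $\epsilon\kappa_1\kappa_2<0$, or (2) exactly one of the metrics $g_1,g_2$ is flat while the other is non-flat almost everywhere. Then: (i) Assume $(C_{+1})$. If $\kappa_1$ and $\kappa_2$ are both nonpositive (resp. both nonnegative), then every $G^+$-minimal $\Omega^+$-Lagrangian surface $\phi\times\psi$, where the geodesics $\phi\subset\Sigma_1$ and $\psi\subset\Sigma_2$ are both spacelike (resp. both timelike), is stable. (ii) Assume $(C_{-1})$. If $\kappa_1$ is nonpositive and $\kappa_2$ is nonnegative, then every $G^-$-minimal $\Omega^-$-Lagrangian surface $\phi\times\psi$, where the geodesic $\phi\subset\Sigma_1$ is spacelike and the geodesic $\psi\subset\Sigma_2$ is timelike, is stable.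
   Context: A Lorentzian surface $(\Sigma,g)$ is a connected, oriented smooth 2-manifold with a smooth metric $g$ of signature $(+,-)$. Near any point there are oriented isothermic coordinates $(s,t)$ with $g_{ss}=-g_{tt}>0$, $g_{st}=0$, and the endomorphism $j$ of $T\Sigma$ is given by $j(\partial_s)=\partial_t$, $j(\partial_t)=\partial_s$; it satisfies $j^2=\mathrm{Id}$ and $g(j\cdot,j\cdot)=-g(\cdot,\cdot)$. Put $\omega(\cdot,\cdot)=g(j\cdot,\cdot)$. For $k=1,2$ let $j_k,\omega_k$ be the objects so associated to $(\Sigma_k,g_k)$. Product structure: with $T(\Sigma_1\times\Sigma_2)=T\Sigma_1\oplus T\Sigma_2$, $X=(X_1,X_2)$, $Y=(Y_1,Y_2)$, and $\pi_i$ the projections, define $G^{\epsilon}(X,Y)=g_1(X_1,Y_1)+\epsilon\, g_2(X_2,Y_2)$, $J=j_1\oplus j_2$, $\Omega^{\epsilon}=\pi_1^*\omega_1+\epsilon\,\pi_2^*\omega_2$; $G^\pm$, $\Omega^\pm$ stand for $\epsilon=\pm1$. "Non-flat almost everywhere" means that the set of flat points (zeros of the Gauss curvature) has measure zero; "away from flat points $\epsilon\kappa_1\kappa_2<0$" means $\epsilon\kappa_1(x)\kappa_2(y)<0$ whenever $\kappa_1(x)\ne0$ and $\kappa_2(y)\neq0$. A surface is $\Omega^\epsilon$-Lagrangian if $\Omega^\epsilon$ pulls back to zero on it, and $G^\epsilon$-minimal if its mean curvature vector with respect to $G^\epsilon$ vanishes. $\phi\times\psi$ denotes the surface parametrised by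 $(s,t)\mapsto(\phi(s),\psi(t))$. A curve $\gamma$ in $(\Sigma_i,g_i)$ is spacelike if $g_i(\gamma',\gamma')>0$ and timelike if $g_i(\gamma',\gamma')<0$. A minimal surface is stable if the second variation of the volume (area of the induced metric) has constant sign (is $\geq0$ for all, or $\leq 0$ for all) on compactly supported normal variations. *)

theory Defs
  imports "HOL-Analysis.Analysis"
begin

section \<open>Smooth functions\<close>

abbreviation dderiv :: "('a::real_normed_vector \<Rightarrow> 'b::real_normed_vector) \<Rightarrow> 'a \<Rightarrow> 'a \<Rightarrow> 'b" where
  "dderiv f x v \<equiv> frechet_derivative f (at x) v"

text \<open>The following two notions are meant for open sets \<open>U\<close> only.\<close>

fun Ck_on :: "nat \<Rightarrow> 'a::real_normed_vector set \<Rightarrow> ('a \<Rightarrow> 'b::real_normed_vector) \<Rightarrow> bool" where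
  "Ck_on 0 U f \<longleftrightarrow> continuous_on U f"
| "Ck_on (Suc k) U f \<longleftrightarrow>
     (\<forall>x\<in>U. f differentiable (at x)) \<and> (\<forall>v. Ck_on k U (\<lambda>x. dderiv f x v))"

definition smooth_on :: "'a::real_normed_vector set \<Rightarrow> ('a \<Rightarrow> 'b::real_normed_vector) \<Rightarrow> bool" where
  "smooth_on U f \<longleftrightarrow> (\<forall>k. Ck_on k U f)"


section \<open>Manifolds with a metric, given by charts\<close>

text \<open>
  The points of the manifold form the whole topological space \<open>'p\<close>. Charts are indexed by
  \<open>atlas\<close>; chart \<open>i\<close> is a homeomorphism from the open set \<open>cdom i\<close> onto an open subset of the
  model space \<open>'m\<close>. A tangent vector at a point of \<open>cdom i\<close> is represented by its component
  vector in \<open>'m\<close> with respect to chart \<open>i\<close>, and \<open>met i x u v\<close> is the metric in chart \<open>i\<close>, at the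
  point with coordinates \<open>x\<close>, of the tangent vectors with components \<open>u\<close> and \<open>v\<close>.
\<close>

record ('p, 'm, 'i) metric_mfd =
  atlas :: "'i set"
  cdom :: "'i \<Rightarrow> 'p set"
  chart :: "'i \<Rightarrow> 'p \<Rightarrow> 'm"
  met :: "'i \<Rightarrow> 'm \<Rightarrow> 'm \<Rightarrow> 'm \<Rightarrow> real"

definition transition :: "('p, 'm, 'i) metric_mfd \<Rightarrow> 'i \<Rightarrow> 'i \<Rightarrow> 'm \<Rightarrow> 'm" where
  "transition M i k = chart M k \<circ> inv_into (cdom M i) (chart M i)"

definition smooth_atlas ::
  "('p::{t2_space,second_countable_topology}, 'm::euclidean_space, 'i) metric_mfd \<Rightarrow> bool" where
  "smooth_atlas M \<longleftrightarrow>
     (\<Union>i\<in>atlas M. cdom M i) = UNIV \<and>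
     (\<forall>i\<in>atlas M. open (cdom M i) \<and> open (chart M i ` cdom M i) \<and>
        homeomorphism (cdom M i) (chart M i ` cdom M i)
          (chart M i) (inv_into (cdom M i) (chart M i))) \<and>
     (\<forall>i\<in>atlas M. \<forall>k\<in>atlas M.
        smooth_on (chart M i ` (cdom M i \<inter> cdom M k)) (transition M i k))"

definition oriented_atlas :: "('p, real^2, 'i) metric_mfd \<Rightarrow> bool" where
  "oriented_atlas M \<longleftrightarrow>
     (\<forall>i\<in>atlas M. \<forall>k\<in>atlas M. \<forall>p\<in>cdom M i \<inter> cdom M k.
        0 < det (matrix (frechet_derivative (transition M i k) (at (chart M i p)))))"

definition smooth_metric :: "('p, 'm::euclidean_space, 'i) metric_mfd \<Rightarrow> bool" where
  "smooth_metric M \<longleftrightarrow>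
     (\<forall>i\<in>atlas M. \<forall>x\<in>chart M i ` cdom M i.
        bilinear (met M i x) \<and> (\<forall>u v. met M i x u v = met M i x v u)) \<and>
     (\<forall>i\<in>atlas M. \<forall>u v. smooth_on (chart M i ` cdom M i) (\<lambda>x. met M i x u v)) \<and>
     (\<forall>i\<in>atlas M. \<forall>k\<in>atlas M. \<forall>p\<in>cdom M i \<inter> cdom M k. \<forall>u v.
        met M i (chart M i p) u v =
        met M k (chart M k p) (dderiv (transition M i k) (chart M i p) u)
                              (dderiv (transition M i k) (chart M i p) v))"

definition lorentzian_surface ::
  "('p::{t2_space,second_countable_topology}, real^2, 'i) metric_mfd \<Rightarrow> bool" where
  "lorentzian_surface S \<longleftrightarrow>
     connected (UNIV :: 'p set) \<and> smooth_atlas S \<and> oriented_atlas S \<and> smooth_metric S \<and>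
     (\<forall>i\<in>atlas S. \<forall>x\<in>chart S i ` cdom S i.
        \<exists>u v. met S i x u u > 0 \<and> met S i x u v = 0 \<and> met S i x v v < 0)"

text \<open>
  Tensorial quantities at a point \<open>p\<close> are evaluated in a fixed chart around \<open>p\<close>; none of the
  notions below that are built from them depends on this choice.
\<close>

definition chart_at :: "('p, 'm, 'i) metric_mfd \<Rightarrow> 'p \<Rightarrow> 'i" where
  "chart_at M p = (SOME i. i \<in> atlas M \<and> p \<in> cdom M i)"

definition met_at :: "('p, 'm, 'i) metric_mfd \<Rightarrow> 'p \<Rightarrow> 'm \<Rightarrow> 'm \<Rightarrow> real" where
  "met_at M p = met M (chart_at M p) (chart M (chart_at M p) p)"


section \<open>Curvature\<close>

text \<open>The Levi-Civita connection in coordinates, by the Koszul formula.\<close>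

definition christoffel :: "('m::euclidean_space \<Rightarrow> 'm \<Rightarrow> 'm \<Rightarrow> real) \<Rightarrow> 'm \<Rightarrow> 'm \<Rightarrow> 'm \<Rightarrow> 'm" where
  "christoffel g x u v = (THE w. \<forall>z. 2 * g x w z =
     dderiv (\<lambda>y. g y v z) x u + dderiv (\<lambda>y. g y u z) x v - dderiv (\<lambda>y. g y u v) x z)"

text \<open>Sign convention: \<open>R(u,v)w = \<nabla>\<^sub>u\<nabla>\<^sub>vw - \<nabla>\<^sub>v\<nabla>\<^sub>uw - \<nabla>\<^bsub>[u,v]\<^esub>w\<close>.\<close>

definition riemann ::
  "('m::euclidean_space \<Rightarrow> 'm \<Rightarrow> 'm \<Rightarrow> real) \<Rightarrow> 'm \<Rightarrow> 'm \<Rightarrow> 'm \<Rightarrow> 'm \<Rightarrow> 'm" where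
  "riemann g x u v w =
     dderiv (\<lambda>y. christoffel g y v w) x u - dderiv (\<lambda>y. christoffel g y u w) x v
     + christoffel g x u (christoffel g x v w) - christoffel g x v (christoffel g x u w)"

definition gauss_curvature :: "('p, real^2, 'i) metric_mfd \<Rightarrow> 'p \<Rightarrow> real" where
  "gauss_curvature S p =
     (let g = met S (chart_at S p); x = chart S (chart_at S p) p;
          u = axis 1 1; v = axis 2 1
      in g x (riemann g x u v v) u / (g x u u * g x v v - (g x u v)\<^sup>2))"

definition null_set_in :: "('p, real^2, 'i) metric_mfd \<Rightarrow> 'p set \<Rightarrow> bool" where
  "null_set_in S N \<longleftrightarrow> (\<forall>i\<in>atlas S. negligible (chart S i ` (N \<inter> cdom S i)))"

definition flat :: "('p, real^2, 'i) metric_mfd \<Rightarrow> bool" where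
  "flat S \<longleftrightarrow> (\<forall>p. gauss_curvature S p = 0)"

definition non_flat_ae :: "('p, real^2, 'i) metric_mfd \<Rightarrow> bool" where
  "non_flat_ae S \<longleftrightarrow> null_set_in S {p. gauss_curvature S p = 0}"

definition curvature_condition ::
  "real \<Rightarrow> ('p, real^2, 'i) metric_mfd \<Rightarrow> ('q, real^2, 'k) metric_mfd \<Rightarrow> bool" where
  "curvature_condition \<epsilon> S1 S2 \<longleftrightarrow>
     (non_flat_ae S1 \<and> non_flat_ae S2 \<and>
      (\<forall>x y. gauss_curvature S1 x \<noteq> 0 \<and> gauss_curvature S2 y \<noteq> 0 \<longrightarrow>
             \<epsilon> * gauss_curvature S1 x * gauss_curvature S2 y < 0))
     \<or> (flat S1 \<and> \<not> flat S2 \<and> non_flat_ae S2)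
     \<or> (flat S2 \<and> \<not> flat S1 \<and> non_flat_ae S1)"


section \<open>The para-Kaehler structure\<close>

text \<open>
  \<open>isothermic S i W h\<close>: \<open>h\<close> is the inverse of an oriented isothermic coordinate system \<open>(s,t)\<close>,
  read in chart \<open>i\<close>; so \<open>dderiv h z (axis 1 1)\<close> and \<open>dderiv h z (axis 2 1)\<close> are the coordinate
  vectors \<open>\<partial>\<^sub>s\<close> and \<open>\<partial>\<^sub>t\<close>.
\<close>

definition isothermic ::
  "('p, real^2, 'i) metric_mfd \<Rightarrow> 'i \<Rightarrow> (real^2) set \<Rightarrow> (real^2 \<Rightarrow> real^2) \<Rightarrow> bool" where
  "isothermic S i W h \<longleftrightarrow>
     open W \<and> smooth_on W h \<and> inj_on h W \<and> h ` W \<subseteq> chart S i ` cdom S i \<and>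
     (\<forall>z\<in>W. let hs = dderiv h z (axis 1 1); ht = dderiv h z (axis 2 1); g = met S i (h z) in
        0 < det (matrix (frechet_derivative h (at z))) \<and>
        g hs hs = - g ht ht \<and> - g ht ht > 0 \<and> g hs ht = 0)"

definition para_complex ::
  "('p, real^2, 'i) metric_mfd \<Rightarrow> 'i \<Rightarrow> real^2 \<Rightarrow> real^2 \<Rightarrow> real^2" where
  "para_complex S i x = (THE j. linear j \<and>
     (\<forall>W h. isothermic S i W h \<longrightarrow> (\<forall>z\<in>W. h z = x \<longrightarrow>
        j (dderiv h z (axis 1 1)) = dderiv h z (axis 2 1) \<and>
        j (dderiv h z (axis 2 1)) = dderiv h z (axis 1 1))))"

definition kaehler_form ::
  "('p, real^2, 'i) metric_mfd \<Rightarrow> 'i \<Rightarrow> real^2 \<Rightarrow> real^2 \<Rightarrow> real^2 \<Rightarrow> real" where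
  "kaehler_form S i x u v = met S i x (para_complex S i x u) v"

definition product_mfd ::
  "real \<Rightarrow> ('p, 'm, 'i) metric_mfd \<Rightarrow> ('q, 'n, 'k) metric_mfd \<Rightarrow>
   ('p \<times> 'q, 'm \<times> 'n, 'i \<times> 'k) metric_mfd" where
  "product_mfd \<epsilon> S1 S2 =
     \<lparr> atlas = atlas S1 \<times> atlas S2,
       cdom = (\<lambda>(i, k). cdom S1 i \<times> cdom S2 k),
       chart = (\<lambda>(i, k) (p, q). (chart S1 i p, chart S2 k q)),
       met = (\<lambda>(i, k) (x, y) (u1, u2) (v1, v2). met S1 i x u1 v1 + \<epsilon> * met S2 k y u2 v2) \<rparr>"

definition product_form ::
  "real \<Rightarrow> ('p, real^2, 'i) metric_mfd \<Rightarrow> ('q, real^2, 'k) metric_mfd \<Rightarrow>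
   'i \<times> 'k \<Rightarrow> (real^2) \<times> (real^2) \<Rightarrow> (real^2) \<times> (real^2) \<Rightarrow> (real^2) \<times> (real^2) \<Rightarrow> real" where
  "product_form \<epsilon> S1 S2 =
     (\<lambda>(i, k) (x, y) (u1, u2) (v1, v2). kaehler_form S1 i x u1 v1 + \<epsilon> * kaehler_form S2 k y u2 v2)"


section \<open>Maps into a manifold\<close>

definition smooth_map ::
  "('p::topological_space, 'm::euclidean_space, 'i) metric_mfd \<Rightarrow>
   'a::euclidean_space set \<Rightarrow> ('a \<Rightarrow> 'p) \<Rightarrow> bool" where
  "smooth_map M U f \<longleftrightarrow> open U \<and> continuous_on U f \<and>
     (\<forall>i\<in>atlas M. smooth_on {x\<in>U. f x \<in> cdom M i} (chart M i \<circ> f))"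

text \<open>The map \<open>f\<close> near \<open>x\<close>, in the coordinates used at \<open>f x\<close>.\<close>

definition loc :: "('p, 'm, 'i) metric_mfd \<Rightarrow> ('a \<Rightarrow> 'p) \<Rightarrow> 'a \<Rightarrow> 'a \<Rightarrow> 'm" where
  "loc M f x = chart M (chart_at M (f x)) \<circ> f"

definition push ::
  "('p, 'm::euclidean_space, 'i) metric_mfd \<Rightarrow> ('a::euclidean_space \<Rightarrow> 'p) \<Rightarrow> 'a \<Rightarrow> 'a \<Rightarrow> 'm" where
  "push M f x a = dderiv (loc M f x) x a"

definition induced ::
  "('p, 'm::euclidean_space, 'i) metric_mfd \<Rightarrow> ('a::euclidean_space \<Rightarrow> 'p) \<Rightarrow> 'a \<Rightarrow> 'a \<Rightarrow> 'a \<Rightarrow> real" where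
  "induced M f x a b = met_at M (f x) (push M f x a) (push M f x b)"

text \<open>The covariant derivative \<open>\<nabla>\<^sub>a \<partial>\<^sub>b f\<close> along \<open>f\<close>.\<close>

definition cov ::
  "('p, 'm::euclidean_space, 'i) metric_mfd \<Rightarrow> ('a::euclidean_space \<Rightarrow> 'p) \<Rightarrow> 'a \<Rightarrow> 'a \<Rightarrow> 'a \<Rightarrow> 'm" where
  "cov M f x a b =
     dderiv (\<lambda>y. dderiv (loc M f x) y b) x a
     + christoffel (met M (chart_at M (f x))) (loc M f x x) (push M f x a) (push M f x b)"


section \<open>Curves\<close>

text \<open>
  A curve is parametrised by an open interval \<open>I\<close> (period \<open>L = 0\<close>), or is a closed curve
  parametrised by the circle of length \<open>L > 0\<close>, in which case \<open>I\<close> is the whole line.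
\<close>

definition smooth_curve ::
  "('p::topological_space, 'm::euclidean_space, 'i) metric_mfd \<Rightarrow>
   real set \<Rightarrow> real \<Rightarrow> (real \<Rightarrow> 'p) \<Rightarrow> bool" where
  "smooth_curve M I L \<gamma> \<longleftrightarrow>
     is_interval I \<and> I \<noteq> {} \<and> smooth_map M I \<gamma> \<and>
     (L = 0 \<or> L > 0 \<and> I = UNIV \<and> (\<forall>s. \<gamma> (s + L) = \<gamma> s))"

definition geodesic ::
  "('p::topological_space, 'm::euclidean_space, 'i) metric_mfd \<Rightarrow>
   real set \<Rightarrow> real \<Rightarrow> (real \<Rightarrow> 'p) \<Rightarrow> bool" where
  "geodesic M I L \<gamma> \<longleftrightarrow> smooth_curve M I L \<gamma> \<and> (\<forall>s\<in>I. cov M \<gamma> s 1 1 = 0)"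

definition spacelike ::
  "('p, 'm::euclidean_space, 'i) metric_mfd \<Rightarrow> real set \<Rightarrow> (real \<Rightarrow> 'p) \<Rightarrow> bool" where
  "spacelike M I \<gamma> \<longleftrightarrow> (\<forall>s\<in>I. induced M \<gamma> s 1 1 > 0)"

definition timelike ::
  "('p, 'm::euclidean_space, 'i) metric_mfd \<Rightarrow> real set \<Rightarrow> (real \<Rightarrow> 'p) \<Rightarrow> bool" where
  "timelike M I \<gamma> \<longleftrightarrow> (\<forall>s\<in>I. induced M \<gamma> s 1 1 < 0)"


section \<open>Parametrised surfaces\<close>

definition product_surface :: "(real \<Rightarrow> 'p) \<Rightarrow> (real \<Rightarrow> 'q) \<Rightarrow> real \<times> real \<Rightarrow> 'p \<times> 'q" where
  "product_surface \<phi> \<psi> = (\<lambda>(s, t). (\<phi> s, \<psi> t))"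

definition lagrangian ::
  "real \<Rightarrow> ('p, real^2, 'i) metric_mfd \<Rightarrow> ('q, real^2, 'k) metric_mfd \<Rightarrow>
   (real \<times> real) set \<Rightarrow> (real \<times> real \<Rightarrow> 'p \<times> 'q) \<Rightarrow> bool" where
  "lagrangian \<epsilon> S1 S2 U f \<longleftrightarrow>
     (let M = product_mfd \<epsilon> S1 S2 in
      \<forall>x\<in>U. \<forall>a b. product_form \<epsilon> S1 S2 (chart_at M (f x)) (loc M f x x)
                     (push M f x a) (push M f x b) = 0)"

definition gram_det ::
  "('p, 'm::euclidean_space, 'i) metric_mfd \<Rightarrow> (real \<times> real \<Rightarrow> 'p) \<Rightarrow> real \<times> real \<Rightarrow> real" where
  "gram_det M f x =
     induced M f x (1,0) (1,0) * induced M f x (0,1) (0,1) - (induced M f x (1,0) (0,1))\<^sup>2"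

definition normal_part ::
  "('p, 'm::euclidean_space, 'i) metric_mfd \<Rightarrow> (real \<times> real \<Rightarrow> 'p) \<Rightarrow> real \<times> real \<Rightarrow> 'm \<Rightarrow> 'm" where
  "normal_part M f x w =
     (THE n. (\<forall>a. met_at M (f x) n (push M f x a) = 0) \<and> (\<exists>a. w = n + push M f x a))"

text \<open>Half the trace of the second fundamental form with respect to the induced metric.\<close>

definition mean_curvature ::
  "('p, 'm::euclidean_space, 'i) metric_mfd \<Rightarrow> (real \<times> real \<Rightarrow> 'p) \<Rightarrow> real \<times> real \<Rightarrow> 'm" where
  "mean_curvature M f x =
     (let h = (\<lambda>a b. normal_part M f x (cov M f x a b)); g = induced M f x in
      (1 / (2 * gram_det M f x)) *\<^sub>R
        (g (0,1) (0,1) *\<^sub>R h (1,0) (1,0) - (2 * g (1,0) (0,1)) *\<^sub>R h (1,0) (0,1)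
         + g (1,0) (1,0) *\<^sub>R h (0,1) (0,1)))"

definition minimal_surface ::
  "('p::topological_space, 'm::euclidean_space, 'i) metric_mfd \<Rightarrow>
   (real \<times> real) set \<Rightarrow> (real \<times> real \<Rightarrow> 'p) \<Rightarrow> bool" where
  "minimal_surface M U f \<longleftrightarrow>
     smooth_map M U f \<and> (\<forall>x\<in>U. gram_det M f x \<noteq> 0 \<and> mean_curvature M f x = 0)"


section \<open>Second variation of the area and stability\<close>

text \<open>
  Surfaces are parametrised by a product of two open intervals or circles, described as for
  curves by \<open>I1, L1\<close> and \<open>I2, L2\<close>; a circle of length \<open>L\<close> has the fundamental domain \<open>[0,L)\<close>.
\<close>

definition cell :: "real set \<Rightarrow> real \<Rightarrow> real set" where
  "cell I L = (if L = 0 then I else {0..<L})"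

text \<open>
  \<open>F t\<close>, for \<open>t\<close> in \<open>(-\<delta>,\<delta>)\<close>, is a smooth variation of \<open>f\<close> with support in the image of \<open>K\<close> in the
  parameter surface, and with normal velocity at time \<open>0\<close>.
\<close>

definition normal_variation ::
  "('p::topological_space, 'm::euclidean_space, 'i) metric_mfd \<Rightarrow>
   real set \<Rightarrow> real \<Rightarrow> real set \<Rightarrow> real \<Rightarrow> (real \<times> real \<Rightarrow> 'p) \<Rightarrow>
   real \<Rightarrow> (real \<times> real) set \<Rightarrow> (real \<Rightarrow> real \<times> real \<Rightarrow> 'p) \<Rightarrow> bool" where
  "normal_variation M I1 L1 I2 L2 f \<delta> K F \<longleftrightarrow>
     \<delta> > 0 \<and> compact K \<and> K \<subseteq> I1 \<times> I2 \<and>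
     smooth_map M ({-\<delta><..<\<delta>} \<times> (I1 \<times> I2)) (\<lambda>(t, x). F t x) \<and>
     (\<forall>t\<in>{-\<delta><..<\<delta>}. \<forall>s\<in>I1. \<forall>u\<in>I2. F t (s + L1, u) = F t (s, u) \<and> F t (s, u + L2) = F t (s, u)) \<and>
     (\<forall>x\<in>I1 \<times> I2. F 0 x = f x) \<and>
     (\<forall>t\<in>{-\<delta><..<\<delta>}. \<forall>x\<in>cell I1 L1 \<times> cell I2 L2 - K. F t x = f x) \<and>
     (\<forall>x\<in>I1 \<times> I2. \<forall>a.
        met_at M (f x) (push M (\<lambda>(t, x). F t x) (0, x) (1, 0)) (push M f x a) = 0)"

definition area ::
  "('p, 'm::euclidean_space, 'i) metric_mfd \<Rightarrow> (real \<times> real) set \<Rightarrow> (real \<times> real \<Rightarrow> 'p) \<Rightarrow> real" where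
  "area M A f = set_lebesgue_integral lborel A (\<lambda>x. sqrt \<bar>gram_det M f x\<bar>)"

definition second_variation ::
  "('p, 'm::euclidean_space, 'i) metric_mfd \<Rightarrow>
   (real \<times> real) set \<Rightarrow> (real \<Rightarrow> real \<times> real \<Rightarrow> 'p) \<Rightarrow> real" where
  "second_variation M A F = deriv (deriv (\<lambda>t. area M A (F t))) 0"

definition stable_surface ::
  "('p::topological_space, 'm::euclidean_space, 'i) metric_mfd \<Rightarrow>
   real set \<Rightarrow> real \<Rightarrow> real set \<Rightarrow> real \<Rightarrow> (real \<times> real \<Rightarrow> 'p) \<Rightarrow> bool" where
  "stable_surface M I1 L1 I2 L2 f \<longleftrightarrow>
     (\<forall>\<delta> K F. normal_variation M I1 L1 I2 L2 f \<delta> K F \<longrightarrow>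
        second_variation M ((cell I1 L1 \<times> cell I2 L2) \<inter> K) F \<ge> 0) \<or>
     (\<forall>\<delta> K F. normal_variation M I1 L1 I2 L2 f \<delta> K F \<longrightarrow>
        second_variation M ((cell I1 L1 \<times> cell I2 L2) \<inter> K) F \<le> 0)"

end

theory Submission
  imports Defs
begin

text \<open>
  Changing the sign of the metrics reduces the three cases to positive definite surfaces
  \<open>\<phi> \<times> \<psi>\<close> with \<open>\<kappa>\<^sub>1, \<kappa>\<^sub>2 \<le> 0\<close>, and there the second variation of the area is \<open>\<le> 0\<close>. Write the variation as
  \<open>F = (P, Q)\<close>, with parameters \<open>(t,s,u)\<close>. At time \<open>0\<close> all first \<open>t\<close>-derivatives of the induced metric vanish,
  because the velocity is normal and the factors are geodesics. For its \<open>ss\<close>-component, the Gauss equation gives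
  \<open>(1/2) \<partial>\<^sub>t\<^sup>2 \<langle>P\<^sub>s,P\<^sub>s\<rangle> = \<partial>\<^sub>s \<langle>\<nabla>\<^sub>tP\<^sub>t,P\<^sub>s\<rangle> + \<langle>R(P\<^sub>t,P\<^sub>s)P\<^sub>t,P\<^sub>s\<rangle> + \<langle>\<nabla>\<^sub>tP\<^sub>s,\<nabla>\<^sub>tP\<^sub>s\<rangle>\<close>.
  The curvature term has the sign of \<open>\<kappa>\<^sub>1\<close>, and the last term is \<open>\<le> 0\<close> because \<open>\<nabla>\<^sub>tP\<^sub>s\<close> is orthogonal to the
  spacelike vector \<open>P\<^sub>s\<close> of a Lorentzian plane, as is \<open>\<nabla>\<^sub>tQ\<^sub>s\<close> to \<open>Q\<^sub>u\<close>. Since the energies of the geodesics are constant,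
  the remaining derivative integrates to \<open>0\<close> over the support of the variation.
\<close>

section \<open>Calculus of smooth functions\<close>

text \<open>The sign change works because \<open>\<epsilon> = \<sigma>1 * \<sigma>2\<close> makes
  the product metric equal to \<open>\<sigma>1\<close> times the metric \<open>\<sigma>1\<close> g1
  + \<open>\<sigma>2\<close> g2: a two-by-two Gram determinant ignores the factor
  \<open>\<sigma>1\<close>, while the Gauss curvature of a factor changes sign with its metric. The
  factors decouple because the two tangent directions of the surface lie in different factors, so
  normality splits into P_t orthogonal to P_s and Q_t orthogonal to Q_u. Differentiating <P_t, P_s>
  = 0 along the geodesic gives the orthogonality on which the sign rests. Only the velocity at time
  0 is normal; the acceleration is arbitrary and has no sign, so it can disappear only by
  integration, and this needs constant weights in front of the two divergence terms. The obstacle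
  that shapes the proof is that a variation may leave any chart, whereas covariant derivatives are
  written in charts. Each pointwise fact is therefore proved in one chart and restated with
  derivatives of the induced metric, which is smooth in the parameters across charts.\<close>

lemma dderiv_eqI:
  "(f has_derivative f') (at x) \<Longrightarrow> dderiv f x v = f' v"
  by (metis frechet_derivative_at)

lemma dderiv_cong_open:
  assumes "open U" "x \<in> U" "\<And>y. y \<in> U \<Longrightarrow> f y = g y"
  shows "dderiv f x v = dderiv g x v"
proof -
  have "(f has_derivative D) (at x) \<longleftrightarrow> (g has_derivative D) (at x)" for D
    using has_derivative_transform_within_open[OF _ assms(1,2), of f D UNIV g]
      has_derivative_transform_within_open[OF _ assms(1,2), of g D UNIV f] assms(3) by auto
  then show ?thesis by (simp add: frechet_derivative_def)
qed

lemma differentiable_cong_open: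
  assumes "open U" "x \<in> U" "\<And>y. y \<in> U \<Longrightarrow> f y = g y" "f differentiable (at x)"
  shows "g differentiable (at x)"
  using has_derivative_transform_within_open[OF _ assms(1,2), of f _ UNIV g] assms(3,4)
  by (auto simp: differentiable_def)

section \<open>Closure properties of \<open>Ck_on\<close> and \<open>smooth_on\<close>\<close>

lemma Ck_on_SucD: "Ck_on (Suc k) U f \<Longrightarrow> Ck_on k U f"
proof (induction k arbitrary: f)
  case 0
  then show ?case
    by (auto intro!: continuous_at_imp_continuous_on differentiable_imp_continuous_within)
next
  case (Suc k)
  then have "\<And>v. Ck_on k U (\<lambda>x. dderiv f x v)" by (metis Ck_on.simps(2))
  with Suc.prems show ?case by simp
qed

lemma Ck_on_subset: "Ck_on k U f \<Longrightarrow> V \<subseteq> U \<Longrightarrow> Ck_on k V f"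
  by (induction k arbitrary: f) (auto intro: continuous_on_subset)

lemma Ck_on_cong:
  assumes "open U" "\<And>x. x \<in> U \<Longrightarrow> f x = g x" "Ck_on k U f"
  shows "Ck_on k U g"
  using assms(2,3)
proof (induction k arbitrary: f g)
  case 0
  then show ?case by (simp cong: continuous_on_cong)
next
  case (Suc k)
  have "Ck_on k U (\<lambda>x. dderiv g x v)" for v
    by (rule Suc.IH[of "\<lambda>x. dderiv f x v"])
      (use Suc.prems(2) dderiv_cong_open[OF assms(1) _ Suc.prems(1)] in auto)
  moreover have "g differentiable (at x)" if "x \<in> U" for x
    using differentiable_cong_open[OF assms(1) that Suc.prems(1)] Suc.prems(2) that by simp
  ultimately show ?case by simp
qed

text \<open>Continuity and differentiability are local, and the directional derivatives are taken of
  the same global function, so the induction carries the hypothesis along. This allows smoothness to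
  be checked chart by chart.\<close>

lemma Ck_on_local:
  assumes "\<And>x. x \<in> U \<Longrightarrow> \<exists>N. open N \<and> x \<in> N \<and> Ck_on k N f"
  shows "Ck_on k U f"
  using assms
proof (induction k arbitrary: f)
  case 0
  have "isCont f x" if "x \<in> U" for x
    using 0[OF that] by (auto simp: continuous_on_eq_continuous_at)
  then show ?case by (simp add: continuous_at_imp_continuous_on)
next
  case (Suc k)
  have "Ck_on k U (\<lambda>x. dderiv f x v)" for v
    by (rule Suc.IH) (metis Suc.prems Ck_on.simps(2))
  moreover have "f differentiable (at x)" if "x \<in> U" for x
    using Suc.prems[OF that] by auto
  ultimately show ?case by simp
qed

lemma Ck_on_const: "Ck_on k U (\<lambda>x. c)"
proof (induction k arbitrary: c)
  case (Suc k)
  have "dderiv (\<lambda>x. c) x v = 0" for x v by (rule dderiv_eqI) (rule has_derivative_const)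
  with Suc show ?case by simp
qed simp

lemma Ck_on_bounded_linear:
  assumes "open U" "bounded_linear L" "Ck_on k U f"
  shows "Ck_on k U (\<lambda>x. L (f x))"
  using assms(3)
proof (induction k arbitrary: f)
  case 0
  then show ?case by (simp add: bounded_linear.continuous_on[OF assms(2)])
next
  case (Suc k)
  have d: "((\<lambda>x. L (f x)) has_derivative (\<lambda>v. L (dderiv f x v))) (at x)" if "x \<in> U" for x
    using Suc.prems that
    by (auto intro!: bounded_linear.has_derivative[OF assms(2)] simp: frechet_derivative_works[symmetric])
  have "Ck_on k U (\<lambda>x. dderiv (\<lambda>x. L (f x)) x v)" for v
    by (rule Ck_on_cong[OF assms(1), of "\<lambda>x. L (dderiv f x v)"])
      (use Suc dderiv_eqI[OF d] in auto)
  with d show ?case by (auto simp: differentiable_def)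
qed

lemma Ck_on_add:
  assumes "open U" "Ck_on k U f" "Ck_on k U g"
  shows "Ck_on k U (\<lambda>x. f x + g x)"
  using assms(2,3)
proof (induction k arbitrary: f g)
  case 0
  then show ?case by (simp add: continuous_on_add)
next
  case (Suc k)
  have d: "((\<lambda>x. f x + g x) has_derivative (\<lambda>v. dderiv f x v + dderiv g x v)) (at x)" if "x \<in> U" for x
    using Suc.prems that
    by (auto intro!: has_derivative_add simp: frechet_derivative_works[symmetric])
  have "Ck_on k U (\<lambda>x. dderiv (\<lambda>x. f x + g x) x v)" for v
    by (rule Ck_on_cong[OF assms(1), of "\<lambda>x. dderiv f x v + dderiv g x v"])
      (use Suc dderiv_eqI[OF d] in auto)
  with d show ?case by (auto simp: differentiable_def)
qed

lemma Ck_on_sum: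
  assumes "open U" "\<And>i. i \<in> A \<Longrightarrow> Ck_on k U (f i)"
  shows "Ck_on k U (\<lambda>x. \<Sum>i\<in>A. f i x)"
  using assms(2)
  by (induction A rule: infinite_finite_induct) (auto intro: Ck_on_const Ck_on_add[OF assms(1)])

lemma Ck_on_bilinear:
  assumes "open U" "bounded_bilinear B" "Ck_on k U f" "Ck_on k U g"
  shows "Ck_on k U (\<lambda>x. B (f x) (g x))"
  using assms(3,4)
proof (induction k arbitrary: f g)
  case 0
  then show ?case by (simp add: bounded_bilinear.continuous_on[OF assms(2)])
next
  case (Suc k)
  have d: "((\<lambda>x. B (f x) (g x)) has_derivative (\<lambda>v. B (f x) (dderiv g x v) + B (dderiv f x v) (g x))) (at x)"
    if "x \<in> U" for x
    using Suc.prems that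
    by (auto intro!: bounded_bilinear.FDERIV[OF assms(2)] simp: frechet_derivative_works[symmetric])
  have "Ck_on k U (\<lambda>x. dderiv (\<lambda>x. B (f x) (g x)) x v)" for v
    by (rule Ck_on_cong[OF assms(1), of "\<lambda>x. B (f x) (dderiv g x v) + B (dderiv f x v) (g x)"])
      (use Suc dderiv_eqI[OF d] Ck_on_SucD[OF Suc.prems(1)] Ck_on_SucD[OF Suc.prems(2)]
       in \<open>auto intro!: Ck_on_add[OF assms(1)]\<close>)
  with d show ?case by (auto simp: differentiable_def)
qed

lemma dderiv_compose:
  assumes "f differentiable (at x)" "g differentiable (at (f x))"
  shows "((\<lambda>x. g (f x)) has_derivative (\<lambda>v. dderiv g (f x) (dderiv f x v))) (at x)"
  using has_derivative_compose[of f _ x UNIV g] assms by (simp add: frechet_derivative_works)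

lemma linear_dderiv: "f differentiable (at x) \<Longrightarrow> linear (\<lambda>v. dderiv f x v)"
  using bounded_linear.linear has_derivative_bounded_linear frechet_derivative_works by blast

lemma linear_expand:
  fixes L :: "'a::euclidean_space \<Rightarrow> 'b::real_vector"
  assumes "linear L" shows "L v = (\<Sum>b\<in>Basis. (v \<bullet> b) *\<^sub>R L b)"
  by (subst euclidean_representation[of v, symmetric])
    (simp only: linear_sum[OF assms] linear_cmul[OF assms])

text \<open>The induction runs over \<open>g\<close> with \<open>f\<close> fixed. Expanding the
  direction \<open>dderiv f x v\<close> in the basis leaves only the functions
  \<open>\<lambda>y. dderiv g y b\<close> with constant \<open>b\<close>, to which the induction
  hypothesis applies.\<close>

lemma Ck_on_compose:
  fixes f :: "'a::real_normed_vector \<Rightarrow> 'b::euclidean_space" and g :: "'b \<Rightarrow> 'c::real_normed_vector"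
  assumes "open U" "open V" "f ` U \<subseteq> V" "Ck_on k U f" "Ck_on k V g"
  shows "Ck_on k U (\<lambda>x. g (f x))"
  using assms(4,5)
proof (induction k arbitrary: g)
  case 0
  then show ?case using continuous_on_compose2[of V g U f] assms(3) by auto
next
  case (Suc k)
  have d: "((\<lambda>x. g (f x)) has_derivative (\<lambda>v. dderiv g (f x) (dderiv f x v))) (at x)"
    if "x \<in> U" for x
    using Suc.prems that assms(3) by (intro dderiv_compose) auto
  have "Ck_on k U (\<lambda>x. dderiv (\<lambda>x. g (f x)) x v)" for v
  proof (rule Ck_on_cong[OF assms(1), of "\<lambda>x. \<Sum>b\<in>Basis. (dderiv f x v \<bullet> b) *\<^sub>R dderiv g (f x) b"])
    show "(\<Sum>b\<in>Basis. (dderiv f x v \<bullet> b) *\<^sub>R dderiv g (f x) b) = dderiv (\<lambda>x. g (f x)) x v"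
      if "x \<in> U" for x
      unfolding dderiv_eqI[OF d[OF that]]
      by (rule linear_expand[symmetric], rule linear_dderiv) (use Suc.prems that assms(3) in auto)
    have "Ck_on k U (\<lambda>x. dderiv g (f x) b)" for b
      using Suc.IH[of "\<lambda>y. dderiv g y b"] Suc.prems Ck_on_SucD by auto
    moreover have "Ck_on k U (\<lambda>x. dderiv f x v \<bullet> b)" for b
      using Suc.prems by (intro Ck_on_bounded_linear[OF assms(1) bounded_linear_inner_left]) simp
    ultimately show "Ck_on k U (\<lambda>x. \<Sum>b\<in>Basis. (dderiv f x v \<bullet> b) *\<^sub>R dderiv g (f x) b)"
      by (intro Ck_on_sum[OF assms(1)] Ck_on_bilinear[OF assms(1) bounded_bilinear_scaleR])
  qed
  with d show ?case by (auto simp: differentiable_def)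
qed

lemma smooth_on_differentiable: "smooth_on U f \<Longrightarrow> x \<in> U \<Longrightarrow> f differentiable (at x)"
  unfolding smooth_on_def using Ck_on.simps(2) by blast

lemma smooth_on_has_derivative:
  "smooth_on U f \<Longrightarrow> x \<in> U \<Longrightarrow> (f has_derivative (\<lambda>v. dderiv f x v)) (at x)"
  using smooth_on_differentiable frechet_derivative_works by blast

lemma smooth_on_continuous: "smooth_on U f \<Longrightarrow> continuous_on U f"
  unfolding smooth_on_def using Ck_on.simps(1) by blast

lemma smooth_on_dderiv: "smooth_on U f \<Longrightarrow> smooth_on U (\<lambda>x. dderiv f x v)"
  unfolding smooth_on_def using Ck_on.simps(2) by blast

lemma smooth_on_subset: "smooth_on U f \<Longrightarrow> V \<subseteq> U \<Longrightarrow> smooth_on V f"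
  unfolding smooth_on_def using Ck_on_subset by blast

lemma smooth_on_cong: "smooth_on U f \<Longrightarrow> open U \<Longrightarrow> (\<And>x. x \<in> U \<Longrightarrow> f x = g x) \<Longrightarrow> smooth_on U g"
  unfolding smooth_on_def using Ck_on_cong by blast

lemma smooth_on_local:
  "(\<And>x. x \<in> U \<Longrightarrow> \<exists>N. open N \<and> x \<in> N \<and> smooth_on N f) \<Longrightarrow> smooth_on U f"
  unfolding smooth_on_def by (meson Ck_on_local)

lemma smooth_on_const: "smooth_on U (\<lambda>x. c)"
  by (simp add: smooth_on_def Ck_on_const)

lemma smooth_on_bounded_linear:
  "bounded_linear L \<Longrightarrow> open U \<Longrightarrow> smooth_on U f \<Longrightarrow> smooth_on U (\<lambda>x. L (f x))"
  by (simp add: smooth_on_def Ck_on_bounded_linear)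

lemma smooth_on_id: "open U \<Longrightarrow> smooth_on U (\<lambda>x. x)"
  unfolding smooth_on_def
proof
  fix k assume "open U"
  have "dderiv (\<lambda>x. x) x v = v" for x v :: 'a by (rule dderiv_eqI) (rule has_derivative_ident)
  then show "Ck_on k U (\<lambda>x. x)" by (cases k) (auto simp: Ck_on_const continuous_on_id)
qed

lemma smooth_on_add: "open U \<Longrightarrow> smooth_on U f \<Longrightarrow> smooth_on U g \<Longrightarrow> smooth_on U (\<lambda>x. f x + g x)"
  by (simp add: smooth_on_def Ck_on_add)

lemma smooth_on_sum:
  "open U \<Longrightarrow> (\<And>i. i \<in> A \<Longrightarrow> smooth_on U (f i)) \<Longrightarrow> smooth_on U (\<lambda>x. \<Sum>i\<in>A. f i x)"
  by (simp add: smooth_on_def Ck_on_sum)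

lemma smooth_on_bilinear:
  "bounded_bilinear B \<Longrightarrow> open U \<Longrightarrow> smooth_on U f \<Longrightarrow> smooth_on U g \<Longrightarrow> smooth_on U (\<lambda>x. B (f x) (g x))"
  by (simp add: smooth_on_def Ck_on_bilinear)

lemmas smooth_on_scaleR = smooth_on_bilinear[OF bounded_bilinear_scaleR]
lemmas smooth_on_mult = smooth_on_bilinear[OF bounded_bilinear_mult]
lemmas smooth_on_inner_left = smooth_on_bounded_linear[OF bounded_linear_inner_left]
lemmas smooth_on_cmult = smooth_on_bounded_linear[OF bounded_linear_mult_right]

lemma smooth_on_diff:
  "open U \<Longrightarrow> smooth_on U f \<Longrightarrow> smooth_on U g \<Longrightarrow> smooth_on U (\<lambda>x. f x - g x)"
  using smooth_on_add[of U f "\<lambda>x. - g x"]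
    smooth_on_bounded_linear[OF bounded_linear_minus[OF bounded_linear_ident], of U g] by simp

lemma smooth_on_compose:
  fixes f :: "'a::real_normed_vector \<Rightarrow> 'b::euclidean_space" and g :: "'b \<Rightarrow> 'c::real_normed_vector"
  shows "smooth_on V g \<Longrightarrow> open U \<Longrightarrow> open V \<Longrightarrow> f ` U \<subseteq> V \<Longrightarrow> smooth_on U f \<Longrightarrow>
    smooth_on U (\<lambda>x. g (f x))"
  by (simp add: smooth_on_def Ck_on_compose)

text \<open>The derivative of the reciprocal is a product of the reciprocal itself and
  \<open>dderiv f\<close>, so each order of differentiability follows from the preceding
  one.\<close>

lemma smooth_on_inverse:
  fixes f :: "'a::real_normed_vector \<Rightarrow> real"
  assumes "open U" "smooth_on U f" "\<And>x. x \<in> U \<Longrightarrow> f x \<noteq> 0"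
  shows "smooth_on U (\<lambda>x. inverse (f x))"
  unfolding smooth_on_def
proof
  fix k show "Ck_on k U (\<lambda>x. inverse (f x))"
  proof (induction k)
    case 0
    then show ?case using assms smooth_on_continuous by (auto intro!: continuous_on_inverse)
  next
    case (Suc k)
    have d: "((\<lambda>x. inverse (f x)) has_derivative
        (\<lambda>v. - (inverse (f x) * dderiv f x v * inverse (f x)))) (at x)" if "x \<in> U" for x
      using Deriv.has_derivative_inverse[OF assms(3)[OF that] smooth_on_has_derivative[OF assms(2) that]] .
    have "Ck_on k U (\<lambda>x. dderiv (\<lambda>x. inverse (f x)) x v)" for v
    proof (rule Ck_on_cong[OF assms(1)])
      show "(- (1::real)) * (inverse (f x) * dderiv f x v * inverse (f x)) = dderiv (\<lambda>x. inverse (f x)) x v"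
        if "x \<in> U" for x using dderiv_eqI[OF d[OF that], of v] by simp
      show "Ck_on k U (\<lambda>x. (- (1::real)) * (inverse (f x) * dderiv f x v * inverse (f x)))"
        using Suc smooth_on_dderiv[OF assms(2)] unfolding smooth_on_def
        by (intro Ck_on_bilinear[OF assms(1) bounded_bilinear_mult] Ck_on_const) auto
    qed
    with d show ?case by (auto simp: differentiable_def)
  qed
qed

section \<open>Symmetry of second derivatives\<close>

lemma has_real_derivative_line:
  fixes f :: "'a::real_normed_vector \<Rightarrow> real"
  assumes "f differentiable (at (x + r *\<^sub>R v))"
  shows "((\<lambda>r. f (x + r *\<^sub>R v)) has_real_derivative dderiv f (x + r *\<^sub>R v) v) (at r)"
proof -
  have "((\<lambda>r. x + r *\<^sub>R v) has_derivative (\<lambda>h. h *\<^sub>R v)) (at r)"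
    by (auto intro!: derivative_eq_intros)
  from has_derivative_compose[OF this, of f] assms
  have "((\<lambda>r. f (x + r *\<^sub>R v)) has_derivative (\<lambda>h. dderiv f (x + r *\<^sub>R v) (h *\<^sub>R v))) (at r)"
    by (simp add: frechet_derivative_works)
  then show ?thesis
    by (simp add: has_field_derivative_def linear_cmul[OF linear_dderiv[OF assms]] mult.commute[of _ "dderiv _ _ _"]
        cong: if_cong)
qed

text \<open>Two mean value steps express the second difference of \<open>f\<close> at scale \<open>h\<close> by \<open>\<partial>\<^sub>b\<partial>\<^sub>a f\<close>.\<close>

lemma second_difference_mvt:
  fixes f :: "'a::real_normed_vector \<Rightarrow> real"
  assumes "0 < h"
    and f: "\<And>r q. 0 \<le> r \<Longrightarrow> r \<le> h \<Longrightarrow> 0 \<le> q \<Longrightarrow> q \<le> h \<Longrightarrow> f differentiable (at (x + r *\<^sub>R a + q *\<^sub>R b))"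
    and fa: "\<And>r q. 0 \<le> r \<Longrightarrow> r \<le> h \<Longrightarrow> 0 \<le> q \<Longrightarrow> q \<le> h \<Longrightarrow>
      (\<lambda>y. dderiv f y a) differentiable (at (x + r *\<^sub>R a + q *\<^sub>R b))"
  obtains r q where "0 \<le> r" "r \<le> h" "0 \<le> q" "q \<le> h"
    "f (x + h *\<^sub>R a + h *\<^sub>R b) - f (x + h *\<^sub>R a) - f (x + h *\<^sub>R b) + f x
       = h * h * dderiv (\<lambda>y. dderiv f y a) (x + r *\<^sub>R a + q *\<^sub>R b) b"
proof -
  define u where "u = (\<lambda>r. f ((x + h *\<^sub>R b) + r *\<^sub>R a) - f (x + r *\<^sub>R a))"
  have "(u has_real_derivative (dderiv f ((x + h *\<^sub>R b) + r *\<^sub>R a) a - dderiv f (x + r *\<^sub>R a) a)) (at r)"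
    if "0 \<le> r" "r \<le> h" for r
    unfolding u_def using f[OF that, of h] f[OF that, of 0] \<open>0 < h\<close>
    by (intro DERIV_diff has_real_derivative_line) (simp_all add: algebra_simps)
  from MVT2[OF \<open>0 < h\<close> this] obtain r where r: "0 < r" "r < h" and
    1: "u h - u 0 = h * (dderiv f ((x + h *\<^sub>R b) + r *\<^sub>R a) a - dderiv f (x + r *\<^sub>R a) a)" by auto
  define w where "w = (\<lambda>q. dderiv f ((x + r *\<^sub>R a) + q *\<^sub>R b) a)"
  have "(w has_real_derivative dderiv (\<lambda>y. dderiv f y a) ((x + r *\<^sub>R a) + q *\<^sub>R b) b) (at q)"
    if "0 \<le> q" "q \<le> h" for q
    unfolding w_def using fa[of r q] that r by (intro has_real_derivative_line[where f="\<lambda>y. dderiv f y a"]) auto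
  from MVT2[OF \<open>0 < h\<close> this] obtain q where q: "0 < q" "q < h" and
    2: "w h - w 0 = h * dderiv (\<lambda>y. dderiv f y a) ((x + r *\<^sub>R a) + q *\<^sub>R b) b" by auto
  have "u h - u 0 = h * (w h - w 0)"
    unfolding 1 by (simp add: w_def algebra_simps)
  then have "u h - u 0 = h * h * dderiv (\<lambda>y. dderiv f y a) (x + r *\<^sub>R a + q *\<^sub>R b) b"
    by (simp add: 2)
  then show ?thesis using r q
    by (intro that[of r q]) (auto simp: u_def algebra_simps)
qed

text \<open>The second difference is symmetric in \<open>a\<close> and \<open>b\<close>. The mean
  value steps write it as \<open>h * h\<close> times a value of either mixed derivative at a point
  close to \<open>x\<close>, and continuity at \<open>x\<close> lets the two values be compared
  there.\<close>

lemma dderiv_commute_real: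
  fixes f :: "'a::real_normed_vector \<Rightarrow> real"
  assumes "open U" "smooth_on U f" "x \<in> U"
  shows "dderiv (\<lambda>y. dderiv f y a) x b = dderiv (\<lambda>y. dderiv f y b) x a"
proof -
  define A where "A = (\<lambda>y. dderiv (\<lambda>y. dderiv f y a) y b)"
  define B where "B = (\<lambda>y. dderiv (\<lambda>y. dderiv f y b) y a)"
  have cont: "isCont A x" "isCont B x"
    using smooth_on_continuous[OF smooth_on_dderiv[OF smooth_on_dderiv[OF assms(2)]]] assms(1,3)
    by (auto simp: A_def B_def continuous_on_eq_continuous_at)
  obtain e0 where e0: "0 < e0" "ball x e0 \<subseteq> U" using assms(1,3) openE by blast
  have "\<bar>A x - B x\<bar> \<le> e" if "0 < e" for e
  proof -
    obtain d1 where d1: "0 < d1" "\<And>y. dist y x < d1 \<Longrightarrow> \<bar>A y - A x\<bar> < e/2"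
      using cont(1)[unfolded continuous_at_eps_delta, rule_format, OF half_gt_zero[OF \<open>0 < e\<close>]] that
      unfolding dist_real_def by blast
    obtain d2 where d2: "0 < d2" "\<And>y. dist y x < d2 \<Longrightarrow> \<bar>B y - B x\<bar> < e/2"
      using cont(2)[unfolded continuous_at_eps_delta, rule_format, OF half_gt_zero[OF \<open>0 < e\<close>]] that
      unfolding dist_real_def by blast
    define d where "d = min e0 (min d1 d2)"
    \<comment> \<open>Keeps the parallelogram with sides \<open>h *\<^sub>R a\<close> and
      \<open>h *\<^sub>R b\<close> within distance \<open>d\<close> of \<open>x\<close>; the summand
      1 covers \<open>a = b = 0\<close>.\<close>
    define h where "h = d / (2 * (norm a + norm b + 1))"
    have pos: "0 < norm a + norm b + 1" by (simp add: add_nonneg_pos)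
    have "0 < d" using e0 d1 d2 by (simp add: d_def)
    then have "0 < h" using pos by (simp add: h_def)
    have *: "dist (x + r *\<^sub>R a + q *\<^sub>R b) x < d"
      if "0 \<le> r" "r \<le> h" "0 \<le> q" "q \<le> h" for r q
    proof -
      have "norm (r *\<^sub>R a + q *\<^sub>R b) \<le> h * norm a + h * norm b"
        using that by (intro norm_triangle_le add_mono) (auto intro: mult_right_mono)
      also have "\<dots> < 2 * h * (norm a + norm b + 1)"
        using \<open>0 < h\<close> by (simp add: algebra_simps add_nonneg_pos)
      also have "\<dots> = d" using pos unfolding h_def by (simp add: divide_simps)
      finally show ?thesis by (simp add: dist_norm algebra_simps)
    qed
    have inU: "x + r *\<^sub>R a + q *\<^sub>R b \<in> U" "x + r *\<^sub>R b + q *\<^sub>R a \<in> U"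
      if "0 \<le> r" "r \<le> h" "0 \<le> q" "q \<le> h" for r q
      using *[OF that] *[OF that(3,4,1,2)] e0(2)
      by (auto simp: d_def dist_commute subset_eq algebra_simps)
    note diff = smooth_on_differentiable[OF assms(2)] smooth_on_differentiable[OF smooth_on_dderiv[OF assms(2)]]
    obtain r q where 1: "0 \<le> r" "r \<le> h" "0 \<le> q" "q \<le> h"
      "f (x + h *\<^sub>R a + h *\<^sub>R b) - f (x + h *\<^sub>R a) - f (x + h *\<^sub>R b) + f x
       = h * h * A (x + r *\<^sub>R a + q *\<^sub>R b)"
      unfolding A_def
      by (rule second_difference_mvt[where a=a and b=b and f=f and x=x and h=h])
         (use \<open>0 < h\<close> inU diff in auto)
    obtain r' q' where 2: "0 \<le> r'" "r' \<le> h" "0 \<le> q'" "q' \<le> h"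
      "f (x + h *\<^sub>R b + h *\<^sub>R a) - f (x + h *\<^sub>R b) - f (x + h *\<^sub>R a) + f x
       = h * h * B (x + r' *\<^sub>R b + q' *\<^sub>R a)"
      unfolding B_def
      by (rule second_difference_mvt[where a=b and b=a and f=f and x=x and h=h])
         (use \<open>0 < h\<close> inU diff in auto)
    have "h * h * A (x + r *\<^sub>R a + q *\<^sub>R b) = h * h * B (x + r' *\<^sub>R b + q' *\<^sub>R a)"
      unfolding 1(5)[symmetric] 2(5)[symmetric] by (simp add: algebra_simps)
    then have "A (x + r *\<^sub>R a + q *\<^sub>R b) = B (x + r' *\<^sub>R b + q' *\<^sub>R a)" using \<open>0 < h\<close> by simp
    moreover have "\<bar>A (x + r *\<^sub>R a + q *\<^sub>R b) - A x\<bar> < e/2"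
      using *[OF 1(1-4)] by (intro d1) (simp add: d_def)
    moreover have "\<bar>B (x + r' *\<^sub>R b + q' *\<^sub>R a) - B x\<bar> < e/2"
      using *[OF 2(3,4,1,2)] by (intro d2) (simp add: d_def algebra_simps)
    ultimately show ?thesis by linarith
  qed
  then have "\<bar>A x - B x\<bar> \<le> 0" by (meson dense_ge)
  then show ?thesis by (simp add: A_def B_def)
qed

lemma dderiv_inner:
  assumes "f differentiable (at x)"
  shows "dderiv (\<lambda>y. f y \<bullet> c) x v = dderiv f x v \<bullet> c"
  by (rule dderiv_eqI) (use assms in \<open>auto intro!: bounded_linear.has_derivative[OF bounded_linear_inner_left] simp: frechet_derivative_works[symmetric]\<close>)

lemma dderiv_commute:
  fixes f :: "'a::real_normed_vector \<Rightarrow> 'b::euclidean_space"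
  assumes "open U" "smooth_on U f" "x \<in> U"
  shows "dderiv (\<lambda>y. dderiv f y a) x b = dderiv (\<lambda>y. dderiv f y b) x a"
proof (rule euclidean_eqI)
  fix c :: 'b
  have *: "dderiv (\<lambda>y. dderiv f y a) x b \<bullet> c = dderiv (\<lambda>y. dderiv (\<lambda>y. f y \<bullet> c) y a) x b" for a b
  proof -
    have "dderiv (\<lambda>y. dderiv f y a) x b \<bullet> c = dderiv (\<lambda>y. dderiv f y a \<bullet> c) x b"
      by (rule dderiv_inner[symmetric]) (rule smooth_on_differentiable[OF smooth_on_dderiv[OF assms(2)] assms(3)])
    also have "\<dots> = dderiv (\<lambda>y. dderiv (\<lambda>y. f y \<bullet> c) y a) x b"
      by (rule dderiv_cong_open[OF assms(1,3)]) (simp add: dderiv_inner smooth_on_differentiable[OF assms(2)])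
    finally show ?thesis .
  qed
  show "dderiv (\<lambda>y. dderiv f y a) x b \<bullet> c = dderiv (\<lambda>y. dderiv f y b) x a \<bullet> c"
    unfolding * by (rule dderiv_commute_real[OF assms(1) smooth_on_inner_left[OF assms(1,2)] assms(3)])
qed

section \<open>Lorentzian metrics in coordinates\<close>

lemma bilinear_expand:
  fixes B :: "'m::euclidean_space \<Rightarrow> 'n::euclidean_space \<Rightarrow> 'c::real_vector"
  assumes "bilinear B"
  shows "B u v = (\<Sum>b\<in>Basis. \<Sum>c\<in>Basis. ((u \<bullet> b) * (v \<bullet> c)) *\<^sub>R B b c)"
proof -
  have "B u v = (\<Sum>b\<in>Basis. (u \<bullet> b) *\<^sub>R B b v)"
    by (rule linear_expand) (use assms in \<open>simp add: bilinear_def\<close>)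
  also have "\<dots> = (\<Sum>b\<in>Basis. (u \<bullet> b) *\<^sub>R (\<Sum>c\<in>Basis. (v \<bullet> c) *\<^sub>R B b c))"
    using assms by (intro sum.cong refl arg_cong[where f="scaleR _"] linear_expand) (simp add: bilinear_def)
  finally show ?thesis by (simp add: scaleR_sum_right)
qed

text \<open>Smoothness of \<open>B\<close> is known only for constant arguments; the basis expansion
  reduces moving arguments to that case. It serves the metric as well as the Christoffel
  symbols.\<close>

lemma smooth_on_bilinear_family:
  fixes B :: "'m::euclidean_space \<Rightarrow> 'n::euclidean_space \<Rightarrow> 'o::euclidean_space \<Rightarrow> 'c::real_normed_vector"
  assumes "open U" "open V" "p ` U \<subseteq> V" "\<And>y. y \<in> V \<Longrightarrow> bilinear (B y)"
    "\<And>u v. smooth_on V (\<lambda>y. B y u v)" "smooth_on U p" "smooth_on U X" "smooth_on U Y"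
  shows "smooth_on U (\<lambda>x. B (p x) (X x) (Y x))"
proof (rule smooth_on_cong[OF _ assms(1)])
  show "(\<Sum>b\<in>Basis. \<Sum>c\<in>Basis. ((X x \<bullet> b) * (Y x \<bullet> c)) *\<^sub>R B (p x) b c) = B (p x) (X x) (Y x)"
    if "x \<in> U" for x
    by (rule bilinear_expand[symmetric]) (use assms that in auto)
  have "smooth_on U (\<lambda>x. B (p x) b c)" for b c
    by (rule smooth_on_compose[OF assms(5,1-3,6)])
  then show "smooth_on U (\<lambda>x. \<Sum>b\<in>Basis. \<Sum>c\<in>Basis. ((X x \<bullet> b) * (Y x \<bullet> c)) *\<^sub>R B (p x) b c)"
    using assms(7,8)
    by (intro smooth_on_sum smooth_on_scaleR smooth_on_mult smooth_on_inner_left assms(1))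
qed

text \<open>Leibniz rule with three moving parts: each term of the basis expansion has three
  factors, and the terms in which the base point moves sum back to the derivative of
  \<open>B\<close> with both arguments frozen.\<close>

lemma dderiv_bilinear_family:
  fixes B :: "'m::euclidean_space \<Rightarrow> 'n::euclidean_space \<Rightarrow> 'o::euclidean_space \<Rightarrow> 'c::real_normed_vector"
  assumes U: "open U" "x \<in> U" and p: "p ` U \<subseteq> V" "p differentiable (at x)"
    and bil: "\<And>y. y \<in> V \<Longrightarrow> bilinear (B y)"
    and B: "\<And>u v. (\<lambda>y. B y u v) differentiable (at (p x))"
    and X: "X differentiable (at x)" and Y: "Y differentiable (at x)"
    and V: "open V"
  shows "dderiv (\<lambda>x. B (p x) (X x) (Y x)) x h =
    dderiv (\<lambda>y. B y (X x) (Y x)) (p x) (dderiv p x h)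
    + B (p x) (dderiv X x h) (Y x) + B (p x) (X x) (dderiv Y x h)"
proof -
  let ?D = "\<lambda>b c h. ((X x \<bullet> b) * (Y x \<bullet> c)) *\<^sub>R dderiv (\<lambda>y. B y b c) (p x) (dderiv p x h)
     + ((dderiv X x h \<bullet> b) * (Y x \<bullet> c)) *\<^sub>R B (p x) b c
     + ((X x \<bullet> b) * (dderiv Y x h \<bullet> c)) *\<^sub>R B (p x) b c"
  have px: "p x \<in> V" using U(2) p(1) by auto
  have inner: "((\<lambda>x. X x \<bullet> b) has_derivative (\<lambda>h. dderiv X x h \<bullet> b)) (at x)"
    "((\<lambda>x. Y x \<bullet> c) has_derivative (\<lambda>h. dderiv Y x h \<bullet> c)) (at x)" for b c
    using X Y by (auto intro!: bounded_linear.has_derivative[OF bounded_linear_inner_left]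
        simp: frechet_derivative_works[symmetric])
  have Bp: "((\<lambda>x. B (p x) b c) has_derivative (\<lambda>h. dderiv (\<lambda>y. B y b c) (p x) (dderiv p x h))) (at x)" for b c
    by (rule dderiv_compose[OF p(2) B])
  have "((\<lambda>x. ((X x \<bullet> b) * (Y x \<bullet> c)) *\<^sub>R B (p x) b c) has_derivative ?D b c) (at x)" for b c
    by (rule has_derivative_eq_rhs[OF has_derivative_scaleR[OF has_derivative_mult[OF inner] Bp]])
      (simp add: fun_eq_iff algebra_simps)
  then have "((\<lambda>x. \<Sum>b\<in>Basis. \<Sum>c\<in>Basis. ((X x \<bullet> b) * (Y x \<bullet> c)) *\<^sub>R B (p x) b c)
      has_derivative (\<lambda>h. \<Sum>b\<in>Basis. \<Sum>c\<in>Basis. ?D b c h)) (at x)"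
    by (intro has_derivative_sum)
  then have *: "((\<lambda>x. B (p x) (X x) (Y x)) has_derivative (\<lambda>h. \<Sum>b\<in>Basis. \<Sum>c\<in>Basis. ?D b c h)) (at x)"
    by (rule has_derivative_transform_within_open[OF _ U])
      (use p bil in \<open>auto intro!: bilinear_expand[symmetric]\<close>)
  have "((\<lambda>y. \<Sum>b\<in>Basis. \<Sum>c\<in>Basis. ((X x \<bullet> b) * (Y x \<bullet> c)) *\<^sub>R B y b c) has_derivative
      (\<lambda>h. \<Sum>b\<in>Basis. \<Sum>c\<in>Basis. ((X x \<bullet> b) * (Y x \<bullet> c)) *\<^sub>R dderiv (\<lambda>y. B y b c) (p x) h)) (at (p x))"
    using B by (intro has_derivative_sum has_derivative_scaleR_right) (simp add: frechet_derivative_works)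
  then have "((\<lambda>y. B y (X x) (Y x)) has_derivative
      (\<lambda>h. \<Sum>b\<in>Basis. \<Sum>c\<in>Basis. ((X x \<bullet> b) * (Y x \<bullet> c)) *\<^sub>R dderiv (\<lambda>y. B y b c) (p x) h)) (at (p x))"
    by (rule has_derivative_transform_within_open[OF _ V px])
      (use bil in \<open>auto intro!: bilinear_expand[symmetric]\<close>)
  then have 1: "dderiv (\<lambda>y. B y (X x) (Y x)) (p x) (dderiv p x h) =
      (\<Sum>b\<in>Basis. \<Sum>c\<in>Basis. ((X x \<bullet> b) * (Y x \<bullet> c)) *\<^sub>R dderiv (\<lambda>y. B y b c) (p x) (dderiv p x h))"
    by (rule dderiv_eqI)
  show ?thesis
    unfolding dderiv_eqI[OF *] 1 bilinear_expand[OF bil[OF px], of "dderiv X x h" "Y x"]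
      bilinear_expand[OF bil[OF px], of "X x" "dderiv Y x h"]
    by (simp add: sum.distrib)
qed

lemma linear_dderiv_family:
  fixes B :: "'m::real_normed_vector \<Rightarrow> 'n::real_vector \<Rightarrow> 'o::real_vector \<Rightarrow> 'c::real_normed_vector"
  assumes "open V" "x \<in> V" "\<And>y. y \<in> V \<Longrightarrow> bilinear (B y)"
    "\<And>u v. (\<lambda>y. B y u v) differentiable (at x)"
  shows "linear (\<lambda>v. dderiv (\<lambda>y. B y u v) x h)" "linear (\<lambda>u. dderiv (\<lambda>y. B y u v) x h)"
proof -
  have *: "linear (\<lambda>v. dderiv (\<lambda>y. L y v) x h)"
    if L: "\<And>y. y \<in> V \<Longrightarrow> linear (L y)" "\<And>v. (\<lambda>y. L y v) differentiable (at x)"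
    for L :: "'m \<Rightarrow> 'e::real_vector \<Rightarrow> 'c"
  proof (rule linearI)
    have D: "((\<lambda>y. L y v) has_derivative frechet_derivative (\<lambda>y. L y v) (at x)) (at x)" for v
      using L(2) by (simp add: frechet_derivative_works)
    fix v w :: 'e and c :: real
    have "dderiv (\<lambda>y. L y (v + w)) x h = dderiv (\<lambda>y. L y v + L y w) x h"
      by (rule dderiv_cong_open[OF assms(1,2)]) (simp add: linear_add[OF L(1)])
    also have "\<dots> = dderiv (\<lambda>y. L y v) x h + dderiv (\<lambda>y. L y w) x h"
      by (rule dderiv_eqI) (intro has_derivative_add D)
    finally show "dderiv (\<lambda>y. L y (v + w)) x h = dderiv (\<lambda>y. L y v) x h + dderiv (\<lambda>y. L y w) x h" .
    have "dderiv (\<lambda>y. L y (c *\<^sub>R v)) x h = dderiv (\<lambda>y. c *\<^sub>R L y v) x h"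
      by (rule dderiv_cong_open[OF assms(1,2)]) (simp add: linear_cmul[OF L(1)])
    also have "\<dots> = c *\<^sub>R dderiv (\<lambda>y. L y v) x h"
      by (rule dderiv_eqI) (intro has_derivative_scaleR_right D)
    finally show "dderiv (\<lambda>y. L y (c *\<^sub>R v)) x h = c *\<^sub>R dderiv (\<lambda>y. L y v) x h" .
  qed
  show "linear (\<lambda>v. dderiv (\<lambda>y. B y u v) x h)" "linear (\<lambda>u. dderiv (\<lambda>y. B y u v) x h)"
    using *[of "\<lambda>y v. B y u v"] *[of "\<lambda>y u. B y u v"] assms(3,4) by (simp_all add: bilinear_def)
qed

section \<open>The Levi-Civita connection of a Lorentzian metric on a plane domain\<close>

abbreviation e1 :: "real^2" where "e1 \<equiv> axis 1 1"
abbreviation e2 :: "real^2" where "e2 \<equiv> axis 2 1"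

lemma vec2_expand: "v = v $ 1 *\<^sub>R e1 + v $ 2 *\<^sub>R e2" for v :: "real^2"
  by (simp add: vec_eq_iff forall_2 axis_def)

locale lorentz_metric =
  fixes V :: "(real^2) set" and g :: "real^2 \<Rightarrow> real^2 \<Rightarrow> real^2 \<Rightarrow> real"
  assumes open_V: "open V"
    and bil: "\<And>x. x \<in> V \<Longrightarrow> bilinear (g x)"
    and sym: "\<And>x u v. x \<in> V \<Longrightarrow> g x u v = g x v u"
    and smooth: "\<And>u v. smooth_on V (\<lambda>x. g x u v)"
    and signature: "\<And>x. x \<in> V \<Longrightarrow> \<exists>u v. g x u u > 0 \<and> g x u v = 0 \<and> g x v v < 0"
begin

lemmas g_simps = bilinear_ladd[OF bil] bilinear_radd[OF bil] bilinear_lmul[OF bil] bilinear_rmul[OF bil]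
  bilinear_lsub[OF bil] bilinear_rsub[OF bil] bilinear_lzero[OF bil] bilinear_rzero[OF bil]
  bilinear_lneg[OF bil] bilinear_rneg[OF bil]

definition gram :: "real^2 \<Rightarrow> real" where
  "gram x = g x e1 e1 * g x e2 e2 - (g x e1 e2)\<^sup>2"

lemma g_expand:
  assumes "x \<in> V"
  shows "g x u v = u$1 * v$1 * g x e1 e1 + (u$1 * v$2 + u$2 * v$1) * g x e1 e2 + u$2 * v$2 * g x e2 e2"
proof -
  have "g x u v = g x (u $ 1 *\<^sub>R e1 + u $ 2 *\<^sub>R e2) (v $ 1 *\<^sub>R e1 + v $ 2 *\<^sub>R e2)"
    by (simp only: vec2_expand[symmetric])
  then show ?thesis using sym[OF assms, of e2 e1] assms by (simp add: g_simps algebra_simps)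
qed

text \<open>Source of the sign arguments: passing to other vectors multiplies the Gram determinant
  by a square, so a nonzero one always has the sign of \<open>gram\<close>.\<close>

lemma gram_transform:
  assumes "x \<in> V"
  shows "g x u u * g x v v - (g x u v)\<^sup>2 = (u$1 * v$2 - u$2 * v$1)\<^sup>2 * gram x"
proof -
  have "(u1 * u1 * E + (u1 * u2 + u2 * u1) * F + u2 * u2 * H)  *  (v1 * v1 * E + (v1 * v2 + v2 * v1) * F + v2 * v2 * H)
    - (u1 * v1 * E + (u1 * v2 + u2 * v1) * F + u2 * v2 * H)\<^sup>2 = (u1 * v2 - u2 * v1)\<^sup>2  *  (E * H - F\<^sup>2)"
    for u1 u2 v1 v2 E F H :: real by algebra
  then show ?thesis
    by (simp only: g_expand[OF assms, of u u] g_expand[OF assms, of v v] g_expand[OF assms, of u v] gram_def)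
qed

lemma gram_neg:
  assumes "x \<in> V" shows "gram x < 0"
proof -
  obtain u v where "g x u u > 0" "g x u v = 0" "g x v v < 0" using signature[OF assms] by blast
  then have "g x u u * g x v v - (g x u v)\<^sup>2 < 0" by (simp add: mult_pos_neg)
  then have "(u$1 * v$2 - u$2 * v$1)\<^sup>2 * gram x < 0" by (simp add: gram_transform[OF assms])
  then show ?thesis by (simp add: mult_less_0_iff not_less)
qed

text \<open>For orthogonal vectors the Gram determinant is the product of the two squares, and it is
  never positive in a Lorentzian plane.\<close>

lemma orthogonal_opposite_sign:
  assumes "x \<in> V" "g x u v = 0" "\<sigma> * g x v v > 0"
  shows "\<sigma> * g x u u \<le> 0"
proof -
  have "g x u u * g x v v \<le> 0"
    using gram_transform[OF assms(1), of u v] gram_neg[OF assms(1)] assms(2)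
    by (simp add: mult_nonneg_nonpos)
  then have "\<sigma>\<^sup>2 * (g x u u * g x v v) \<le> 0" by (simp add: mult_nonneg_nonpos)
  then have "(\<sigma> * g x u u) * (\<sigma> * g x v v) \<le> 0" by (simp add: power2_eq_square algebra_simps)
  then show ?thesis using assms(3) mult_pos_pos[of "\<sigma> * g x u u" "\<sigma> * g x v v"] by linarith
qed

text \<open>A vector orthogonal to everything has zero Gram determinant with every \<open>z\<close>;
  since \<open>gram\<close> is nonzero, the vector is parallel to both \<open>e1\<close> and
  \<open>e2\<close>.\<close>

lemma nondegenerate:
  assumes "x \<in> V" "\<And>z. g x w z = g x w' z" shows "w = w'"
proof -
  let ?u = "w - w'"
  have 0: "g x ?u z = 0" for z using assms by (simp add: g_simps)
  have "(?u$1 * z$2 - ?u$2 * z$1)\<^sup>2 * gram x = 0" for z :: "real^2"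
    by (simp only: gram_transform[OF assms(1), symmetric] 0) simp
  then have "?u$1 * z$2 - ?u$2 * z$1 = 0" for z :: "real^2"
    using gram_neg[OF assms(1)] by (metis mult_eq_0_iff less_irrefl power_eq_0_iff)
  from this[of e1] this[of e2] have "?u$1 = 0" "?u$2 = 0" by (auto simp: axis_def)
  then show ?thesis by (simp add: vec_eq_iff forall_2)
qed

lemma g_differentiable: "x \<in> V \<Longrightarrow> (\<lambda>x. g x u v) differentiable (at x)"
  by (rule smooth_on_differentiable[OF smooth])

text \<open>Twice the Christoffel symbol with lowered index: the Koszul formula for constant
  coordinate fields, whose brackets vanish.\<close>

definition koszul :: "real^2 \<Rightarrow> real^2 \<Rightarrow> real^2 \<Rightarrow> real^2 \<Rightarrow> real" where
  "koszul x u v z = dderiv (\<lambda>y. g y v z) x u + dderiv (\<lambda>y. g y u z) x v - dderiv (\<lambda>y. g y u v) x z"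

lemma linear_dderiv_g:
  assumes "x \<in> V"
  shows "linear (\<lambda>v. dderiv (\<lambda>y. g y u v) x h)" "linear (\<lambda>u. dderiv (\<lambda>y. g y u v) x h)"
    "linear (\<lambda>h. dderiv (\<lambda>y. g y u v) x h)"
  using bil
  by (intro linear_dderiv_family(1)[where B=g and V=V] linear_dderiv_family(2)[where B=g and V=V]
      linear_dderiv g_differentiable open_V assms; assumption)+

lemmas dderiv_g_simps = linear_dderiv_g[THEN linear_add] linear_dderiv_g[THEN linear_cmul]

lemma koszul_simps:
  assumes "x \<in> V"
  shows "koszul x (u + u') v z = koszul x u v z + koszul x u' v z"
    "koszul x u (v + v') z = koszul x u v z + koszul x u v' z"
    "koszul x u v (z + z') = koszul x u v z + koszul x u v z'"
    "koszul x (c *\<^sub>R u) v z = c * koszul x u v z"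
    "koszul x u (c *\<^sub>R v) z = c * koszul x u v z"
    "koszul x u v (c *\<^sub>R z) = c * koszul x u v z"
  using assms by (simp_all add: koszul_def dderiv_g_simps algebra_simps)

lemma koszul_commute:
  assumes "x \<in> V" shows "koszul x u v z = koszul x v u z"
proof -
  have "dderiv (\<lambda>y. g y u v) x z = dderiv (\<lambda>y. g y v u) x z"
    by (rule dderiv_cong_open[OF open_V assms]) (simp add: sym)
  then show ?thesis by (simp add: koszul_def)
qed

text \<open>Four of the six terms cancel by symmetry of the metric. Halved, this is the
  compatibility of the connection with the metric, as used in \<open>dderiv_g\<close>.\<close>

lemma koszul_metric:
  assumes "x \<in> V" shows "koszul x a u v + koszul x a v u = 2 * dderiv (\<lambda>y. g y u v) x a"
proof -
  have "dderiv (\<lambda>y. g y u v) x z = dderiv (\<lambda>y. g y v u) x z" for u v z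
    by (rule dderiv_cong_open[OF open_V assms]) (simp add: sym)
  from this[of u v a] this[of u a v] this[of v a u] show ?thesis by (simp add: koszul_def)
qed

text \<open>Cramer's rule for the linear system that defines the Christoffel symbols.\<close>

definition christoffel_solution :: "real^2 \<Rightarrow> real^2 \<Rightarrow> real^2 \<Rightarrow> real^2" where
  "christoffel_solution x u v = inverse (2 * gram x) *\<^sub>R
     ((g x e2 e2 * koszul x u v e1 - g x e1 e2 * koszul x u v e2) *\<^sub>R e1
      + (g x e1 e1 * koszul x u v e2 - g x e1 e2 * koszul x u v e1) *\<^sub>R e2)"

lemma christoffel_solution:
  assumes "x \<in> V" shows "2 * g x (christoffel_solution x u v) z = koszul x u v z"
proof -
  have "koszul x u v z = koszul x u v (z $ 1 *\<^sub>R e1 + z $ 2 *\<^sub>R e2)"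
    by (simp only: vec2_expand[symmetric])
  then have k: "koszul x u v z = z$1 * koszul x u v e1 + z$2 * koszul x u v e2"
    by (simp only: koszul_simps[OF assms])
  have ne: "gram x \<noteq> 0" using gram_neg[OF assms] by simp
  let ?w = "(g x e2 e2 * koszul x u v e1 - g x e1 e2 * koszul x u v e2) *\<^sub>R e1
      + (g x e1 e1 * koszul x u v e2 - g x e1 e2 * koszul x u v e1) *\<^sub>R e2"
  have w: "?w $ 1 = g x e2 e2 * koszul x u v e1 - g x e1 e2 * koszul x u v e2"
    "?w $ 2 = g x e1 e1 * koszul x u v e2 - g x e1 e2 * koszul x u v e1"
    by (simp_all add: axis_def)
  have "2 * gram x * g x (christoffel_solution x u v) z = g x ?w z"
    unfolding christoffel_solution_def bilinear_lmul[OF bil[OF assms]] using ne by simp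
  also have "\<dots> = gram x * koszul x u v z"
    unfolding k g_expand[OF assms, of ?w z] w gram_def power2_eq_square
    by (simp only: algebra_simps)
  finally have "gram x * (2 * g x (christoffel_solution x u v) z) = gram x * koszul x u v z"
    by (simp only: mult_ac)
  then show ?thesis using mult_left_cancel[OF ne] by blast
qed

text \<open>Nondegeneracy makes the \<open>THE\<close> in \<open>christoffel\<close> unique, so
  identities between Christoffel symbols can be checked after pairing with an arbitrary
  \<open>z\<close>.\<close>

lemma christoffel_eqI:
  assumes "x \<in> V" "\<And>z. 2 * g x w z = koszul x u v z" shows "christoffel g x u v = w"
  unfolding christoffel_def koszul_def[symmetric]
proof (rule the_equality)
  show "w' = w" if "\<forall>z. 2 * g x w' z = koszul x u v z" for w'
  proof (rule nondegenerate[OF assms(1)])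
    show "g x w' z = g x w z" for z using spec[OF that, of z] assms(2)[of z] by linarith
  qed
qed (use assms in blast)

lemma christoffel_eq: "x \<in> V \<Longrightarrow> christoffel g x u v = christoffel_solution x u v"
  using christoffel_eqI[OF _ christoffel_solution] by blast

lemma g_christoffel: "x \<in> V \<Longrightarrow> 2 * g x (christoffel g x u v) z = koszul x u v z"
  by (simp add: christoffel_eq christoffel_solution)

lemma bilinear_christoffel: "x \<in> V \<Longrightarrow> bilinear (christoffel g x)"
  unfolding bilinear_def
  by (intro conjI allI linearI christoffel_eqI; simp add: g_simps g_christoffel koszul_simps algebra_simps)

lemma christoffel_commute: "x \<in> V \<Longrightarrow> christoffel g x u v = christoffel g x v u"
  by (rule christoffel_eqI) (simp_all add: g_christoffel koszul_commute[of x u v])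

text \<open>The reason for solving the system explicitly: the solution is a rational expression in
  the metric and its derivatives, with a multiple of the nonvanishing \<open>gram\<close> as
  denominator.\<close>

lemma smooth_christoffel: "smooth_on V (\<lambda>x. christoffel g x u v)"
proof (rule smooth_on_cong[OF _ open_V])
  have gram: "smooth_on V gram"
    unfolding gram_def power2_eq_square
    by (intro smooth_on_diff smooth_on_mult open_V smooth)
  have koszul: "smooth_on V (\<lambda>x. koszul x u v z)" for z
    unfolding koszul_def
    by (intro smooth_on_diff smooth_on_add smooth_on_dderiv open_V smooth)
  show "smooth_on V (\<lambda>x. christoffel_solution x u v)"
    unfolding christoffel_solution_def using gram_neg
    by (intro smooth_on_scaleR smooth_on_inverse smooth_on_add smooth_on_diff smooth_on_mult smooth_on_const
        koszul gram smooth open_V) force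
qed (simp add: christoffel_eq)

lemma dderiv_g:
  assumes "x \<in> V"
  shows "dderiv (\<lambda>y. g y u v) x a = g x (christoffel g x a u) v + g x u (christoffel g x a v)"
  using koszul_metric[OF assms, of a u v] g_christoffel[OF assms, of a u v] g_christoffel[OF assms, of a v u]
  by (simp add: sym[OF assms, of u "christoffel g x a v"])

lemma christoffel_differentiable: "x \<in> V \<Longrightarrow> (\<lambda>x. christoffel g x u v) differentiable (at x)"
  by (rule smooth_on_differentiable[OF smooth_christoffel])

end

section \<open>Covariant derivatives of vector fields along a map\<close>

definition cov_deriv ::
  "(real^2 \<Rightarrow> real^2 \<Rightarrow> real^2 \<Rightarrow> real) \<Rightarrow> ('a::real_normed_vector \<Rightarrow> real^2) \<Rightarrow> 'a \<Rightarrow> ('a \<Rightarrow> real^2) \<Rightarrow> 'a \<Rightarrow> real^2" where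
  "cov_deriv g p a X x = dderiv X x a + christoffel g (p x) (dderiv p x a) (X x)"

text \<open>The map \<open>p\<close> is typically a variation read in a chart. It can fail to be an
  immersion, so what is differentiated are vector fields along \<open>p\<close>, given by their
  components, rather than fields on \<open>V\<close>.\<close>

locale lorentz_map = lorentz_metric +
  fixes U :: "'a::real_normed_vector set" and p :: "'a \<Rightarrow> real^2"
  assumes open_U: "open U" and smooth_p: "smooth_on U p" and p_in: "p ` U \<subseteq> V"
begin

lemma p_inD: "x \<in> U \<Longrightarrow> p x \<in> V"
  using p_in by auto

lemma smooth_vel: "smooth_on U (\<lambda>x. dderiv p x a)"
  by (rule smooth_on_dderiv[OF smooth_p])

lemma smooth_g_along:
  "smooth_on U X \<Longrightarrow> smooth_on U Y \<Longrightarrow> smooth_on U (\<lambda>x. g (p x) (X x) (Y x))"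
  using bil by (intro smooth_on_bilinear_family[OF open_U open_V p_in _ smooth smooth_p])

lemma smooth_christoffel_along:
  "smooth_on U X \<Longrightarrow> smooth_on U Y \<Longrightarrow> smooth_on U (\<lambda>x. christoffel g (p x) (X x) (Y x))"
  using bilinear_christoffel
  by (intro smooth_on_bilinear_family[OF open_U open_V p_in _ smooth_christoffel smooth_p])

lemma smooth_cov_deriv: "smooth_on U X \<Longrightarrow> smooth_on U (cov_deriv g p a X)"
  unfolding cov_deriv_def[abs_def]
  by (intro smooth_on_add open_U smooth_on_dderiv smooth_christoffel_along smooth_p)

lemma dderiv_g_along:
  assumes "smooth_on U X" "smooth_on U Y" "x \<in> U"
  shows "dderiv (\<lambda>x. g (p x) (X x) (Y x)) x a
    = g (p x) (cov_deriv g p a X x) (Y x) + g (p x) (X x) (cov_deriv g p a Y x)"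
proof -
  note V = p_inD[OF assms(3)]
  have "dderiv (\<lambda>x. g (p x) (X x) (Y x)) x a =
    dderiv (\<lambda>y. g y (X x) (Y x)) (p x) (dderiv p x a)
    + g (p x) (dderiv X x a) (Y x) + g (p x) (X x) (dderiv Y x a)"
    using bil assms
    by (intro dderiv_bilinear_family[OF open_U assms(3) p_in _ _ _ _ _ open_V])
      (auto intro: smooth_on_differentiable[OF smooth_p] smooth_on_differentiable g_differentiable[OF V])
  then show ?thesis
    by (simp add: dderiv_g[OF V] cov_deriv_def g_simps[OF V])
qed

text \<open>The connection is torsion-free: second derivatives of \<open>p\<close> commute and the
  Christoffel symbols are symmetric.\<close>

lemma cov_deriv_vel_commute:
  assumes "x \<in> U"
  shows "cov_deriv g p a (\<lambda>x. dderiv p x b) x = cov_deriv g p b (\<lambda>x. dderiv p x a) x"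
  using dderiv_commute[OF open_U smooth_p assms] christoffel_commute[OF p_inD[OF assms]]
  by (simp add: cov_deriv_def)

text \<open>The constant directions \<open>a\<close> and \<open>b\<close> commute, so no bracket
  term occurs. After expansion the second derivatives of \<open>X\<close> and of \<open>p\<close>
  cancel, the mixed first-order terms cancel in pairs, and what remains is the coordinate definition
  of the curvature.\<close>

lemma cov_deriv_commutator:
  assumes X: "smooth_on U X" and x: "x \<in> U"
  shows "cov_deriv g p a (cov_deriv g p b X) x - cov_deriv g p b (cov_deriv g p a X) x
    = riemann g (p x) (dderiv p x a) (dderiv p x b) (X x)"
proof -
  note V = p_inD[OF x]
  let ?\<Gamma> = "christoffel g (p x)"
  note \<Gamma>_add = bilinear_radd[OF bilinear_christoffel[OF V]] bilinear_ladd[OF bilinear_christoffel[OF V]]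
  have *: "cov_deriv g p a (cov_deriv g p b X) x =
      dderiv (\<lambda>y. dderiv X y b) x a
      + (dderiv (\<lambda>y. christoffel g y (dderiv p x b) (X x)) (p x) (dderiv p x a)
      + ?\<Gamma> (dderiv (\<lambda>x. dderiv p x b) x a) (X x) + ?\<Gamma> (dderiv p x b) (dderiv X x a))
      + (?\<Gamma> (dderiv p x a) (dderiv X x b) + ?\<Gamma> (dderiv p x a) (?\<Gamma> (dderiv p x b) (X x)))" for a b
  proof -
    have "dderiv (cov_deriv g p b X) x a
        = dderiv (\<lambda>y. dderiv X y b) x a + dderiv (\<lambda>y. christoffel g (p y) (dderiv p y b) (X y)) x a"
      unfolding cov_deriv_def[abs_def]
      by (rule dderiv_eqI)
        (intro has_derivative_add smooth_on_has_derivative[OF _ x] smooth_on_dderiv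
          smooth_christoffel_along smooth_p X)
    moreover have "dderiv (\<lambda>y. christoffel g (p y) (dderiv p y b) (X y)) x a
      = dderiv (\<lambda>y. christoffel g y (dderiv p x b) (X x)) (p x) (dderiv p x a)
      + ?\<Gamma> (dderiv (\<lambda>x. dderiv p x b) x a) (X x) + ?\<Gamma> (dderiv p x b) (dderiv X x a)"
      using bilinear_christoffel
      by (intro dderiv_bilinear_family[OF open_U x p_in _ _ _ _ _ open_V] christoffel_differentiable V
          smooth_on_differentiable[OF _ x] smooth_p smooth_vel X)
    ultimately show ?thesis
      by (simp add: cov_deriv_def[of g p a "cov_deriv g p b X"] cov_deriv_def[of g p b X] \<Gamma>_add)
  qed
  show ?thesis
    unfolding * riemann_def dderiv_commute[OF open_U X x, of a b] dderiv_commute[OF open_U smooth_p x, of a b]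
    by simp
qed

end

section \<open>Symmetries of the curvature tensor in dimension two\<close>

context lorentz_metric
begin

lemma
  assumes "x \<in> V"
  shows linear_riemann: "linear (\<lambda>w. riemann g x u v w)"
    and linear_riemann_left: "linear (\<lambda>u. riemann g x u v w)"
proof -
  note \<Gamma> = bilinear_christoffel[OF assms]
  note lin = linear_dderiv_family[where B="christoffel g", OF open_V assms bilinear_christoffel
      christoffel_differentiable[OF assms]]
  note lin3 = linear_dderiv[OF christoffel_differentiable[OF assms]]
  show "linear (\<lambda>w. riemann g x u v w)" "linear (\<lambda>u. riemann g x u v w)"
    unfolding riemann_def
    by (rule linearI; simp add: lin[THEN linear_add] lin[THEN linear_cmul] lin3[THEN linear_add]
        lin3[THEN linear_cmul] bilinear_ladd[OF \<Gamma>] bilinear_radd[OF \<Gamma>] bilinear_lmul[OF \<Gamma>]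
        bilinear_rmul[OF \<Gamma>] algebra_simps)+
qed

lemma riemann_antisym: "riemann g x v u w = - riemann g x u v w"
  by (simp add: riemann_def)

text \<open>\<open>R(u,v)w\<close> is a commutator of second covariant derivatives of the constant field \<open>w\<close>, and second
  derivatives of the function \<open>g(w,w)\<close> commute.\<close>

lemma riemann_skew_diag:
  assumes "x \<in> V" shows "g x (riemann g x u v w) w = 0"
proof -
  interpret I: lorentz_map V g V "\<lambda>x. x"
    by unfold_locales (auto intro: open_V smooth_on_id)
  let ?W = "\<lambda>x. w"
  let ?c = "cov_deriv g (\<lambda>x. x)"
  have id: "dderiv (\<lambda>x. x) x a = a" for x a :: "real^2" by (rule dderiv_eqI) (rule has_derivative_ident)
  note W = smooth_on_const[of V w]
  note cW = I.smooth_cov_deriv[OF W]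
  have 2: "dderiv (\<lambda>x. dderiv (\<lambda>x. g x w w) x b) x a
    = 2 * g x (?c a (?c b ?W) x) w + 2 * g x (?c b ?W x) (?c a ?W x)" for a b
  proof -
    have "dderiv (\<lambda>x. dderiv (\<lambda>x. g x w w) x b) x a = dderiv (\<lambda>x. 2 * g x (?c b ?W x) w) x a"
      using I.dderiv_g_along[OF W W]
      by (intro dderiv_cong_open[OF open_V assms]) (simp add: sym[of _ w])
    also have "\<dots> = 2 * dderiv (\<lambda>x. g x (?c b ?W x) w) x a"
      by (rule dderiv_eqI) (intro has_derivative_mult_right smooth_on_has_derivative[OF _ assms] I.smooth_g_along cW W)
    finally show ?thesis by (simp add: I.dderiv_g_along[OF cW W assms])
  qed
  have "dderiv (\<lambda>x. dderiv (\<lambda>x. g x w w) x v) x u = dderiv (\<lambda>x. dderiv (\<lambda>x. g x w w) x u) x v"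
    by (rule dderiv_commute_real[OF open_V smooth assms])
  then have "g x (?c u (?c v ?W) x) w = g x (?c v (?c u ?W) x) w"
    unfolding 2 by (simp add: sym[OF assms, of "?c u ?W x" "?c v ?W x"])
  moreover have "riemann g x u v w = ?c u (?c v ?W) x - ?c v (?c u ?W) x"
    using I.cov_deriv_commutator[OF W assms, of u v] by (simp only: id)
  ultimately show ?thesis by (simp add: bilinear_lsub[OF bil[OF assms]])
qed

text \<open>Polarization: the quadratic form in the last two slots vanishes at \<open>w + z\<close>,
  \<open>w\<close> and \<open>z\<close>.\<close>

lemma riemann_skew:
  assumes "x \<in> V" shows "g x (riemann g x u v w) z = - g x (riemann g x u v z) w"
  using riemann_skew_diag[OF assms, of u v "w + z"] riemann_skew_diag[OF assms, of u v w]
    riemann_skew_diag[OF assms, of u v z]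
  by (simp add: linear_add[OF linear_riemann[OF assms]] g_simps[OF assms])

text \<open>In dimension two there is a single curvature component. Skewness in the first pair of
  slots (\<open>A\<close>) and in the second pair (\<open>B\<close>) each contributes one
  determinant of \<open>u\<close> and \<open>v\<close>.\<close>

lemma riemann_plane:
  assumes "x \<in> V"
  shows "g x (riemann g x u v v) u = (u$1 * v$2 - u$2 * v$1)\<^sup>2 * g x (riemann g x e1 e2 e2) e1"
proof -
  let ?d = "u$1 * v$2 - u$2 * v$1"
  note L = linear_add[OF linear_riemann_left[OF assms]] linear_cmul[OF linear_riemann_left[OF assms]]
  note R = linear_add[OF linear_riemann[OF assms]] linear_cmul[OF linear_riemann[OF assms]]
  have 0: "riemann g x w w z = 0" for w z by (simp add: riemann_def)
  have A: "riemann g x (a *\<^sub>R e1 + b *\<^sub>R e2) (c *\<^sub>R e1 + d *\<^sub>R e2) z = (a * d - b * c) *\<^sub>R riemann g x e1 e2 z"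
    for a b c d z
  proof -
    have "riemann g x (c *\<^sub>R e1 + d *\<^sub>R e2) e1 z = - d *\<^sub>R riemann g x e1 e2 z"
      using riemann_antisym[of x e2 e1 z] by (simp add: L 0)
    moreover have "riemann g x (c *\<^sub>R e1 + d *\<^sub>R e2) e2 z = c *\<^sub>R riemann g x e1 e2 z" by (simp add: L 0)
    ultimately show ?thesis
      using riemann_antisym[of x e1 "c *\<^sub>R e1 + d *\<^sub>R e2" z] riemann_antisym[of x e2 "c *\<^sub>R e1 + d *\<^sub>R e2" z]
      by (simp only: L) (simp add: algebra_simps)
  qed
  have B: "g x (riemann g x e1 e2 (c *\<^sub>R e1 + d *\<^sub>R e2)) (a *\<^sub>R e1 + b *\<^sub>R e2)
      = (a * d - b * c) * g x (riemann g x e1 e2 e2) e1" for a b c d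
    using riemann_skew[OF assms, of e1 e2 e1 e2] riemann_skew_diag[OF assms, of e1 e2]
    by (simp add: R g_simps[OF assms] algebra_simps)
  have "g x (riemann g x u v v) u = ?d * g x (riemann g x e1 e2 v) u"
    using A[of "u$1" "u$2" "v$1" "v$2" v] by (simp add: g_simps[OF assms] flip: vec2_expand)
  also have "\<dots> = ?d * (?d * g x (riemann g x e1 e2 e2) e1)"
    using B[of "v$1" "v$2" "u$1" "u$2"] by (simp flip: vec2_expand)
  finally show ?thesis by (simp add: power2_eq_square)
qed

text \<open>Two sign changes meet here: \<open>gram\<close> is negative, so the numerator of the
  Gauss curvature has the opposite sign, and exchanging the last two slots of the curvature reverses
  it again.\<close>

lemma sectional_sign:
  assumes "x \<in> V" "\<sigma> * (g x (riemann g x e1 e2 e2) e1 / gram x) \<le> 0"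
  shows "\<sigma> * g x (riemann g x u v u) v \<le> 0"
proof -
  let ?r = "g x (riemann g x e1 e2 e2) e1"
  have "\<sigma> * ?r \<ge> 0" using assms(2) gram_neg[OF assms(1)] by (simp add: divide_le_0_iff)
  then have "(u$1 * v$2 - u$2 * v$1)\<^sup>2 * (\<sigma> * ?r) \<ge> 0" by simp
  then show ?thesis
    by (simp only: riemann_skew[OF assms(1), of u v u v] riemann_plane[OF assms(1), of u v])
      (simp add: algebra_simps)
qed

end

section \<open>First and second time derivatives of the pulled-back metric\<close>

context lorentz_map
begin

definition pull :: "'a \<Rightarrow> 'a \<Rightarrow> 'a \<Rightarrow> real" where
  "pull a b x = g (p x) (dderiv p x a) (dderiv p x b)"

abbreviation cov_vel :: "'a \<Rightarrow> 'a \<Rightarrow> 'a \<Rightarrow> real^2" where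
  "cov_vel a b \<equiv> cov_deriv g p a (\<lambda>x. dderiv p x b)"

lemma smooth_pull: "smooth_on U (pull a b)"
  unfolding pull_def[abs_def] by (intro smooth_g_along smooth_vel)

lemma dderiv_pull:
  assumes "x \<in> U"
  shows "dderiv (pull a b) x c = g (p x) (cov_vel c a x) (dderiv p x b) + g (p x) (dderiv p x a) (cov_vel c b x)"
  unfolding pull_def[abs_def] by (rule dderiv_g_along[OF smooth_vel smooth_vel assms])

text \<open>The product rule leaves an extra term that pairs the velocity with its covariant
  derivative along \<open>a\<close>; torsion-freeness makes it half the derivative of
  \<open>pull t t\<close>. The acceleration component is thus expressed without Christoffel
  symbols.\<close>

lemma koszul_pull:
  assumes "x \<in> U"
  shows "dderiv (pull t a) x t - dderiv (pull t t) x a / 2 = g (p x) (cov_vel t t x) (dderiv p x a)"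
  using assms by (simp add: dderiv_pull cov_deriv_vel_commute[of x a t] sym[OF p_inD, of x _ "dderiv p x t"])

lemma second_dderiv_pull_diag:
  assumes x: "x \<in> U"
  shows "dderiv (\<lambda>y. dderiv (pull a a) y t) x t
    = 2 * (g (p x) (cov_deriv g p t (cov_vel t a) x) (dderiv p x a) + g (p x) (cov_vel t a x) (cov_vel t a x))"
proof -
  note cv = smooth_cov_deriv[OF smooth_vel]
  have "dderiv (pull a a) y t = 2 * g (p y) (cov_vel t a y) (dderiv p y a)" if "y \<in> U" for y
    unfolding dderiv_pull[OF that] sym[OF p_inD[OF that], of "dderiv p y a" "cov_vel t a y"] by simp
  then have "dderiv (\<lambda>y. dderiv (pull a a) y t) x t = dderiv (\<lambda>y. 2 * g (p y) (cov_vel t a y) (dderiv p y a)) x t"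
    by (rule dderiv_cong_open[OF open_U x])
  also have "\<dots> = 2 * dderiv (\<lambda>y. g (p y) (cov_vel t a y) (dderiv p y a)) x t"
    by (rule dderiv_eqI) (intro has_derivative_mult_right smooth_on_has_derivative[OF _ x] smooth_g_along cv smooth_vel)
  finally show ?thesis
    by (simp only: dderiv_g_along[OF cv smooth_vel x])
qed

text \<open>Exchanging the order of differentiation twice turns the second time derivative of the
  \<open>a\<close>-velocity into the \<open>a\<close>-derivative of the acceleration plus a
  curvature term. Taking the \<open>a\<close>-derivative out of the scalar product costs a term with
  \<open>cov_vel a a\<close>, which \<open>geod\<close> removes.\<close>

lemma second_dderiv_pull:
  assumes x: "x \<in> U" and geod: "cov_vel a a x = 0"
  shows "dderiv (\<lambda>y. dderiv (pull a a) y t) x t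
    = 2 * dderiv (\<lambda>y. dderiv (pull t a) y t - dderiv (pull t t) y a / 2) x a
      + 2 * g (p x) (riemann g (p x) (dderiv p x t) (dderiv p x a) (dderiv p x t)) (dderiv p x a)
      + 2 * g (p x) (cov_vel t a x) (cov_vel t a x)"
proof -
  note V = p_inD[OF x]
  note cv = smooth_cov_deriv[OF smooth_vel]
  have W: "dderiv (\<lambda>y. dderiv (pull t a) y t - dderiv (pull t t) y a / 2) x a
     = g (p x) (cov_deriv g p a (cov_vel t t) x) (dderiv p x a)"
  proof -
    have "dderiv (\<lambda>y. dderiv (pull t a) y t - dderiv (pull t t) y a / 2) x a
      = dderiv (\<lambda>y. g (p y) (cov_vel t t y) (dderiv p y a)) x a"
      by (rule dderiv_cong_open[OF open_U x]) (rule koszul_pull)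
    then show ?thesis
      unfolding dderiv_g_along[OF cv smooth_vel x] geod bilinear_rzero[OF bil[OF V]] by simp
  qed
  have "dderiv (cov_vel t a) x t = dderiv (cov_vel a t) x t"
    by (rule dderiv_cong_open[OF open_U x]) (rule cov_deriv_vel_commute)
  then have "cov_deriv g p t (cov_vel t a) x = cov_deriv g p t (cov_vel a t) x"
    unfolding cov_deriv_def[of g p t "cov_vel t a"] cov_deriv_def[of g p t "cov_vel a t"]
      cov_deriv_vel_commute[OF x, of t a] by simp
  then have C: "cov_deriv g p t (cov_vel t a) x
      = cov_deriv g p a (cov_vel t t) x + riemann g (p x) (dderiv p x t) (dderiv p x a) (dderiv p x t)"
    using cov_deriv_commutator[OF smooth_vel x, of t a t] by (simp only: diff_eq_eq add.commute)
  show ?thesis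
    unfolding W second_dderiv_pull_diag[OF x] C bilinear_ladd[OF bil[OF V]] by simp
qed

text \<open>The hypothesis \<open>ta\<close> is what normality leaves behind: with
  \<open>geod\<close> it makes \<open>cov_vel t a x\<close> orthogonal to the velocity in direction
  \<open>a\<close>, so its square cannot have the sign of \<open>pull a a x\<close>.\<close>

lemma second_dderiv_pull_le:
  assumes x: "x \<in> U" and geod: "cov_vel a a x = 0"
    and ta: "dderiv (pull t a) x a = 0" and pos: "\<sigma> * pull a a x > 0"
    and curv: "\<sigma> * (g (p x) (riemann g (p x) e1 e2 e2) e1 / gram (p x)) \<le> 0"
  shows "\<sigma> * dderiv (\<lambda>y. dderiv (pull a a) y t) x t
    \<le> 2 * (\<sigma> * dderiv (\<lambda>y. dderiv (pull t a) y t - dderiv (pull t t) y a / 2) x a)"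
proof -
  note V = p_inD[OF x]
  have "g (p x) (cov_vel t a x) (dderiv p x a) = 0"
    using ta by (simp add: dderiv_pull[OF x] geod g_simps[OF V] cov_deriv_vel_commute[OF x, of t a])
  then have "\<sigma> * g (p x) (cov_vel t a x) (cov_vel t a x) \<le> 0"
    using orthogonal_opposite_sign[OF V] pos by (simp add: pull_def)
  with sectional_sign[OF V curv, of "dderiv p x t" "dderiv p x a"] show ?thesis
    unfolding second_dderiv_pull[OF x geod, of t] by (simp add: algebra_simps)
qed

text \<open>Here \<open>p\<close> is stationary in direction \<open>b\<close>: the second covariant
  derivative is paired with \<open>dderiv p x b\<close> and drops out, and only the square of
  \<open>cov_vel t b x\<close> is left. That vector is orthogonal to the \<open>a\<close>-velocity,
  because the \<open>b\<close>-derivative of \<open>pull t a\<close> vanishes and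
  \<open>cov_vel b a x\<close> is zero by torsion-freeness.\<close>

lemma second_dderiv_pull_degenerate:
  assumes x: "x \<in> U" and b: "dderiv p x b = 0" "cov_vel a b x = 0"
    and ta: "dderiv (pull t a) x b = 0" and pos: "\<sigma> * pull a a x > 0"
  shows "\<sigma> * dderiv (\<lambda>y. dderiv (pull b b) y t) x t \<le> 0"
    and "dderiv (pull a b) x t = 0"
proof -
  note V = p_inD[OF x]
  note cv = smooth_cov_deriv[OF smooth_vel]
  have "cov_vel b a x = 0"
    unfolding cov_deriv_vel_commute[OF x, of b a] by (rule b)
  then have orth: "g (p x) (cov_vel t b x) (dderiv p x a) = 0"
    using ta by (simp add: dderiv_pull[OF x] g_simps[OF V] cov_deriv_vel_commute[OF x, of t b])
  then show "dderiv (pull a b) x t = 0"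
    by (simp add: dderiv_pull[OF x] b g_simps[OF V] sym[OF V, of "dderiv p x a"])
  show "\<sigma> * dderiv (\<lambda>y. dderiv (pull b b) y t) x t \<le> 0"
    unfolding second_dderiv_pull_diag[OF x] b
    using orthogonal_opposite_sign[OF V orth, of \<sigma>] pos
    by (simp add: pull_def bilinear_rzero[OF bil[OF V]] algebra_simps)
qed

lemma dderiv_pull_diag:
  assumes x: "x \<in> U"
  shows "cov_vel a a x = 0 \<Longrightarrow> dderiv (pull a a) x a = 0"
    and "cov_vel a a x = 0 \<Longrightarrow> dderiv (pull t a) x a = 0 \<Longrightarrow> dderiv (pull a a) x t = 0"
    and "dderiv p x b = 0 \<Longrightarrow> dderiv (pull b b) x t = 0"
  using x by (auto simp: dderiv_pull g_simps[OF p_inD[OF x]] cov_deriv_vel_commute[OF x, of t a]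
      sym[OF p_inD[OF x], of _ "cov_vel a t x"])

end

section \<open>Induced metrics of maps into a Lorentzian surface\<close>

text \<open>Isolated from \<open>smooth_atlas\<close> because it passes to products at once and
  guarantees that \<open>chart_at\<close> picks a chart around each point.\<close>

definition open_cover :: "('p::topological_space, 'm, 'i) metric_mfd \<Rightarrow> bool" where
  "open_cover M \<longleftrightarrow> (\<Union>i\<in>atlas M. cdom M i) = UNIV \<and> (\<forall>i\<in>atlas M. open (cdom M i))"

lemma chart_at:
  assumes "open_cover M"
  shows "chart_at M p \<in> atlas M" "p \<in> cdom M (chart_at M p)"
proof -
  have "\<exists>i. i \<in> atlas M \<and> p \<in> cdom M i" using assms unfolding open_cover_def by blast
  then have "chart_at M p \<in> atlas M \<and> p \<in> cdom M (chart_at M p)"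
    unfolding chart_at_def by (rule someI_ex)
  then show "chart_at M p \<in> atlas M" "p \<in> cdom M (chart_at M p)" by auto
qed

lemma open_chart_preimage:
  assumes "open_cover M" "smooth_map M U F" "i \<in> atlas M"
  shows "open {x\<in>U. F x \<in> cdom M i}"
proof -
  have "open (U \<inter> F -` cdom M i)"
    using assms by (intro continuous_open_preimage) (auto simp: open_cover_def smooth_map_def)
  then show ?thesis by (simp add: Int_def vimage_def)
qed

lemma smooth_on_chart:
  "smooth_map M U F \<Longrightarrow> i \<in> atlas M \<Longrightarrow> smooth_on {x\<in>U. F x \<in> cdom M i} (chart M i \<circ> F)"
  by (simp add: smooth_map_def)

lemma push_compose:
  fixes F :: "'a::euclidean_space \<Rightarrow> 'p::topological_space"
  assumes M: "open_cover M" and F: "smooth_map M U F"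
    and A: "(A has_derivative A') (at x)" "A x \<in> U"
    and N: "open N" "x \<in> N" "\<And>y. y \<in> N \<Longrightarrow> f y = F (A y)"
  shows "push M f x a = push M F (A x) (A' a)"
proof -
  let ?c = "chart_at M (F (A x))"
  have fx: "f x = F (A x)" using N by simp
  have "((chart M ?c \<circ> F) has_derivative (\<lambda>v. dderiv (chart M ?c \<circ> F) (A x) v)) (at (A x))"
    using A(2) by (intro smooth_on_has_derivative[OF smooth_on_chart[OF F]] chart_at[OF M]) (auto intro: chart_at[OF M])
  from has_derivative_compose[OF A(1) this]
  have "((\<lambda>y. (chart M ?c \<circ> F) (A y)) has_derivative (\<lambda>v. dderiv (chart M ?c \<circ> F) (A x) (A' v))) (at x)" .
  then have "((chart M ?c \<circ> f) has_derivative (\<lambda>v. dderiv (chart M ?c \<circ> F) (A x) (A' v))) (at x)"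
    by (rule has_derivative_transform_within_open[OF _ N(1,2)]) (simp add: N(3))
  then show ?thesis by (simp add: push_def loc_def fx dderiv_eqI)
qed

lemma induced_compose:
  fixes F :: "'a::euclidean_space \<Rightarrow> 'p::topological_space"
  assumes "open_cover M" "smooth_map M U F" "(A has_derivative A') (at x)" "A x \<in> U"
    "open N" "x \<in> N" "\<And>y. y \<in> N \<Longrightarrow> f y = F (A y)"
  shows "induced M f x a b = induced M F (A x) (A' a) (A' b)"
  using push_compose[OF assms] assms(6,7) by (simp add: induced_def)

lemma lorentzian_open_cover: "lorentzian_surface S \<Longrightarrow> open_cover S"
  unfolding lorentzian_surface_def smooth_atlas_def open_cover_def by blast

lemma lorentzian_chart:
  assumes "lorentzian_surface S" "i \<in> atlas S"
  shows "lorentz_metric (chart S i ` cdom S i) (met S i)"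
  using assms unfolding lorentzian_surface_def smooth_atlas_def smooth_metric_def
  by unfold_locales blast+

lemma lorentzian_lorentz_map:
  assumes "lorentzian_surface S" "smooth_map S U P" "i \<in> atlas S"
  shows "lorentz_map (chart S i ` cdom S i) (met S i) {x\<in>U. P x \<in> cdom S i} (chart S i \<circ> P)"
  using assms
  by (intro lorentz_map.intro lorentz_map_axioms.intro lorentzian_chart open_chart_preimage[OF lorentzian_open_cover] smooth_on_chart)
    auto

text \<open>\<open>induced\<close> switches charts from point to point. The transformation law of
  the metric shows that one chart may be used on its whole domain, which is what makes
  \<open>induced\<close> differentiable in \<open>x\<close>.\<close>

lemma induced_chart:
  assumes S: "lorentzian_surface S" and P: "smooth_map S U P" and i: "i \<in> atlas S"
    and x: "x \<in> U" "P x \<in> cdom S i"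
  shows "induced S P x a b
    = met S i (chart S i (P x)) (dderiv (chart S i \<circ> P) x a) (dderiv (chart S i \<circ> P) x b)"
proof -
  note cov = lorentzian_open_cover[OF S]
  let ?k = "chart_at S (P x)"
  let ?\<tau> = "transition S i ?k"
  have k: "?k \<in> atlas S" "P x \<in> cdom S ?k" using chart_at[OF cov] by auto
  have atlas: "homeomorphism (cdom S i) (chart S i ` cdom S i) (chart S i) (inv_into (cdom S i) (chart S i))"
    "smooth_on (chart S i ` (cdom S i \<inter> cdom S ?k)) ?\<tau>"
    using S i k unfolding lorentzian_surface_def smooth_atlas_def by blast+
  have \<tau>: "?\<tau> (chart S i q) = chart S ?k q" if "q \<in> cdom S i" for q
    using homeomorphism_apply1[OF atlas(1) that] by (simp add: transition_def)
  let ?N = "{y\<in>U. P y \<in> cdom S i} \<inter> {y\<in>U. P y \<in> cdom S ?k}"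
  have N: "open ?N" "x \<in> ?N"
    using open_chart_preimage[OF cov P] i k x by auto
  have "((\<lambda>y. ?\<tau> ((chart S i \<circ> P) y)) has_derivative
      (\<lambda>v. dderiv ?\<tau> ((chart S i \<circ> P) x) (dderiv (chart S i \<circ> P) x v))) (at x)"
    using x k
    by (intro dderiv_compose smooth_on_differentiable[OF smooth_on_chart[OF P i]]
        smooth_on_differentiable[OF atlas(2)]) auto
  then have "((chart S ?k \<circ> P) has_derivative
      (\<lambda>v. dderiv ?\<tau> ((chart S i \<circ> P) x) (dderiv (chart S i \<circ> P) x v))) (at x)"
    by (rule has_derivative_transform_within_open[OF _ N]) (simp add: \<tau>)
  then have "dderiv (chart S ?k \<circ> P) x v = dderiv ?\<tau> (chart S i (P x)) (dderiv (chart S i \<circ> P) x v)" for v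
    by (simp add: dderiv_eqI)
  moreover have "met S i (chart S i (P x)) u v
    = met S ?k (chart S ?k (P x)) (dderiv ?\<tau> (chart S i (P x)) u) (dderiv ?\<tau> (chart S i (P x)) v)" for u v
    using S i k x unfolding lorentzian_surface_def smooth_metric_def by blast
  ultimately show ?thesis by (simp add: induced_def met_at_def push_def loc_def)
qed

lemma smooth_induced:
  assumes S: "lorentzian_surface S" and P: "smooth_map S U P"
  shows "smooth_on U (\<lambda>x. induced S P x a b)"
proof (rule smooth_on_local)
  fix x assume x: "x \<in> U"
  note cov = lorentzian_open_cover[OF S]
  let ?i = "chart_at S (P x)"
  let ?N = "{y\<in>U. P y \<in> cdom S ?i}"
  interpret L: lorentz_map "chart S ?i ` cdom S ?i" "met S ?i" ?N "chart S ?i \<circ> P"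
    by (intro lorentzian_lorentz_map[OF S P] chart_at[OF cov])
  have "smooth_on ?N (\<lambda>x. induced S P x a b)"
    by (rule smooth_on_cong[OF L.smooth_pull[of a b] L.open_U])
      (simp add: L.pull_def induced_chart[OF S P chart_at(1)[OF cov, of "P x"]])
  then show "\<exists>N. open N \<and> x \<in> N \<and> smooth_on N (\<lambda>x. induced S P x a b)"
    using L.open_U x chart_at(2)[OF cov, of "P x"] by blast
qed

text \<open>Near \<open>x\<close> the chart at \<open>P x\<close> is kept fixed, and
  \<open>induced\<close> agrees there with \<open>pull\<close>, so all derivatives agree too. The
  facts of \<open>lorentz_map\<close> thereby become statements in which a chart enters only at the
  single point \<open>x\<close>.\<close>

lemma
  assumes S: "lorentzian_surface S" and P: "smooth_map S U P" and x: "x \<in> U"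
  shows induced_commute: "induced S P x a b = induced S P x b a"
    and induced_push_zero: "push S P x a = 0 \<Longrightarrow> induced S P x a b = 0"
    and dderiv_induced_self: "cov S P x a a = 0 \<Longrightarrow> dderiv (\<lambda>y. induced S P y a a) x a = 0"
    and dderiv_induced_cross: "cov S P x a a = 0 \<Longrightarrow> dderiv (\<lambda>y. induced S P y t a) x a = 0
      \<Longrightarrow> dderiv (\<lambda>y. induced S P y a a) x t = 0"
    and dderiv_induced_push_zero: "push S P x b = 0 \<Longrightarrow> dderiv (\<lambda>y. induced S P y b b) x t = 0"
    and second_dderiv_induced_le: "cov S P x a a = 0 \<Longrightarrow> dderiv (\<lambda>y. induced S P y t a) x a = 0
      \<Longrightarrow> \<sigma> * induced S P x a a > 0 \<Longrightarrow> \<sigma> * gauss_curvature S (P x) \<le> 0 \<Longrightarrow>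
      \<sigma> * dderiv (\<lambda>y. dderiv (\<lambda>z. induced S P z a a) y t) x t
      \<le> 2 * (\<sigma> * dderiv (\<lambda>y. dderiv (\<lambda>z. induced S P z t a) y t - dderiv (\<lambda>z. induced S P z t t) y a / 2) x a)"
    and second_dderiv_induced_degenerate: "push S P x b = 0 \<Longrightarrow> cov S P x a b = 0
      \<Longrightarrow> dderiv (\<lambda>y. induced S P y t a) x b = 0 \<Longrightarrow> \<sigma> * induced S P x a a > 0
      \<Longrightarrow> \<sigma> * dderiv (\<lambda>y. dderiv (\<lambda>z. induced S P z b b) y t) x t \<le> 0"
    and dderiv_induced_degenerate: "push S P x b = 0 \<Longrightarrow> cov S P x a b = 0
      \<Longrightarrow> dderiv (\<lambda>y. induced S P y t a) x b = 0 \<Longrightarrow> \<sigma> * induced S P x a a > 0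
      \<Longrightarrow> dderiv (\<lambda>y. induced S P y a b) x t = 0"
proof -
  note cover = lorentzian_open_cover[OF S]
  let ?i = "chart_at S (P x)"
  let ?N = "{y\<in>U. P y \<in> cdom S ?i}"
  have i: "?i \<in> atlas S" and xi: "P x \<in> cdom S ?i" using chart_at[OF cover] by auto
  interpret L: lorentz_map "chart S ?i ` cdom S ?i" "met S ?i" ?N "chart S ?i \<circ> P"
    by (rule lorentzian_lorentz_map[OF S P i])
  have xN: "x \<in> ?N" using x xi by simp
  have ind: "induced S P y a b = L.pull a b y" if "y \<in> ?N" for y a b
    using induced_chart[OF S P i] that by (simp add: L.pull_def)
  have d: "dderiv (\<lambda>y. induced S P y a b) y c = dderiv (L.pull a b) y c" if "y \<in> ?N" for a b c y
    by (rule dderiv_cong_open[OF L.open_U that]) (rule ind)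
  have dd: "dderiv (\<lambda>y. dderiv (\<lambda>z. induced S P z a b) y t) x t = dderiv (\<lambda>y. dderiv (L.pull a b) y t) x t" for a b t
    by (rule dderiv_cong_open[OF L.open_U xN]) (rule d)
  have w: "dderiv (\<lambda>y. dderiv (\<lambda>z. induced S P z t a) y t - dderiv (\<lambda>z. induced S P z t t) y a / 2) x a
    = dderiv (\<lambda>y. dderiv (L.pull t a) y t - dderiv (L.pull t t) y a / 2) x a" for a t
    by (rule dderiv_cong_open[OF L.open_U xN]) (simp only: d)
  have push: "push S P x a = dderiv (chart S ?i \<circ> P) x a" for a
    by (simp add: push_def loc_def)
  have cov: "cov S P x a b = L.cov_vel a b x" for a b
    by (simp add: cov_def cov_deriv_def push loc_def)
  have K: "gauss_curvature S (P x)
    = met S ?i ((chart S ?i \<circ> P) x) (riemann (met S ?i) ((chart S ?i \<circ> P) x) e1 e2 e2) e1 / L.gram ((chart S ?i \<circ> P) x)"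
    by (simp add: gauss_curvature_def Let_def L.gram_def)
  note * = ind[OF xN] d[OF xN] dd w push cov K
  have V: "(chart S ?i \<circ> P) x \<in> chart S ?i ` cdom S ?i" using xi by simp
  show "induced S P x a b = induced S P x b a"
    unfolding * L.pull_def by (rule L.sym[OF V])
  show "push S P x a = 0 \<Longrightarrow> induced S P x a b = 0"
    unfolding * L.pull_def by (simp only: bilinear_lzero[OF L.bil[OF V]])
  show "cov S P x a a = 0 \<Longrightarrow> dderiv (\<lambda>y. induced S P y a a) x a = 0"
    unfolding * by (rule L.dderiv_pull_diag(1)[OF xN])
  show "cov S P x a a = 0 \<Longrightarrow> dderiv (\<lambda>y. induced S P y t a) x a = 0
      \<Longrightarrow> dderiv (\<lambda>y. induced S P y a a) x t = 0"
    unfolding * by (rule L.dderiv_pull_diag(2)[OF xN])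
  show "push S P x b = 0 \<Longrightarrow> dderiv (\<lambda>y. induced S P y b b) x t = 0"
    unfolding * by (rule L.dderiv_pull_diag(3)[OF xN])
  show "cov S P x a a = 0 \<Longrightarrow> dderiv (\<lambda>y. induced S P y t a) x a = 0
      \<Longrightarrow> \<sigma> * induced S P x a a > 0 \<Longrightarrow> \<sigma> * gauss_curvature S (P x) \<le> 0 \<Longrightarrow>
      \<sigma> * dderiv (\<lambda>y. dderiv (\<lambda>z. induced S P z a a) y t) x t
      \<le> 2 * (\<sigma> * dderiv (\<lambda>y. dderiv (\<lambda>z. induced S P z t a) y t - dderiv (\<lambda>z. induced S P z t t) y a / 2) x a)"
    unfolding * by (rule L.second_dderiv_pull_le[OF xN])
  show "push S P x b = 0 \<Longrightarrow> cov S P x a b = 0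
      \<Longrightarrow> dderiv (\<lambda>y. induced S P y t a) x b = 0 \<Longrightarrow> \<sigma> * induced S P x a a > 0
      \<Longrightarrow> \<sigma> * dderiv (\<lambda>y. dderiv (\<lambda>z. induced S P z b b) y t) x t \<le> 0"
    unfolding * by (rule L.second_dderiv_pull_degenerate(1)[OF xN])
  show "push S P x b = 0 \<Longrightarrow> cov S P x a b = 0
      \<Longrightarrow> dderiv (\<lambda>y. induced S P y t a) x b = 0 \<Longrightarrow> \<sigma> * induced S P x a a > 0
      \<Longrightarrow> dderiv (\<lambda>y. induced S P y a b) x t = 0"
    unfolding * by (rule L.second_dderiv_pull_degenerate(2)[OF xN])
qed

section \<open>Maps into the product manifold\<close>

lemma product_mfd_simps:
  "atlas (product_mfd \<epsilon> S1 S2) = atlas S1 \<times> atlas S2"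
  "cdom (product_mfd \<epsilon> S1 S2) (i, k) = cdom S1 i \<times> cdom S2 k"
  "chart (product_mfd \<epsilon> S1 S2) (i, k) r = (chart S1 i (fst r), chart S2 k (snd r))"
  "met (product_mfd \<epsilon> S1 S2) (i, k) z u v
    = met S1 i (fst z) (fst u) (fst v) + \<epsilon> * met S2 k (snd z) (snd u) (snd v)"
  by (simp_all add: product_mfd_def case_prod_beta)

lemma product_open_cover:
  assumes "open_cover S1" "open_cover S2" shows "open_cover (product_mfd \<epsilon> S1 S2)"
proof -
  have "\<exists>i\<in>atlas S1. \<exists>k\<in>atlas S2. p \<in> cdom S1 i \<and> q \<in> cdom S2 k" for p q
    using assms unfolding open_cover_def by blast
  then show ?thesis
    using assms unfolding open_cover_def product_mfd_def by (auto intro: open_Times)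
qed

text \<open>A chart of the product is a pair, so smoothness of one component is read off only where
  the other component also stays in a chart; hence the localization around each
  \<open>x\<close>.\<close>

lemma product_smooth_map:
  assumes cover: "open_cover S1" "open_cover S2" and F: "smooth_map (product_mfd \<epsilon> S1 S2) U F"
  shows "smooth_map S1 U (\<lambda>x. fst (F x))" and "smooth_map S2 U (\<lambda>x. snd (F x))"
proof -
  let ?M = "product_mfd \<epsilon> S1 S2"
  note M = product_open_cover[OF cover, of \<epsilon>]
  have U: "open U" "continuous_on U F" using F by (auto simp: smooth_map_def)
  have ik: "open {x\<in>U. fst (F x) \<in> cdom S1 i \<and> snd (F x) \<in> cdom S2 k}"
    "smooth_on {x\<in>U. fst (F x) \<in> cdom S1 i \<and> snd (F x) \<in> cdom S2 k}
      (\<lambda>x. (chart S1 i (fst (F x)), chart S2 k (snd (F x))))"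
    if "i \<in> atlas S1" "k \<in> atlas S2" for i k
    using open_chart_preimage[OF M F, of "(i, k)"] smooth_on_chart[OF F, of "(i, k)"] that
    by (auto simp: product_mfd_simps mem_Times_iff o_def)
  show "smooth_map S1 U (\<lambda>x. fst (F x))"
    unfolding smooth_map_def
  proof (intro conjI ballI U continuous_intros smooth_on_local)
    fix i x assume i: "i \<in> atlas S1" and x: "x \<in> {x\<in>U. fst (F x) \<in> cdom S1 i}"
    obtain k where k: "k \<in> atlas S2" "snd (F x) \<in> cdom S2 k" using cover(2) unfolding open_cover_def by blast
    show "\<exists>N. open N \<and> x \<in> N \<and> smooth_on N (chart S1 i \<circ> (\<lambda>x. fst (F x)))"
      using ik[OF i k(1)] smooth_on_bounded_linear[OF bounded_linear_fst ik[OF i k(1)]] x k(2)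
      by (auto simp: o_def)
  qed
  show "smooth_map S2 U (\<lambda>x. snd (F x))"
    unfolding smooth_map_def
  proof (intro conjI ballI U continuous_intros smooth_on_local)
    fix k x assume k: "k \<in> atlas S2" and x: "x \<in> {x\<in>U. snd (F x) \<in> cdom S2 k}"
    obtain i where i: "i \<in> atlas S1" "fst (F x) \<in> cdom S1 i" using cover(1) unfolding open_cover_def by blast
    show "\<exists>N. open N \<and> x \<in> N \<and> smooth_on N (chart S2 k \<circ> (\<lambda>x. snd (F x)))"
      using ik[OF i(1) k] smooth_on_bounded_linear[OF bounded_linear_snd ik[OF i(1) k]] x i(2)
      by (auto simp: o_def)
  qed
qed

text \<open>The chart chosen for the product at \<open>F x\<close> may differ from the pair of
  charts chosen in the factors; \<open>induced_chart\<close> makes up for the difference.\<close>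

lemma product_induced:
  assumes S: "lorentzian_surface S1" "lorentzian_surface S2"
    and F: "smooth_map (product_mfd \<epsilon> S1 S2) U F" and x: "x \<in> U"
  shows "induced (product_mfd \<epsilon> S1 S2) F x a b
    = induced S1 (\<lambda>x. fst (F x)) x a b + \<epsilon> * induced S2 (\<lambda>x. snd (F x)) x a b"
proof -
  let ?M = "product_mfd \<epsilon> S1 S2"
  note cover = S[THEN lorentzian_open_cover]
  note M = product_open_cover[OF cover, of \<epsilon>]
  note PQ = product_smooth_map[OF cover F]
  obtain i k where ik: "chart_at ?M (F x) = (i, k)" by (cases "chart_at ?M (F x)")
  have i: "i \<in> atlas S1" "fst (F x) \<in> cdom S1 i" and k: "k \<in> atlas S2" "snd (F x) \<in> cdom S2 k"
    using chart_at[OF M, of "F x"] by (simp_all add: ik product_mfd_simps mem_Times_iff)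
  let ?p = "chart S1 i \<circ> (\<lambda>x. fst (F x))" and ?q = "chart S2 k \<circ> (\<lambda>x. snd (F x))"
  have "loc ?M F x = (\<lambda>x. (?p x, ?q x))"
    by (simp add: loc_def ik product_mfd_simps o_def)
  moreover have "((\<lambda>x. (?p x, ?q x)) has_derivative (\<lambda>v. (dderiv ?p x v, dderiv ?q x v))) (at x)"
    using x i k by (intro has_derivative_Pair smooth_on_has_derivative[OF smooth_on_chart[OF PQ(1)]]
        smooth_on_has_derivative[OF smooth_on_chart[OF PQ(2)]]) auto
  ultimately have "push ?M F x v = (dderiv ?p x v, dderiv ?q x v)" for v
    by (simp add: push_def dderiv_eqI)
  then show ?thesis
    by (simp add: induced_def[of ?M] met_at_def ik product_mfd_simps
        induced_chart[OF S(1) PQ(1) i(1) x i(2)] induced_chart[OF S(2) PQ(2) k(1) x k(2)] o_def)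
qed

section \<open>Variations of a geodesic factor\<close>

text \<open>Both sides are the derivative at \<open>x\<close> of
  \<open>\<lambda>y. f (t, y)\<close>, once as a restriction of \<open>f\<close> and once as
  \<open>c\<close> composed with \<open>l\<close>.\<close>

lemma dderiv_slice:
  fixes f :: "real \<times> 'e::euclidean_space \<Rightarrow> 'c::real_normed_vector" and c :: "real \<Rightarrow> 'c"
  assumes f: "f differentiable (at (t, x))" and c: "c differentiable (at (l x))" and l: "bounded_linear l"
    and W: "open W" "x \<in> W" "\<And>y. y \<in> W \<Longrightarrow> f (t, y) = c (l y)"
  shows "dderiv f (t, x) (0, v) = dderiv c (l x) (l v)"
proof -
  have "((\<lambda>y. (t, y)) has_derivative (\<lambda>v. (0, v))) (at x)" by (auto intro!: derivative_eq_intros)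
  from has_derivative_compose[OF this, of f] f
  have 1: "((\<lambda>y. f (t, y)) has_derivative (\<lambda>v. dderiv f (t, x) (0, v))) (at x)"
    by (simp add: frechet_derivative_works)
  from has_derivative_compose[OF bounded_linear_imp_has_derivative[OF l], of c] c
  have "((\<lambda>y. c (l y)) has_derivative (\<lambda>v. dderiv c (l x) (l v))) (at x)"
    by (simp add: frechet_derivative_works)
  then have "((\<lambda>y. f (t, y)) has_derivative (\<lambda>v. dderiv c (l x) (l v))) (at x)"
    by (rule has_derivative_transform_within_open[OF _ W(1,2)]) (simp add: W(3))
  from has_derivative_unique[OF 1 this] show ?thesis by meson
qed

lemma dderiv_slice_zero:
  fixes f :: "real \<times> 'e::euclidean_space \<Rightarrow> 'c::real_normed_vector"
  assumes "f differentiable (at (t, x))" "open W" "x \<in> W" "\<And>y. y \<in> W \<Longrightarrow> f (t, y) = 0"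
  shows "dderiv f (t, x) (0, v) = 0"
proof -
  have "dderiv f (t, x) (0, v) = dderiv (\<lambda>_::real. 0::'c) 0 0"
    using dderiv_slice[OF assms(1) differentiable_const bounded_linear_zero assms(2,3), of 0] assms(4) by simp
  then show ?thesis by (simp add: dderiv_eqI[OF has_derivative_const])
qed

lemma dderiv_translate:
  assumes "f differentiable (at (x + c))" "open N" "x \<in> N" "\<And>y. y \<in> N \<Longrightarrow> f (y + c) = f y"
  shows "dderiv f (x + c) v = dderiv f x v"
proof -
  have "((\<lambda>y. y + c) has_derivative (\<lambda>v. v)) (at x)" by (auto intro!: derivative_eq_intros)
  from has_derivative_compose[OF this, of f] assms(1)
  have "((\<lambda>y. f (y + c)) has_derivative (\<lambda>v. dderiv f (x + c) v)) (at x)"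
    by (simp add: frechet_derivative_works)
  then have "(f has_derivative (\<lambda>v. dderiv f (x + c) v)) (at x)"
    by (rule has_derivative_transform_within_open[OF _ assms(2,3)]) (rule assms(4))
  then show ?thesis by (simp add: dderiv_eqI)
qed

lemma smooth_map_differentiable_loc:
  assumes "open_cover M" "smooth_map M U F" "x \<in> U"
  shows "loc M F x differentiable (at x)"
  unfolding loc_def
  by (rule smooth_on_differentiable[OF smooth_on_chart[OF assms(2) chart_at(1)[OF assms(1)]]])
    (use assms chart_at(2)[OF assms(1)] in auto)

lemma push_0: "open_cover M \<Longrightarrow> smooth_map M U F \<Longrightarrow> x \<in> U \<Longrightarrow> push M F x 0 = 0"
  unfolding push_def by (rule linear_0[OF linear_dderiv[OF smooth_map_differentiable_loc]])

text \<open>Restricting \<open>F\<close> to the line through \<open>x\<close> in direction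
  \<open>v\<close> gives a constant curve, whose push-forward is zero; in other directions
  \<open>F\<close> may vary.\<close>

lemma push_locally_constant:
  assumes M: "open_cover M" and F: "smooth_map M U F" and x: "x \<in> U"
    and J: "0 < r" "\<And>h. \<bar>h\<bar> < r \<Longrightarrow> F (x + h *\<^sub>R v) = F x"
  shows "push M F x v = 0"
proof -
  have "((\<lambda>h::real. x + h *\<^sub>R v) has_derivative (\<lambda>h. h *\<^sub>R v)) (at 0)" by (auto intro!: derivative_eq_intros)
  then have "push M (\<lambda>_. F x) (0::real) 1 = push M F (x + 0 *\<^sub>R v) (1 *\<^sub>R v)"
    by (rule push_compose[OF M F, where A="\<lambda>h. x + h *\<^sub>R v" and A'="\<lambda>h. h *\<^sub>R v" and x=0
          and N="ball 0 r" and f="\<lambda>_. F x"])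
      (use x J in \<open>auto simp: dist_real_def\<close>)
  moreover have "push M (\<lambda>_. F x) (0::real) 1 = 0"
    by (simp add: push_def loc_def o_def dderiv_eqI[OF has_derivative_const])
  ultimately show ?thesis by simp
qed

text \<open>
  One factor of a variation of \<open>\<phi> \<times> \<psi>\<close>: at time \<open>0\<close> the map \<open>P\<close> depends on the parameter only through
  \<open>l\<close>, so \<open>a\<close> is the direction of the geodesic and \<open>b\<close> the direction of the other factor.
  The sign \<open>\<sigma>\<close> turns \<open>\<gamma>\<close> into a spacelike curve.
\<close>

locale geodesic_slice =
  fixes S :: "('p::{t2_space,second_countable_topology}, real^2, 'i) metric_mfd"
    and \<sigma> :: real and I :: "real set" and L :: real and \<gamma> :: "real \<Rightarrow> 'p" and \<delta> :: real
    and U0 :: "'e::euclidean_space set" and P :: "real \<times> 'e \<Rightarrow> 'p" and l :: "'e \<Rightarrow> real" and a b :: 'e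
  assumes S: "lorentzian_surface S" and curv: "\<And>p. \<sigma> * gauss_curvature S p \<le> 0"
    and geod: "geodesic S I L \<gamma>" and pos: "\<And>s. s \<in> I \<Longrightarrow> \<sigma> * induced S \<gamma> s 1 1 > 0"
    and \<delta>: "\<delta> > 0" and U0: "open U0" and P: "smooth_map S ({-\<delta><..<\<delta>} \<times> U0) P"
    and l: "bounded_linear l" "l a = 1" "l b = 0" "l ` U0 \<subseteq> I"
    and P0: "\<And>x. x \<in> U0 \<Longrightarrow> P (0, x) = \<gamma> (l x)"
begin

abbreviation "U \<equiv> {-\<delta><..<\<delta>} \<times> U0"
abbreviation "T \<equiv> (1, 0) :: real \<times> 'e"

lemma open_U: "open U"
  using U0 by (intro open_Times) auto

lemma in_U: "x \<in> U0 \<Longrightarrow> (0, x) \<in> U"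
  using \<delta> by simp

lemma cover: "open_cover S"
  by (rule lorentzian_open_cover[OF S])

lemma \<gamma>: "smooth_map S I \<gamma>" "is_interval I"
  using geod by (auto simp: geodesic_def smooth_curve_def)

lemma l_in: "x \<in> U0 \<Longrightarrow> l x \<in> I"
  using l(4) by auto

text \<open>Components of the induced metric for \<open>\<sigma>\<close> times the metric of
  \<open>S\<close>; the one in direction \<open>a\<close> is positive at time 0.\<close>

definition met_comp :: "real \<times> 'e \<Rightarrow> real \<times> 'e \<Rightarrow> real \<times> 'e \<Rightarrow> real" where
  "met_comp u v z = \<sigma> * induced S P z u v"

text \<open>
  The component \<open>\<langle>\<nabla>\<^sub>t\<partial>\<^sub>tP, \<partial>\<^sub>aP\<rangle>\<close> of the acceleration, written with derivatives of the induced
  metric only: in this form it is smooth across changes of charts.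
\<close>

definition flux :: "real \<times> 'e \<Rightarrow> real" where
  "flux z = dderiv (met_comp T (0, a)) z T - dderiv (met_comp T T) z (0, a) / 2"

lemma smooth_met_comp: "smooth_on U (met_comp u v)"
  unfolding met_comp_def[abs_def] by (rule smooth_on_cmult[OF open_U smooth_induced[OF S P]])

lemma smooth_flux: "smooth_on U flux"
  unfolding flux_def[abs_def] divide_inverse
  by (intro smooth_on_diff smooth_on_mult smooth_on_const smooth_on_dderiv smooth_met_comp open_U)

lemma met_comp_commute: "z \<in> U \<Longrightarrow> met_comp u v z = met_comp v u z"
  by (simp add: met_comp_def induced_commute[OF S P, of z u v])

lemma dderiv_met_comp: "z \<in> U \<Longrightarrow> dderiv (met_comp u v) z w = \<sigma> * dderiv (\<lambda>y. induced S P y u v) z w"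
  unfolding met_comp_def[abs_def]
  by (rule dderiv_eqI) (intro has_derivative_mult_right smooth_on_has_derivative[OF smooth_induced[OF S P]])

lemma slice_derivative: "((\<lambda>y. (0::real, y)) has_derivative (\<lambda>v. (0, v))) (at x)" for x :: 'e
  by (auto intro!: derivative_eq_intros)

lemma push_slice: "x \<in> U0 \<Longrightarrow> push S P (0, x) (0, v) = push S \<gamma> (l x) (l v)"
  using push_compose[OF cover P slice_derivative in_U U0, of x "\<lambda>y. P (0, y)" v]
    push_compose[OF cover \<gamma>(1) bounded_linear_imp_has_derivative[OF l(1)] l_in U0, of x "\<lambda>y. P (0, y)" v] P0
  by simp

lemma induced_slice: "x \<in> U0 \<Longrightarrow> induced S P (0, x) (0, u) (0, v) = induced S \<gamma> (l x) (l u) (l v)"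
  by (simp add: induced_def push_slice P0)

text \<open>First derivatives agree on a whole neighbourhood \<open>W\<close> of \<open>x\<close>,
  so \<open>dderiv_slice\<close> applies to them again; the linear map \<open>l\<close> adds no
  second-order term.\<close>

lemma cov_slice:
  assumes x: "x \<in> U0"
  shows "cov S P (0, x) (0, u) (0, v) = cov S \<gamma> (l x) (l u) (l v)"
proof -
  let ?i = "chart_at S (\<gamma> (l x))"
  let ?p = "chart S ?i \<circ> P" and ?c = "chart S ?i \<circ> \<gamma>"
  have i: "?i \<in> atlas S" "\<gamma> (l x) \<in> cdom S ?i" using chart_at[OF cover] by auto
  let ?NP = "{z\<in>U. P z \<in> cdom S ?i}" and ?NG = "{s\<in>I. \<gamma> s \<in> cdom S ?i}"
  have sp: "smooth_on ?NP ?p" "smooth_on ?NG ?c"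
    using smooth_on_chart[OF P i(1)] smooth_on_chart[OF \<gamma>(1) i(1)] by auto
  define W where "W = {y\<in>U0. \<gamma> (l y) \<in> cdom S ?i}"
  have "W = U0 \<inter> l -` ?NG" using l_in by (auto simp: W_def)
  moreover have "open (U0 \<inter> l -` ?NG)"
    by (intro continuous_open_preimage U0 open_chart_preimage[OF cover \<gamma>(1) i(1)]
        linear_continuous_on l(1))
  ultimately have W: "open W" "x \<in> W" using x i by (auto simp: W_def)
  have 1: "dderiv ?p (0, y) (0, v) = dderiv ?c (l y) (l v)" if y: "y \<in> W" for y
    using y in_U l_in
    by (intro dderiv_slice[OF _ _ l(1) W(1) y] smooth_on_differentiable[OF sp(1)] smooth_on_differentiable[OF sp(2)])
      (auto simp: W_def P0)
  have "dderiv (\<lambda>z. dderiv ?p z (0, v)) (0, x) (0, u) = dderiv (\<lambda>s. dderiv ?c s (l v)) (l x) (l u)"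
    using W(2) in_U l_in
    by (intro dderiv_slice[where W=W and c="\<lambda>s. dderiv ?c s (l v)"] l(1) W 1
        smooth_on_differentiable[OF smooth_on_dderiv[OF sp(1)]]
        smooth_on_differentiable[OF smooth_on_dderiv[OF sp(2)]])
      (auto simp: W_def P0)
  then show ?thesis
    by (simp add: cov_def push_slice[OF x] loc_def P0[OF x])
qed

lemma push_slice_b: "x \<in> U0 \<Longrightarrow> push S P (0, x) (0, b) = 0"
  by (simp add: push_slice l push_0[OF cover \<gamma>(1) l_in])

lemma cov_slice_a: "x \<in> U0 \<Longrightarrow> cov S P (0, x) (0, a) (0, a) = 0"
  using geod l_in by (simp add: cov_slice l geodesic_def)

text \<open>As \<open>l b = 0\<close>, the map is stationary in direction \<open>b\<close> along the
  whole slice: the derivative is that of a zero function, and the Christoffel term has a zero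
  argument.\<close>

lemma cov_slice_b:
  assumes x: "x \<in> U0" shows "cov S P (0, x) (0, a) (0, b) = 0"
proof -
  let ?s = "l x"
  let ?i = "chart_at S (\<gamma> ?s)"
  let ?c = "chart S ?i \<circ> \<gamma>"
  have i: "?i \<in> atlas S" "\<gamma> ?s \<in> cdom S ?i" using chart_at[OF cover] by auto
  interpret L: lorentz_metric "chart S ?i ` cdom S ?i" "met S ?i"
    by (rule lorentzian_chart[OF S i(1)])
  have "dderiv (\<lambda>s. dderiv ?c s 0) ?s 1 = dderiv (\<lambda>s. 0) ?s 1"
  proof (rule dderiv_cong_open[OF open_chart_preimage[OF cover \<gamma>(1) i(1)]])
    show "dderiv ?c s 0 = 0" if "s \<in> {s\<in>I. \<gamma> s \<in> cdom S ?i}" for s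
      by (rule linear_0[OF linear_dderiv[OF smooth_on_differentiable[OF smooth_on_chart[OF \<gamma>(1) i(1)] that]]])
  qed (use l_in[OF x] i in simp)
  then show ?thesis
    using i(2) unfolding cov_slice[OF x] l
    by (simp add: cov_def loc_def push_0[OF cover \<gamma>(1) l_in[OF x]]
        bilinear_rzero[OF L.bilinear_christoffel] dderiv_eqI[OF has_derivative_const])
qed

lemma met_comp_aa: "x \<in> U0 \<Longrightarrow> met_comp (0, a) (0, a) (0, x) = \<sigma> * induced S \<gamma> (l x) 1 1"
  by (simp add: met_comp_def induced_slice l)

lemma met_comp_aa_pos: "x \<in> U0 \<Longrightarrow> \<sigma> * induced S P (0, x) (0, a) (0, a) > 0"
  by (simp add: induced_slice l pos[OF l_in])

lemma met_comp_b: "x \<in> U0 \<Longrightarrow> met_comp (0, b) v (0, x) = 0"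
  by (simp add: met_comp_def induced_push_zero[OF S P in_U push_slice_b])

text \<open>Provides the constant weights with which the two fluxes enter the second
  variation.\<close>

lemma energy_constant:
  assumes "s \<in> I" "s' \<in> I" shows "induced S \<gamma> s 1 1 = induced S \<gamma> s' 1 1"
proof -
  note sm = smooth_induced[OF S \<gamma>(1), of 1 1]
  have "((\<lambda>s. induced S \<gamma> s 1 1) has_real_derivative 0) (at s)" if s: "s \<in> I" for s
  proof -
    have "dderiv (\<lambda>s. induced S \<gamma> s 1 1) s 1 = 0"
      using geod s by (intro dderiv_induced_self[OF S \<gamma>(1) s]) (simp add: geodesic_def)
    moreover have "((\<lambda>r. induced S \<gamma> (0 + r *\<^sub>R 1) 1 1) has_real_derivative
        dderiv (\<lambda>s. induced S \<gamma> s 1 1) (0 + s *\<^sub>R 1) 1) (at s)"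
      by (rule has_real_derivative_line) (use smooth_on_differentiable[OF sm s] in simp)
    ultimately show "((\<lambda>s. induced S \<gamma> s 1 1) has_real_derivative 0) (at s)" by simp
  qed
  then have "(\<lambda>s. induced S \<gamma> s 1 1) constant_on I"
    using \<gamma> by (intro has_field_derivative_0_imp_constant_on) (auto simp: is_interval_connected_1 smooth_map_def)
  then show ?thesis using assms by (auto simp: constant_on_def)
qed

lemma dderiv2_met_comp:
  assumes z: "z \<in> U"
  shows "dderiv (\<lambda>y. dderiv (met_comp u v) y w) z w' = \<sigma> * dderiv (\<lambda>y. dderiv (\<lambda>y. induced S P y u v) y w) z w'"
proof -
  have "dderiv (\<lambda>y. dderiv (met_comp u v) y w) z w' = dderiv (\<lambda>y. \<sigma> * dderiv (\<lambda>y. induced S P y u v) y w) z w'"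
    by (rule dderiv_cong_open[OF open_U z]) (rule dderiv_met_comp)
  also have "\<dots> = \<sigma> * dderiv (\<lambda>y. dderiv (\<lambda>y. induced S P y u v) y w) z w'"
    by (rule dderiv_eqI)
      (intro has_derivative_mult_right smooth_on_has_derivative[OF smooth_on_dderiv[OF smooth_induced[OF S P]] z])
  finally show ?thesis .
qed

text \<open>Where \<open>P\<close> never moves, its velocity vanishes on an open set of times and
  parameters. Every \<open>met_comp T v\<close> is zero there, and \<open>flux\<close> consists of
  derivatives of such components.\<close>

lemma flux_eq_0:
  assumes W: "open W" "W \<subseteq> U0" "\<And>t y. t \<in> {-\<delta><..<\<delta>} \<Longrightarrow> y \<in> W \<Longrightarrow> P (t, y) = P (0, y)" and x: "x \<in> W"
  shows "flux (0, x) = 0"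
proof -
  let ?N = "{-\<delta><..<\<delta>} \<times> W"
  have N: "open ?N" "(0, x) \<in> ?N" using W(1) x \<delta> by (auto intro: open_Times)
  have "met_comp T v z = 0" if "z \<in> ?N" for v z
  proof -
    obtain t y where z: "z = (t, y)" by (cases z)
    have ty: "t \<in> {-\<delta><..<\<delta>}" "y \<in> W" using that z by auto
    have zU: "z \<in> U" using z ty W(2) by auto
    have "push S P z T = 0"
    proof (rule push_locally_constant[OF cover P zU])
      show "0 < min (t + \<delta>) (\<delta> - t)" using ty by auto
      show "P (z + h *\<^sub>R T) = P z" if "\<bar>h\<bar> < min (t + \<delta>) (\<delta> - t)" for h
        using W(3)[of "t + h" y] W(3)[of t y] ty that by (auto simp: z abs_less_iff)
    qed
    then show ?thesis by (simp add: met_comp_def induced_push_zero[OF S P zU])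
  qed
  then have "dderiv (met_comp T v) (0, x) w = dderiv (\<lambda>_. 0) (0, x) w" for v w
    by (intro dderiv_cong_open[OF N])
  then show ?thesis by (simp add: flux_def dderiv_eqI[OF has_derivative_const])
qed

lemma flux_periodic:
  assumes c: "\<And>y. y \<in> U0 \<Longrightarrow> y + c \<in> U0"
    "\<And>t y. t \<in> {-\<delta><..<\<delta>} \<Longrightarrow> y \<in> U0 \<Longrightarrow> P (t, y + c) = P (t, y)" and x: "x \<in> U0"
  shows "flux (0, x + c) = flux (0, x)"
proof -
  have cU: "z + (0, c) \<in> U" if "z \<in> U" for z using that c(1) by auto
  have "met_comp u v (z + (0, c)) = met_comp u v z" if z: "z \<in> U" for u v z
  proof -
    have "((\<lambda>z. z + (0, c)) has_derivative (\<lambda>v. v)) (at z)" by (auto intro!: derivative_eq_intros)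
    from induced_compose[OF cover P this cU[OF z] open_U z, of P u v]
    show ?thesis using c(2) by (auto simp: met_comp_def)
  qed
  then have "dderiv (met_comp u v) ((0, x) + (0, c)) w = dderiv (met_comp u v) (0, x) w" for u v w
    using in_U[OF x] cU
    by (intro dderiv_translate[OF _ open_U] smooth_on_differentiable[OF smooth_met_comp]) blast+
  then show ?thesis by (simp add: flux_def)
qed

end

text \<open>Kept apart from \<open>geodesic_slice\<close> because normality within one factor is
  deduced from slice facts about the other factor.\<close>

locale geodesic_variation = geodesic_slice +
  assumes normal: "\<And>x. x \<in> U0 \<Longrightarrow> induced S P (0, x) (1, 0) (0, a) = 0"
begin

lemma dderiv_normal: "x \<in> U0 \<Longrightarrow> dderiv (\<lambda>y. induced S P y T (0, a)) (0, x) (0, v) = 0"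
  by (rule dderiv_slice_zero[OF smooth_on_differentiable[OF smooth_induced[OF S P] in_U] U0])
    (simp_all add: normal)

lemma dderiv_met_comp_time:
  assumes x: "x \<in> U0"
  shows "dderiv (met_comp (0, a) (0, a)) (0, x) T = 0"
    and "dderiv (met_comp (0, b) (0, b)) (0, x) T = 0"
    and "dderiv (met_comp (0, a) (0, b)) (0, x) T = 0"
  using dderiv_induced_cross[OF S P in_U[OF x] cov_slice_a[OF x] dderiv_normal[OF x]]
    dderiv_induced_push_zero[OF S P in_U[OF x] push_slice_b[OF x]]
    dderiv_induced_degenerate[OF S P in_U[OF x] push_slice_b[OF x] cov_slice_b[OF x] dderiv_normal[OF x] met_comp_aa_pos[OF x]]
  by (simp_all add: dderiv_met_comp[OF in_U[OF x]])

lemma second_time_derivative_aa: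
  assumes x: "x \<in> U0"
  shows "dderiv (\<lambda>z. dderiv (met_comp (0, a) (0, a)) z T) (0, x) T \<le> 2 * dderiv flux (0, x) (0, a)"
proof -
  let ?w = "\<lambda>y. dderiv (\<lambda>z. induced S P z T (0, a)) y T - dderiv (\<lambda>z. induced S P z T T) y (0, a) / 2"
  have w: "smooth_on U ?w"
    unfolding divide_inverse
    by (intro smooth_on_diff smooth_on_mult smooth_on_const smooth_on_dderiv smooth_induced[OF S P] open_U)
  have "dderiv flux (0, x) (0, a) = dderiv (\<lambda>z. \<sigma> * ?w z) (0, x) (0, a)"
    by (rule dderiv_cong_open[OF open_U in_U[OF x]]) (simp add: flux_def dderiv_met_comp right_diff_distrib)
  also have "\<dots> = \<sigma> * dderiv ?w (0, x) (0, a)"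
    by (rule dderiv_eqI) (intro has_derivative_mult_right smooth_on_has_derivative[OF w in_U[OF x]])
  finally show ?thesis
    using second_dderiv_induced_le[OF S P in_U[OF x] cov_slice_a[OF x] dderiv_normal[OF x] met_comp_aa_pos[OF x] curv]
    unfolding dderiv2_met_comp[OF in_U[OF x]] by simp
qed

lemma second_time_derivative_bb:
  assumes x: "x \<in> U0"
  shows "dderiv (\<lambda>z. dderiv (met_comp (0, b) (0, b)) z T) (0, x) T \<le> 0"
  unfolding dderiv2_met_comp[OF in_U[OF x]]
  by (rule second_dderiv_induced_degenerate[OF S P in_U[OF x] push_slice_b[OF x] cov_slice_b[OF x]
        dderiv_normal[OF x] met_comp_aa_pos[OF x]])

end

section \<open>Integrals over compact sets\<close>

text \<open>Meant for a compact set cut down by a fundamental cell, which is half-open for a circle,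
  so that \<open>B\<close> itself may fail to be compact.\<close>

lemma set_integrable_compact_subset:
  fixes f :: "'a::euclidean_space \<Rightarrow> real"
  assumes "compact K" "continuous_on K f" "B \<in> sets borel" "B \<subseteq> K"
  shows "set_integrable lborel B f"
  by (rule set_integrable_subset[of lborel K])
    (use assms borel_integrable_compact[OF assms(1,2)] in \<open>auto simp: set_integrable_def\<close>)

text \<open>Compactness of \<open>K\<close> makes \<open>f' t x\<close> close to
  \<open>f' t0 x\<close> uniformly in \<open>x\<close>, and the mean value inequality turns this
  into a uniform bound for the error of the difference quotients.\<close>

lemma has_real_derivative_set_integral:
  fixes f f' :: "real \<Rightarrow> 'a::euclidean_space \<Rightarrow> real"
  assumes K: "compact K" and B: "B \<in> sets borel" "B \<subseteq> K" and t0: "t0 \<in> {-d<..<d}"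
    and f: "\<And>t. t \<in> {-d<..<d} \<Longrightarrow> continuous_on K (f t)"
    and df: "\<And>t x. t \<in> {-d<..<d} \<Longrightarrow> x \<in> K \<Longrightarrow> ((\<lambda>t. f t x) has_real_derivative f' t x) (at t)"
    and f': "continuous_on ({-d<..<d} \<times> K) (\<lambda>(t, x). f' t x)"
  shows "((\<lambda>t. LINT x:B|lborel. f t x) has_real_derivative (LINT x:B|lborel. f' t0 x)) (at t0)"
proof -
  have "continuous_on K (\<lambda>x. (t0, x))" by (intro continuous_intros)
  from continuous_on_compose2[OF f' this] have f't0: "continuous_on K (f' t0)"
    using t0 by (simp add: image_subset_iff)
  note int = set_integrable_compact_subset[OF K _ B]
  define m where "m = measure lborel B"
  have fin: "emeasure lborel B < \<infinity>"
    using emeasure_bounded_finite[OF bounded_subset[OF compact_imp_bounded[OF K] B(2)]] by simp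
  show ?thesis
    unfolding DERIV_def
  proof (rule LIM_I)
    fix e :: real assume "0 < e"
    \<comment> \<open>The integrated error is at most \<open>e' * m\<close>; the summand 1 covers a
      null set \<open>B\<close>.\<close>
    define e' where "e' = e / (2 * (m + 1))"
    have "m \<ge> 0" by (simp add: m_def)
    then have e': "0 < e'" "e' * m < e" using \<open>0 < e\<close> by (auto simp: e'_def field_simps add_nonneg_pos)
    obtain X0 where X0: "t0 \<in> X0" "open X0"
      "\<forall>t\<in>X0 \<inter> {-d<..<d}. \<forall>x\<in>K. dist (f' t x) (f' t0 x) \<le> e'"
      using continuous_on_prod_compactE[OF f' K t0 e'(1)] by auto
    have "open (X0 \<inter> {-d<..<d})" "t0 \<in> X0 \<inter> {-d<..<d}" using X0 t0 by auto
    then obtain r where r: "0 < r" "ball t0 r \<subseteq> X0 \<inter> {-d<..<d}" using openE by blast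
    have "norm (((LINT x:B|lborel. f (t0 + h) x) - (LINT x:B|lborel. f t0 x)) / h - (LINT x:B|lborel. f' t0 x)) < e"
      if h: "h \<noteq> 0" "norm (h - 0) < r" for h
    proof -
      have seg: "t \<in> X0 \<inter> {-d<..<d}" if "t \<in> closed_segment t0 (t0 + h)" for t
        using that h r(2) segment_bound(1)[OF that] by (auto simp: dist_norm subset_eq)
      have bound: "norm ((f (t0 + h) x - f t0 x) / h - f' t0 x) \<le> e'" if x: "x \<in> K" for x
      proof -
        \<comment> \<open>Mean value inequality for \<open>f t x - t * f' t0 x\<close>, whose
          \<open>t\<close>-derivative is small on the segment.\<close>
        have "norm ((f (t0 + h) x - (t0 + h) * f' t0 x) - (f t0 x - t0 * f' t0 x)) \<le> e' * norm ((t0 + h) - t0)"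
        proof (rule field_differentiable_bound[of "closed_segment t0 (t0 + h)" _ "\<lambda>t. f' t x - f' t0 x"])
          fix t assume t: "t \<in> closed_segment t0 (t0 + h)"
          show "((\<lambda>t. f t x - t * f' t0 x) has_field_derivative f' t x - f' t0 x) (at t within closed_segment t0 (t0 + h))"
            using seg[OF t] x by (auto intro!: derivative_eq_intros DERIV_subset[OF df])
          show "norm (f' t x - f' t0 x) \<le> e'"
            using seg[OF t] x X0(3) by (auto simp: dist_norm)
        qed auto
        moreover have "h * ((f (t0 + h) x - f t0 x) / h - f' t0 x)
            = (f (t0 + h) x - (t0 + h) * f' t0 x) - (f t0 x - t0 * f' t0 x)"
        proof -
          have "h * ((f (t0 + h) x - f t0 x) / h) = f (t0 + h) x - f t0 x" using h(1) by simp
          then show ?thesis unfolding right_diff_distrib[of h] by (simp only:) (simp add: algebra_simps)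
        qed
        ultimately have "norm (h * ((f (t0 + h) x - f t0 x) / h - f' t0 x)) \<le> e' * norm h"
          by simp
        then have "norm h * norm ((f (t0 + h) x - f t0 x) / h - f' t0 x) \<le> norm h * e'"
          unfolding norm_mult by (simp only: mult.commute)
        then show ?thesis by (rule mult_left_le_imp_le) (use h(1) in simp)
      qed
      have th: "t0 + h \<in> {-d<..<d}" using seg[of "t0 + h"] by simp
      note I = int[OF f[OF th]] int[OF f[OF t0]] int[OF f't0]
      have "((LINT x:B|lborel. f (t0 + h) x) - (LINT x:B|lborel. f t0 x)) / h - (LINT x:B|lborel. f' t0 x)
        = (LINT x:B|lborel. (f (t0 + h) x - f t0 x) / h - f' t0 x)"
        using I by (simp add: set_integral_diff)
      also have "norm \<dots> \<le> (LINT x:B|lborel. norm ((f (t0 + h) x - f t0 x) / h - f' t0 x))"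
        using I by (intro set_integral_norm_bound set_integral_diff set_integrable_divide)
      also have "\<dots> \<le> (LINT x:B|lborel. e')"
        using I B bound K
        by (intro set_integral_mono set_integrable_norm set_integral_diff set_integrable_divide
            int continuous_on_const f[OF th] f[OF t0] f't0) auto
      also have "\<dots> = e' * m"
        using fin by (simp add: set_integral_const m_def mult.commute B)
      also have "\<dots> < e" by (rule e')
      finally show ?thesis .
    qed
    then show "\<exists>s>0. \<forall>h. h \<noteq> 0 \<and> norm (h - 0) < s \<longrightarrow>
      norm (((LINT x:B|lborel. f (t0 + h) x) - (LINT x:B|lborel. f t0 x)) / h - (LINT x:B|lborel. f' t0 x)) < e"
      using r(1) by blast
  qed
qed

section \<open>The second derivative of an area integral\<close>

lemma smooth_on_time_derivative:
  fixes D :: "real \<times> 'a::euclidean_space \<Rightarrow> real"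
  assumes "smooth_on U D" "(t, x) \<in> U"
  shows "((\<lambda>t. D (t, x)) has_real_derivative dderiv D (t, x) (1, 0)) (at t)"
proof -
  have "((\<lambda>r. D ((0, x) + r *\<^sub>R (1, 0))) has_real_derivative dderiv D ((0, x) + t *\<^sub>R (1, 0)) (1, 0)) (at t)"
    by (rule has_real_derivative_line) (use smooth_on_differentiable[OF assms] in simp)
  then show ?thesis by simp
qed

text \<open>The second derivative of the square root has a term with the second time derivative of
  \<open>D\<close> and a term with the square of the first; \<open>D1\<close> removes the latter at
  time 0.\<close>

lemma second_derivative_area:
  fixes D :: "real \<times> 'a::euclidean_space \<Rightarrow> real"
  assumes \<delta>: "\<delta> > 0" and U0: "open U0" and K: "compact K" "K \<subseteq> U0" and B: "B \<in> sets borel" "B \<subseteq> K"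
    and D: "smooth_on ({-\<delta><..<\<delta>} \<times> U0) D"
    and D0: "\<And>x. x \<in> K \<Longrightarrow> D (0, x) = c" and c: "c > 0"
    and D1: "\<And>x. x \<in> K \<Longrightarrow> dderiv D (0, x) (1, 0) = 0"
  shows "deriv (deriv (\<lambda>t. LINT x:B|lborel. sqrt \<bar>D (t, x)\<bar>)) 0
    = (LINT x:B|lborel. dderiv (\<lambda>z. dderiv D z (1, 0)) (0, x) (1, 0) / (2 * sqrt c))"
proof -
  let ?U = "{-\<delta><..<\<delta>} \<times> U0" and ?T = "(1, 0) :: real \<times> 'a"
  let ?D1 = "\<lambda>z. dderiv D z ?T"
  let ?D2 = "\<lambda>z. dderiv ?D1 z ?T"
  have openU: "open ?U" using U0 by (intro open_Times) auto
  have sD1: "smooth_on ?U ?D1" by (rule smooth_on_dderiv[OF D])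
  have cont: "continuous_on ?U D" "continuous_on ?U ?D1" "continuous_on ?U ?D2"
    using D sD1 smooth_on_dderiv[OF sD1] smooth_on_continuous by blast+
  define W where "W = {z\<in>?U. D z > 0}"
  have oW: "open W"
    using continuous_open_preimage[OF cont(1) openU, of "{0<..}"] by (simp add: W_def Int_def vimage_def)
  have "{0} \<times> K \<subseteq> W" using K D0 c \<delta> by (auto simp: W_def)
  then obtain X0 where X0: "0 \<in> X0" "open X0" "X0 \<times> K \<subseteq> W"
    using Elementary_Topology.tube_lemma[OF K(1) oW] by blast
  then obtain d where d: "0 < d" "ball 0 d \<subseteq> X0" using openE by blast
  have pos: "(t, x) \<in> ?U \<and> D (t, x) > 0" if "t \<in> {-d<..<d}" "x \<in> K" for t x
  proof -
    have "t \<in> X0" using d that by (auto simp: subset_eq dist_real_def)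
    then show ?thesis using X0(3) that by (auto simp: W_def)
  qed
  have K2: "continuous_on ({-d<..<d} \<times> K) D" "continuous_on ({-d<..<d} \<times> K) ?D1" "continuous_on ({-d<..<d} \<times> K) ?D2"
    using pos by (intro cont[THEN continuous_on_subset]; blast)+
  have slice: "continuous_on K (\<lambda>x. h (t, x))" if "continuous_on ({-d<..<d} \<times> K) h" "t \<in> {-d<..<d}"
    for h :: "real \<times> 'a \<Rightarrow> real" and t
  proof -
    have "continuous_on K (\<lambda>x. (t, x))" by (intro continuous_intros)
    from continuous_on_compose2[OF that(1) this] show ?thesis
      using that(2) by (simp add: image_subset_iff)
  qed
  define f1 where "f1 = (\<lambda>t x. ?D1 (t, x) / (2 * sqrt (D (t, x))))"
  define f2 where "f2 = (\<lambda>t x. ?D2 (t, x) / (2 * sqrt (D (t, x)))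
    - (?D1 (t, x))\<^sup>2 / (4 * D (t, x) * sqrt (D (t, x))))"
  have ne: "\<forall>z\<in>{-d<..<d} \<times> K. 2 * sqrt (D z) \<noteq> 0"
    "\<forall>z\<in>{-d<..<d} \<times> K. 4 * D z * sqrt (D z) \<noteq> 0"
    using pos by force+
  have c1: "continuous_on ({-d<..<d} \<times> K) (\<lambda>(t, x). f1 t x)"
    unfolding f1_def case_prod_beta prod.collapse
    by (rule continuous_on_divide[OF K2(2) _ ne(1)]) (intro continuous_intros K2)
  have c2: "continuous_on ({-d<..<d} \<times> K) (\<lambda>(t, x). f2 t x)"
    unfolding f2_def case_prod_beta prod.collapse
    by (intro continuous_on_diff continuous_on_divide[OF K2(3) _ ne(1)] continuous_on_divide[OF _ _ ne(2)]
        continuous_on_mult continuous_on_power continuous_on_const continuous_on_real_sqrt K2)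
  have dA: "((\<lambda>t. LINT x:B|lborel. sqrt \<bar>D (t, x)\<bar>) has_real_derivative (LINT x:B|lborel. f1 t x)) (at t)"
    if t: "t \<in> {-d<..<d}" for t
  proof (rule has_real_derivative_set_integral[OF K(1) B t _ _ c1])
    show "continuous_on K (\<lambda>x. sqrt \<bar>D (t, x)\<bar>)" if "t \<in> {-d<..<d}" for t
      by (intro continuous_intros slice[OF K2(1) that])
    show "((\<lambda>t. sqrt \<bar>D (t, x)\<bar>) has_real_derivative f1 t x) (at t)"
      if t: "t \<in> {-d<..<d}" and x: "x \<in> K" for t x
    proof (rule has_field_derivative_transform_within_open[of "\<lambda>t. sqrt (D (t, x))" _ _ "{-d<..<d}"])
      show "((\<lambda>t. sqrt (D (t, x))) has_real_derivative f1 t x) (at t)"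
        using pos[OF t x] smooth_on_time_derivative[OF D, of t x]
        by (auto intro!: derivative_eq_intros simp: f1_def field_simps)
      show "sqrt (D (t, x)) = sqrt \<bar>D (t, x)\<bar>" if "t \<in> {-d<..<d}" for t
        using pos[OF that x] by simp
    qed (use t in auto)
  qed
  have dA2: "((\<lambda>t. LINT x:B|lborel. f1 t x) has_real_derivative (LINT x:B|lborel. f2 0 x)) (at 0)"
  proof (rule has_real_derivative_set_integral[OF K(1) B _ _ _ c2])
    show "0 \<in> {-d<..<d}" using d by simp
    show "continuous_on K (f1 t)" if "t \<in> {-d<..<d}" for t
      using slice[OF c1 that] by simp
    show "((\<lambda>t. f1 t x) has_real_derivative f2 t x) (at t)"
      if t: "t \<in> {-d<..<d}" and x: "x \<in> K" for t x
      unfolding f1_def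
      using pos[OF t x] smooth_on_time_derivative[OF D, of t x] smooth_on_time_derivative[OF sD1, of t x]
      by (auto intro!: derivative_eq_intros simp: f2_def power2_eq_square) (simp add: field_simps)
  qed
  have "(deriv (\<lambda>t. LINT x:B|lborel. sqrt \<bar>D (t, x)\<bar>) has_real_derivative (LINT x:B|lborel. f2 0 x)) (at 0)"
    by (rule has_field_derivative_transform_within_open[OF dA2, of "{-d<..<d}"])
      (use d DERIV_imp_deriv[OF dA] in auto)
  then have "deriv (deriv (\<lambda>t. LINT x:B|lborel. sqrt \<bar>D (t, x)\<bar>)) 0 = (LINT x:B|lborel. f2 0 x)"
    by (rule DERIV_imp_deriv)
  also have "\<dots> = (LINT x:B|lborel. ?D2 (0, x) / (2 * sqrt c))"
    using B D0 D1 by (intro set_lebesgue_integral_cong) (auto simp: f2_def)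
  finally show ?thesis .
qed

section \<open>Integrals over boxes and fundamental cells\<close>

lemma set_integral_box:
  fixes w :: "'a::euclidean_space \<Rightarrow> real"
  assumes "continuous_on (cbox a b) w" "B \<in> sets borel" "B \<subseteq> cbox a b"
    "\<And>x. x \<in> box a b - B \<Longrightarrow> w x = 0"
  shows "(LINT x:B|lborel. w x) = integral (cbox a b) w"
proof -
  have "(LINT x:B|lborel. w x) = integral B w"
    by (rule set_borel_integral_eq_integral(2)) (rule set_integrable_compact_subset[OF compact_cbox assms(1-3)])
  also have "\<dots> = integral (cbox a b) w"
  proof (rule integral_spike_set)
    show "negligible {x \<in> B - cbox a b. w x \<noteq> 0}" using assms(3) by (simp add: Diff_eq_empty_iff[THEN iffD2])
    \<comment> \<open>Vanishing is known in the open box only, since a fundamental cell may miss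
      part of the frontier; the frontier is a null set.\<close>
    show "negligible {x \<in> cbox a b - B. w x \<noteq> 0}"
      by (rule negligible_subset[OF negligible_frontier_interval]) (use assms(4) in auto)
  qed
  finally show ?thesis .
qed

text \<open>Fubini and the fundamental theorem of calculus in the first variable. Agreement of the
  boundary values for interior \<open>u\<close> is enough, as the two extreme values of
  \<open>u\<close> form a null set.\<close>

lemma integral_partial_derivative_fst:
  fixes w w' :: "real \<times> real \<Rightarrow> real"
  assumes w': "continuous_on (cbox (a1, a2) (b1, b2)) w'" and "a1 \<le> b1"
    and d: "\<And>s u. s \<in> {a1..b1} \<Longrightarrow> u \<in> {a2..b2} \<Longrightarrow> ((\<lambda>s. w (s, u)) has_real_derivative w' (s, u)) (at s)"
    and ends: "\<And>u. u \<in> {a2<..<b2} \<Longrightarrow> w (a1, u) = w (b1, u)"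
  shows "integral (cbox (a1, a2) (b1, b2)) w' = 0"
proof -
  have "integral {a1..b1} (\<lambda>s. w' (s, u)) = w (b1, u) - w (a1, u)" if "u \<in> {a2..b2}" for u
    using d[OF _ that] \<open>a1 \<le> b1\<close>
    by (intro integral_unique fundamental_theorem_of_calculus)
      (auto simp flip: has_real_derivative_iff_has_vector_derivative intro: has_field_derivative_at_within)
  then have "integral {a2..b2} (\<lambda>u. integral {a1..b1} (\<lambda>s. w' (s, u))) = integral {a2..b2} (\<lambda>u. 0)"
    by (intro integral_spike[where S="{a2, b2}"]) (auto simp: ends)
  then show ?thesis
    using integral_prod_continuous[OF w'] integral_swap_continuous[of a1 a2 b1 b2 "\<lambda>s u. w' (s, u)"] w' by simp
qed

lemma integral_partial_derivative_snd:
  fixes w w' :: "real \<times> real \<Rightarrow> real"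
  assumes w': "continuous_on (cbox (a1, a2) (b1, b2)) w'" and "a2 \<le> b2"
    and d: "\<And>s u. s \<in> {a1..b1} \<Longrightarrow> u \<in> {a2..b2} \<Longrightarrow> ((\<lambda>u. w (s, u)) has_real_derivative w' (s, u)) (at u)"
    and ends: "\<And>s. s \<in> {a1<..<b1} \<Longrightarrow> w (s, a2) = w (s, b2)"
  shows "integral (cbox (a1, a2) (b1, b2)) w' = 0"
proof -
  have "integral {a2..b2} (\<lambda>u. w' (s, u)) = w (s, b2) - w (s, a2)" if "s \<in> {a1..b1}" for s
    using d[OF that] \<open>a2 \<le> b2\<close>
    by (intro integral_unique fundamental_theorem_of_calculus)
      (auto simp flip: has_real_derivative_iff_has_vector_derivative intro: has_field_derivative_at_within)
  then have "integral {a1..b1} (\<lambda>s. integral {a2..b2} (\<lambda>u. w' (s, u))) = integral {a1..b1} (\<lambda>s. 0)"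
    by (intro integral_spike[where S="{a1, b1}"]) (auto simp: ends)
  then show ?thesis
    using integral_prod_continuous[OF w'] by simp
qed

text \<open>Provides an interval of integration without boundary terms: its endpoints avoid
  \<open>K\<close> when the parameter runs over an open interval and are identified by the period
  when it runs over a circle.\<close>

lemma cell_interval:
  assumes I: "open I" "is_interval I" "I \<noteq> {}" and L: "L = 0 \<or> L > 0 \<and> I = UNIV"
    and K: "compact K" "K \<subseteq> I"
  obtains a b where "a < b" "{a..b} \<subseteq> I" "cell I L \<inter> K \<subseteq> {a..b}" "{a<..<b} \<subseteq> cell I L"
    "L = 0 \<and> a \<notin> K \<and> b \<notin> K \<or> L > 0 \<and> a = 0 \<and> b = L"
proof (cases "L = 0")
  case True
  obtain i where i: "i \<in> I" using I(3) by blast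
  \<comment> \<open>The extra point covers an empty \<open>K\<close>; the margins \<open>d\<close>
    and \<open>e\<close> chosen below move the endpoints strictly beyond \<open>K\<close>.\<close>
  let ?K = "insert i K"
  have K': "compact ?K" "?K \<noteq> {}" "?K \<subseteq> I" using K i by auto
  obtain m where m: "m \<in> ?K" "\<And>x. x \<in> ?K \<Longrightarrow> m \<le> x" using compact_attains_inf[OF K'(1,2)] by blast
  obtain n where n: "n \<in> ?K" "\<And>x. x \<in> ?K \<Longrightarrow> x \<le> n" using compact_attains_sup[OF K'(1,2)] by blast
  obtain d where d: "0 < d" "cball m d \<subseteq> I" using open_contains_cball[of I] I(1) m(1) K'(3) by blast
  obtain e where e: "0 < e" "cball n e \<subseteq> I" using open_contains_cball[of I] I(1) n(1) K'(3) by blast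
  have "m - d \<in> I" "n + e \<in> I" using d e by (auto simp: subset_eq dist_real_def)
  moreover have "{m - d..n + e} \<subseteq> I"
  proof
    fix x assume "x \<in> {m - d..n + e}"
    then show "x \<in> I" using mem_is_interval_1_I[OF I(2) \<open>m - d \<in> I\<close> \<open>n + e \<in> I\<close>, of x] by simp
  qed
  ultimately show ?thesis
    using m n d(1) e(1) True
    by (intro that[of "m - d" "n + e"]) (force simp: cell_def)+
next
  case False
  then show ?thesis using L by (intro that[of 0 L]) (auto simp: cell_def)
qed

section \<open>The second variation of a product of geodesics\<close>

lemma
  assumes U: "open U" and A: "smooth_on U A" and C: "smooth_on U C" and E: "smooth_on U E" and z: "z \<in> U"
  shows dderiv_gram: "dderiv (\<lambda>z. A z * C z - (E z)\<^sup>2 :: real) z v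
      = A z * dderiv C z v + dderiv A z v * C z - 2 * E z * dderiv E z v"
    and second_dderiv_gram: "dderiv (\<lambda>y. dderiv (\<lambda>z. A z * C z - (E z)\<^sup>2) y v) z v
      = A z * dderiv (\<lambda>y. dderiv C y v) z v + 2 * dderiv A z v * dderiv C z v
        + dderiv (\<lambda>y. dderiv A y v) z v * C z
        - 2 * (dderiv E z v)\<^sup>2 - 2 * E z * dderiv (\<lambda>y. dderiv E y v) z v"
proof -
  note has = smooth_on_has_derivative

  have 1: "dderiv (\<lambda>z. A z * C z - (E z)\<^sup>2) y v
      = A y * dderiv C y v + dderiv A y v * C y - 2 * E y * dderiv E y v" if y: "y \<in> U" for y
    unfolding power2_eq_square
    by (rule trans, rule dderiv_eqI, rule has_derivative_diff[OF has_derivative_mult[OF has[OF A y] has[OF C y]]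
          has_derivative_mult[OF has[OF E y] has[OF E y]]]) simp
  show "dderiv (\<lambda>z. A z * C z - (E z)\<^sup>2) z v
      = A z * dderiv C z v + dderiv A z v * C z - 2 * E z * dderiv E z v"
    by (rule 1[OF z])
  have "dderiv (\<lambda>y. dderiv (\<lambda>z. A z * C z - (E z)\<^sup>2) y v) z v
      = dderiv (\<lambda>y. A y * dderiv C y v + dderiv A y v * C y - 2 * (E y * dderiv E y v)) z v"
    by (rule dderiv_cong_open[OF U z]) (simp add: 1)
  also have "\<dots> = (A z * dderiv (\<lambda>y. dderiv C y v) z v + dderiv A z v * dderiv C z v)
      + (dderiv A z v * dderiv C z v + dderiv (\<lambda>y. dderiv A y v) z v * C z)
      - 2 * (E z * dderiv (\<lambda>y. dderiv E y v) z v + dderiv E z v * dderiv E z v)"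
    by (rule dderiv_eqI)
      (intro has_derivative_diff has_derivative_add has_derivative_mult has_derivative_mult_right
        has[OF _ z] A C E smooth_on_dderiv)
  finally show "dderiv (\<lambda>y. dderiv (\<lambda>z. A z * C z - (E z)\<^sup>2) y v) z v
      = A z * dderiv (\<lambda>y. dderiv C y v) z v + 2 * dderiv A z v * dderiv C z v
        + dderiv (\<lambda>y. dderiv A y v) z v * C z
        - 2 * (dderiv E z v)\<^sup>2 - 2 * E z * dderiv (\<lambda>y. dderiv E y v) z v"
    by (simp add: power2_eq_square algebra_simps)
qed

lemma dderiv_sum2:
  fixes f h :: "'a::real_normed_vector \<Rightarrow> real"
  assumes U: "open U" and f: "smooth_on U f" and h: "smooth_on U h" and z: "z \<in> U"
  shows "dderiv (\<lambda>z. f z + h z) z v = dderiv f z v + dderiv h z v"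
    and "dderiv (\<lambda>y. dderiv (\<lambda>z. f z + h z) y v) z v
      = dderiv (\<lambda>y. dderiv f y v) z v + dderiv (\<lambda>y. dderiv h y v) z v"
proof -
  have 1: "dderiv (\<lambda>z. f z + h z) y v = dderiv f y v + dderiv h y v"
    if "smooth_on U f" "smooth_on U h" "y \<in> U" for f h :: "'a \<Rightarrow> real" and y
    using that by (intro dderiv_eqI has_derivative_add smooth_on_has_derivative)
  show "dderiv (\<lambda>z. f z + h z) z v = dderiv f z v + dderiv h z v"
    by (rule 1[OF f h z])
  have "dderiv (\<lambda>y. dderiv (\<lambda>z. f z + h z) y v) z v = dderiv (\<lambda>y. dderiv f y v + dderiv h y v) z v"
    by (rule dderiv_cong_open[OF U z]) (rule 1[OF f h])
  also have "\<dots> = dderiv (\<lambda>y. dderiv f y v) z v + dderiv (\<lambda>y. dderiv h y v) z v"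
    by (rule 1[OF smooth_on_dderiv[OF f] smooth_on_dderiv[OF h] z])
  finally show "dderiv (\<lambda>y. dderiv (\<lambda>z. f z + h z) y v) z v
      = dderiv (\<lambda>y. dderiv f y v) z v + dderiv (\<lambda>y. dderiv h y v) z v" .
qed

lemma box_Pair_eq: "box (a, c) (b, d) = box a b \<times> box c d"
  by (force simp: box_def Basis_prod_def)

lemma deriv_deriv_cong:
  fixes f h :: "real \<Rightarrow> real"
  assumes "open N" "x \<in> N" "\<And>t. t \<in> N \<Longrightarrow> f t = h t"
  shows "deriv (deriv f) x = deriv (deriv h) x"
proof -
  have "deriv f t = deriv h t" if "t \<in> N" for t
    using assms that by (intro deriv_cong_ev) (auto simp: eventually_nhds)
  then show ?thesis
    using assms by (intro deriv_cong_ev) (auto simp: eventually_nhds)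
qed

lemma cell_borel: "open I \<Longrightarrow> cell I L \<in> sets borel"
  by (simp add: cell_def)

text \<open>The signs \<open>\<sigma>1\<close> and \<open>\<sigma>2\<close> make both geodesics
  spacelike and both curvatures nonpositive, for \<open>\<sigma>1\<close> times the first metric and
  \<open>\<sigma>2\<close> times the second. This is the common form of the three cases.\<close>

lemma product_geodesics_stable:
  fixes S1 :: "('p::{t2_space,second_countable_topology}, real^2, 'i) metric_mfd"
    and S2 :: "('q::{t2_space,second_countable_topology}, real^2, 'k) metric_mfd"
  assumes S: "lorentzian_surface S1" "lorentzian_surface S2"
    and \<sigma>: "\<sigma>1 * \<sigma>1 = 1" "\<sigma>2 * \<sigma>2 = 1" "\<epsilon> = \<sigma>1 * \<sigma>2"
    and curv: "\<And>p. \<sigma>1 * gauss_curvature S1 p \<le> 0" "\<And>q. \<sigma>2 * gauss_curvature S2 q \<le> 0"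
    and geod: "geodesic S1 I1 L1 \<phi>" "geodesic S2 I2 L2 \<psi>"
    and pos: "\<And>s. s \<in> I1 \<Longrightarrow> \<sigma>1 * induced S1 \<phi> s 1 1 > 0" "\<And>s. s \<in> I2 \<Longrightarrow> \<sigma>2 * induced S2 \<psi> s 1 1 > 0"
  shows "stable_surface (product_mfd \<epsilon> S1 S2) I1 L1 I2 L2 (product_surface \<phi> \<psi>)"
  unfolding stable_surface_def
\<comment> \<open>The sign is \<open>\<le> 0\<close>: for \<open>\<sigma>1\<close> times the product
  metric, of signature (2,2), the surface is positive definite, so its normal planes are negative
  definite.\<close>
proof (rule disjI2, intro allI impI)
  fix \<delta> K and F :: "real \<Rightarrow> real \<times> real \<Rightarrow> 'p \<times> 'q"
  let ?M = "product_mfd \<epsilon> S1 S2" and ?f = "product_surface \<phi> \<psi>"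
  let ?F = "\<lambda>(t, x). F t x"
  assume "normal_variation ?M I1 L1 I2 L2 ?f \<delta> K F"
  then have \<delta>: "\<delta> > 0" and K: "compact K" "K \<subseteq> I1 \<times> I2"
    and F: "smooth_map ?M ({-\<delta><..<\<delta>} \<times> (I1 \<times> I2)) ?F"
    and per: "\<And>t s u. t \<in> {-\<delta><..<\<delta>} \<Longrightarrow> s \<in> I1 \<Longrightarrow> u \<in> I2 \<Longrightarrow>
      F t (s + L1, u) = F t (s, u) \<and> F t (s, u + L2) = F t (s, u)"
    and F0: "\<And>x. x \<in> I1 \<times> I2 \<Longrightarrow> F 0 x = ?f x"
    and supp: "\<And>t x. t \<in> {-\<delta><..<\<delta>} \<Longrightarrow> x \<in> cell I1 L1 \<times> cell I2 L2 - K \<Longrightarrow> F t x = ?f x"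
    and normal: "\<And>x a. x \<in> I1 \<times> I2 \<Longrightarrow> met_at ?M (?f x) (push ?M ?F (0, x) (1, 0)) (push ?M ?f x a) = 0"
    unfolding normal_variation_def by blast+
  have I: "open I1" "is_interval I1" "I1 \<noteq> {}" "L1 = 0 \<or> L1 > 0 \<and> I1 = UNIV"
    "open I2" "is_interval I2" "I2 \<noteq> {}" "L2 = 0 \<or> L2 > 0 \<and> I2 = UNIV"
    using geod by (auto simp: geodesic_def smooth_curve_def smooth_map_def)
  define U0 where "U0 = I1 \<times> I2"
  define U where "U = {-\<delta><..<\<delta>} \<times> U0"
  define P where "P = (\<lambda>z. fst (?F z))"
  define Q where "Q = (\<lambda>z. snd (?F z))"
  have oU0: "open U0" unfolding U0_def using I by (intro open_Times)
  have oU: "open U" unfolding U_def using oU0 by (intro open_Times) auto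
  note cover = S[THEN lorentzian_open_cover]
  note M = product_open_cover[OF cover, of \<epsilon>]
  have FU: "smooth_map ?M U ?F" using F by (simp add: U_def U0_def)
  have PQ: "smooth_map S1 U P" "smooth_map S2 U Q"
    using product_smooth_map[OF cover FU] by (simp_all add: P_def Q_def)
  have inU: "(0, x) \<in> U" if "x \<in> U0" for x using that \<delta> by (simp add: U_def)
  have PQ0: "P (0, x) = \<phi> (fst x)" "Q (0, x) = \<psi> (snd x)" if "x \<in> U0" for x
    using F0[of x] that by (auto simp: P_def Q_def U0_def product_surface_def)
  let ?es = "(1, 0) :: real \<times> real" and ?eu = "(0, 1) :: real \<times> real"
  interpret A: geodesic_slice S1 \<sigma>1 I1 L1 \<phi> \<delta> U0 P fst ?es ?eu
    using S curv geod pos \<delta> oU0 PQ PQ0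
    by (intro geodesic_slice.intro bounded_linear_fst) (auto simp: U_def U0_def)
  interpret B: geodesic_slice S2 \<sigma>2 I2 L2 \<psi> \<delta> U0 Q snd ?eu ?es
    using S curv geod pos \<delta> oU0 PQ PQ0
    by (intro geodesic_slice.intro bounded_linear_snd) (auto simp: U_def U0_def)
  let ?T = "(1, 0) :: real \<times> real \<times> real"
  have ind: "induced ?M ?F z v w = induced S1 P z v w + \<epsilon> * induced S2 Q z v w" if "z \<in> U" for z v w
    using product_induced[OF S FU that] by (simp add: P_def Q_def)
  have pushF: "push ?M h x v = push ?M ?F (t, x) (0, v)"
    if "t \<in> {-\<delta><..<\<delta>}" "x \<in> U0" "\<And>y. y \<in> U0 \<Longrightarrow> h y = F t y" for t x v and h :: "real \<times> real \<Rightarrow> 'p \<times> 'q"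
  proof -
    have "((\<lambda>y. (t, y)) has_derivative (\<lambda>v. (0, v))) (at x)" by (auto intro!: derivative_eq_intros)
    from push_compose[OF M FU this _ oU0 that(2), of h v] that show ?thesis by (auto simp: U_def)
  qed
  have nrm: "induced S1 P (0, x) ?T (0, v) + \<epsilon> * induced S2 Q (0, x) ?T (0, v) = 0" if x: "x \<in> U0" for x v
  proof -
    have "push ?M ?f x v = push ?M ?F (0, x) (0, v)"
      using x \<delta> F0 by (intro pushF) (auto simp: U0_def)
    then have "induced ?M ?F (0, x) ?T (0, v) = 0"
      using normal[of x v] F0[of x] x by (simp add: induced_def U0_def)
    then show ?thesis using ind[OF inU[OF x]] by simp
  qed
  \<comment> \<open>Tested against the direction of \<open>\<phi>\<close>, normality involves the
    second factor only through the derivative of \<open>Q\<close> along \<open>?es\<close>, which is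
    zero at time 0.\<close>
  interpret A: geodesic_variation S1 \<sigma>1 I1 L1 \<phi> \<delta> U0 P fst ?es ?eu
  proof unfold_locales
    fix x assume x: "x \<in> U0"
    have "induced S2 Q (0, x) ?T (0, ?es) = 0"
      using induced_commute[OF S(2) PQ(2) inU[OF x], of ?T] induced_push_zero[OF S(2) PQ(2) inU[OF x] B.push_slice_b[OF x]]
      by simp
    then show "induced S1 P (0, x) ?T (0, ?es) = 0" using nrm[OF x, of ?es] by simp
  qed
  interpret B: geodesic_variation S2 \<sigma>2 I2 L2 \<psi> \<delta> U0 Q snd ?eu ?es
  proof unfold_locales
    fix x assume x: "x \<in> U0"
    have "induced S1 P (0, x) ?T (0, ?eu) = 0"
      using induced_commute[OF S(1) PQ(1) inU[OF x], of ?T] induced_push_zero[OF S(1) PQ(1) inU[OF x] A.push_slice_b[OF x]]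
      by simp
    then show "induced S2 Q (0, x) ?T (0, ?eu) = 0" using nrm[OF x, of ?eu] \<sigma> by auto
  qed
  \<comment> \<open>The metric induced on the varied surfaces by \<open>\<sigma>1\<close> g1 +
    \<open>\<sigma>2\<close> g2, which is \<open>\<sigma>1\<close> times the one induced by the
    product metric; at time 0 it is diagonal with positive constant entries.\<close>
  define m where "m = (\<lambda>u v z. A.met_comp (0, u) (0, v) z + B.met_comp (0, u) (0, v) z)"
  define D where "D = (\<lambda>z. m ?es ?es z * m ?eu ?eu z - (m ?es ?eu z)\<^sup>2)"
  have smA: "smooth_on U (A.met_comp v w)" and smB: "smooth_on U (B.met_comp v w)" for v w
    using A.smooth_met_comp B.smooth_met_comp by (simp_all add: U_def)
  have sm: "smooth_on U (m u v)" for u v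
    unfolding m_def by (intro smooth_on_add oU smA smB)
  have sD: "smooth_on U D"
    unfolding D_def power2_eq_square by (intro smooth_on_diff smooth_on_mult oU sm)
  have gram: "gram_det ?M (F t) x = D (t, x)" if t: "t \<in> {-\<delta><..<\<delta>}" and x: "x \<in> U0" for t x
  proof -
    have "induced ?M (F t) x v w = \<sigma>1 * m v w (t, x)" for v w
    proof -
      have "induced ?M (F t) x v w = induced ?M ?F (t, x) (0, v) (0, w)"
        using pushF[OF t x, of "F t"] by (simp add: induced_def)
      also have "\<dots> = \<sigma>1 * m v w (t, x)"
        using t x \<sigma>(1) by (subst ind) (simp_all add: U_def m_def A.met_comp_def B.met_comp_def \<sigma>(3) distrib_left flip: mult.assoc)
      finally show ?thesis .
    qed
    then have "gram_det ?M (F t) x = (\<sigma>1 * \<sigma>1) * D (t, x)"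
      by (simp add: gram_det_def D_def power2_eq_square algebra_simps)
    then show ?thesis by (simp add: \<sigma>(1))
  qed
  obtain s1 s2 where s: "s1 \<in> I1" "s2 \<in> I2" using I by blast
  define \<alpha> where "\<alpha> = \<sigma>1 * induced S1 \<phi> s1 1 1"
  define \<beta> where "\<beta> = \<sigma>2 * induced S2 \<psi> s2 1 1"
  have \<alpha>\<beta>: "\<alpha> > 0" "\<beta> > 0" using pos s by (auto simp: \<alpha>_def \<beta>_def)
  have commB: "B.met_comp (0, ?es) (0, ?eu) z = B.met_comp (0, ?eu) (0, ?es) z" if "z \<in> U" for z
    using B.met_comp_commute that by (simp add: U_def)
  have m0: "m ?es ?es (0, x) = \<alpha>" "m ?eu ?eu (0, x) = \<beta>" "m ?es ?eu (0, x) = 0" if x: "x \<in> U0" for x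
  proof -
    have "fst x \<in> I1" "snd x \<in> I2" using x by (auto simp: U0_def)
    then show "m ?es ?es (0, x) = \<alpha>" "m ?eu ?eu (0, x) = \<beta>"
      using A.energy_constant[OF _ s(1)] B.energy_constant[OF _ s(2)] x
      by (auto simp: m_def \<alpha>_def \<beta>_def A.met_comp_aa B.met_comp_aa A.met_comp_b B.met_comp_b)
    show "m ?es ?eu (0, x) = 0"
      using A.met_comp_commute[of "(0, x)" "(0, ?es)" "(0, ?eu)"] x inU[OF x]
      by (simp add: m_def A.met_comp_b B.met_comp_b U_def)
  qed
  have m1: "dderiv (m ?es ?es) (0, x) ?T = 0" "dderiv (m ?eu ?eu) (0, x) ?T = 0" "dderiv (m ?es ?eu) (0, x) ?T = 0"
    if x: "x \<in> U0" for x
  proof -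
    have "dderiv (B.met_comp (0, ?es) (0, ?eu)) (0, x) ?T = 0"
      using dderiv_cong_open[OF oU inU[OF x] commB] B.dderiv_met_comp_time(3)[OF x] by simp
    then show "dderiv (m ?es ?es) (0, x) ?T = 0" "dderiv (m ?eu ?eu) (0, x) ?T = 0" "dderiv (m ?es ?eu) (0, x) ?T = 0"
      unfolding m_def dderiv_sum2(1)[OF oU smA smB inU[OF x]]
      by (simp_all add: A.dderiv_met_comp_time[OF x] B.dderiv_met_comp_time[OF x])
  qed
  define wA where "wA = (\<lambda>x. dderiv A.flux (0, x) (0, ?es))"
  define wB where "wB = (\<lambda>x. dderiv B.flux (0, x) (0, ?eu))"
  \<comment> \<open>Each diagonal component is bounded by the flux derivative of the factor whose
    geodesic runs in that direction; the other factor contributes a nonpositive amount.\<close>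
  have m2: "dderiv (\<lambda>z. dderiv (m ?es ?es) z ?T) (0, x) ?T \<le> 2 * wA x"
    "dderiv (\<lambda>z. dderiv (m ?eu ?eu) z ?T) (0, x) ?T \<le> 2 * wB x" if x: "x \<in> U0" for x
    unfolding m_def dderiv_sum2(2)[OF oU smA smB inU[OF x]] wA_def wB_def
    using A.second_time_derivative_aa[OF x] B.second_time_derivative_bb[OF x]
      A.second_time_derivative_bb[OF x] B.second_time_derivative_aa[OF x] by linarith+
  \<comment> \<open>At time 0 all first time derivatives vanish and the off-diagonal component is
    zero, so only second derivatives of the diagonal components survive, weighted by
    \<open>\<alpha>\<close> or \<open>\<beta>\<close>.\<close>
  have D0: "D (0, x) = \<alpha> * \<beta>" and D1: "dderiv D (0, x) ?T = 0"
    and D2: "dderiv (\<lambda>z. dderiv D z ?T) (0, x) ?T \<le> 2 * (\<beta> * wA x + \<alpha> * wB x)" if x: "x \<in> U0" for x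
  proof -
    show "D (0, x) = \<alpha> * \<beta>" by (simp add: D_def m0[OF x])
    show "dderiv D (0, x) ?T = 0"
      unfolding D_def dderiv_gram[OF oU sm sm sm inU[OF x]] by (simp add: m0[OF x] m1[OF x])
    have "dderiv (\<lambda>z. dderiv D z ?T) (0, x) ?T
      = \<alpha> * dderiv (\<lambda>z. dderiv (m ?eu ?eu) z ?T) (0, x) ?T + dderiv (\<lambda>z. dderiv (m ?es ?es) z ?T) (0, x) ?T * \<beta>"
      unfolding D_def second_dderiv_gram[OF oU sm sm sm inU[OF x]] by (simp add: m0[OF x] m1[OF x])
    also have "\<dots> \<le> \<alpha> * (2 * wB x) + (2 * wA x) * \<beta>"
      using m2[OF x] \<alpha>\<beta> by (intro add_mono mult_left_mono mult_right_mono) auto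
    finally show "dderiv (\<lambda>z. dderiv D z ?T) (0, x) ?T \<le> 2 * (\<beta> * wA x + \<alpha> * wB x)"
      by (simp add: algebra_simps)
  qed
  define Bd where "Bd = (cell I1 L1 \<times> cell I2 L2) \<inter> K"
  have Bd: "Bd \<in> sets borel" "Bd \<subseteq> K" "K \<subseteq> U0"
    using K(2) sets.Int[OF borel_Times[OF cell_borel[OF I(1)] cell_borel[OF I(5)]] borel_compact[OF K(1)]]
    by (auto simp: Bd_def U0_def)
  have "second_variation ?M Bd F = deriv (deriv (\<lambda>t. LINT x:Bd|lborel. sqrt \<bar>D (t, x)\<bar>)) 0"
    unfolding second_variation_def
  proof (rule deriv_deriv_cong[of "{-\<delta><..<\<delta>}"])
    show "area ?M Bd (F t) = (LINT x:Bd|lborel. sqrt \<bar>D (t, x)\<bar>)" if "t \<in> {-\<delta><..<\<delta>}" for t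
      unfolding area_def using Bd gram[OF that] by (intro set_lebesgue_integral_cong) auto
  qed (use \<delta> in auto)
  also have "\<dots> = (LINT x:Bd|lborel. dderiv (\<lambda>z. dderiv D z ?T) (0, x) ?T / (2 * sqrt (\<alpha> * \<beta>)))"
    using Bd \<alpha>\<beta> D0 D1 sD
    by (intro second_derivative_area[OF \<delta> oU0 K(1)]) (auto simp: U_def)
  finally have sv: "second_variation ?M Bd F = \<dots>" .
  have cont0: "continuous_on U0 (\<lambda>x. h (0, x))" if "smooth_on U h" for h :: "real \<times> real \<times> real \<Rightarrow> real"
  proof -
    have "continuous_on U0 (\<lambda>x. (0::real, x))" by (intro continuous_intros)
    from continuous_on_compose2[OF smooth_on_continuous[OF that] this] show ?thesis
      using inU by (simp add: image_subset_iff)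
  qed
  have smw: "smooth_on U A.flux" "smooth_on U B.flux"
    using A.smooth_flux B.smooth_flux by (simp_all add: U_def)
  have cw: "continuous_on U0 wA" "continuous_on U0 wB"
    unfolding wA_def wB_def by (intro cont0 smooth_on_dderiv smw)+
  \<comment> \<open>The support is prescribed within one fundamental cell only, hence the
    restriction to open subsets of it.\<close>
  have vanish: "A.flux (0, x) = 0" "B.flux (0, x) = 0"
    if W: "open W" "W \<subseteq> cell I1 L1 \<times> cell I2 L2 - K" "W \<subseteq> U0" "x \<in> W" for W x
  proof -
    have *: "P (t, y) = P (0, y)" "Q (t, y) = Q (0, y)" if "t \<in> {-\<delta><..<\<delta>}" "y \<in> W" for t y
      using supp[of t y] supp[of 0 y] that W \<delta> by (auto simp: P_def Q_def subset_eq)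
    show "A.flux (0, x) = 0" by (rule A.flux_eq_0[OF W(1,3) *(1) W(4)])
    show "B.flux (0, x) = 0" by (rule B.flux_eq_0[OF W(1,3) *(2) W(4)])
  qed
  have K12: "compact (fst ` K)" "compact (snd ` K)" "fst ` K \<subseteq> I1" "snd ` K \<subseteq> I2"
    using K by (auto intro!: compact_continuous_image continuous_intros)
  obtain a1 b1 where 1: "a1 < b1" "{a1..b1} \<subseteq> I1" "cell I1 L1 \<inter> fst ` K \<subseteq> {a1..b1}" "{a1<..<b1} \<subseteq> cell I1 L1"
    "L1 = 0 \<and> a1 \<notin> fst ` K \<and> b1 \<notin> fst ` K \<or> L1 > 0 \<and> a1 = 0 \<and> b1 = L1"
    by (rule cell_interval[OF I(1-4) K12(1,3)])
  obtain a2 b2 where 2: "a2 < b2" "{a2..b2} \<subseteq> I2" "cell I2 L2 \<inter> snd ` K \<subseteq> {a2..b2}" "{a2<..<b2} \<subseteq> cell I2 L2"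
    "L2 = 0 \<and> a2 \<notin> snd ` K \<and> b2 \<notin> snd ` K \<or> L2 > 0 \<and> a2 = 0 \<and> b2 = L2"
    by (rule cell_interval[OF I(5-8) K12(2,4)])
  let ?R = "cbox (a1, a2) (b1, b2)" and ?O = "{a1<..<b1} \<times> {a2<..<b2} - K"
  have R: "?R = {a1..b1} \<times> {a2..b2}" "box (a1, a2) (b1, b2) = {a1<..<b1} \<times> {a2<..<b2}"
    by (simp_all add: cbox_Pair_eq box_Pair_eq)
  have RU: "?R \<subseteq> U0" unfolding R U0_def by (intro Sigma_mono 1(2) 2(2))
  have BdR: "Bd \<subseteq> ?R"
  proof
    fix x assume "x \<in> Bd"
    then have "fst x \<in> cell I1 L1 \<inter> fst ` K" "snd x \<in> cell I2 L2 \<inter> snd ` K" by (auto simp: Bd_def)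
    then have "fst x \<in> {a1..b1}" "snd x \<in> {a2..b2}" using 1(3) 2(3) by blast+
    then show "x \<in> ?R" unfolding R by (simp only: mem_Times_iff)
  qed
  have oO: "open ?O" using K(1) by (intro open_Diff open_Times) (auto simp: compact_imp_closed)
  have OU: "?O \<subseteq> U0" using RU R by (auto simp: subset_eq)
  have Ocell: "?O \<subseteq> cell I1 L1 \<times> cell I2 L2 - K" using 1(4) 2(4) by blast
  \<comment> \<open>The flux vanishes on an open set around \<open>x\<close>, so its derivative does
    too; this is why points of the frontier of the box are excluded.\<close>
  have w0: "wA x = 0" "wB x = 0" if "x \<in> box (a1, a2) (b1, b2) - Bd" for x
  proof -
    have x: "x \<in> ?O" using that 1(4) 2(4) unfolding R Bd_def by blast
    then have "(0, x) \<in> U" using OU inU by blast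
    then show "wA x = 0" "wB x = 0"
      unfolding wA_def wB_def
      using vanish[OF oO Ocell OU] smw
      by (auto intro!: dderiv_slice_zero[OF _ oO x] smooth_on_differentiable)
  qed
  have line: "((\<lambda>r. h (0, (c + r *\<^sub>R v))) has_real_derivative dderiv h (0, c + r *\<^sub>R v) (0, v)) (at r)"
    if "smooth_on U h" "c + r *\<^sub>R v \<in> U0" for h :: "real \<times> real \<times> real \<Rightarrow> real" and c v r
    using has_real_derivative_line[of h "(0, c)" r "(0, v)"] smooth_on_differentiable[OF that(1) inU[OF that(2)]]
    by simp
  have intA: "integral ?R wA = 0"
  proof (rule integral_partial_derivative_fst[OF continuous_on_subset[OF cw(1) RU], where w="\<lambda>x. A.flux (0, x)"])
    fix s u assume su: "s \<in> {a1..b1}" "u \<in> {a2..b2}"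
    then have "(s, u) \<in> U0" using RU R by auto
    then show "((\<lambda>s. A.flux (0, (s, u))) has_real_derivative wA (s, u)) (at s)"
      using line[OF smw(1), of "(0, u)" s ?es] by (simp add: wA_def)
  next
    fix u assume u: "u \<in> {a2<..<b2}"
    then have uI: "u \<in> I2" using 2(2) by auto
    show "A.flux (0, (a1, u)) = A.flux (0, (b1, u))"
    proof (cases "L1 = 0")
      case True
      \<comment> \<open>An open strip reaching beyond the box, so that the points over
        \<open>a1\<close> and \<open>b1\<close>, which lie outside the projection of
        \<open>K\<close>, become interior points.\<close>
      let ?W = "I1 \<times> {a2<..<b2} - K"
      have W: "open ?W" "?W \<subseteq> cell I1 L1 \<times> cell I2 L2 - K" "?W \<subseteq> U0"
        using K(1) I 2 True by (auto intro!: open_Diff open_Times simp: compact_imp_closed cell_def U0_def)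
      have "(a1, u) \<in> ?W" "(b1, u) \<in> ?W" using 1 True u by (auto simp: image_iff)
      then show ?thesis using vanish(1)[OF W] by simp
    next
      case False
      then have L: "a1 = 0" "b1 = L1" "I1 = UNIV" using 1(5) I(4) by auto
      \<comment> \<open>On a circle the two ends of the box differ by the period, so the boundary
        values cancel even if \<open>K\<close> meets them.\<close>
      have "A.flux (0, (0, u) + (L1, 0)) = A.flux (0, (0, u))"
        using per uI L by (intro A.flux_periodic) (auto simp: U0_def P_def)
      then show ?thesis by (simp add: L)
    qed
  qed (use 1 in simp)
  have intB: "integral ?R wB = 0"
  proof (rule integral_partial_derivative_snd[OF continuous_on_subset[OF cw(2) RU], where w="\<lambda>x. B.flux (0, x)"])
    fix s u assume su: "s \<in> {a1..b1}" "u \<in> {a2..b2}"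
    then have "(s, u) \<in> U0" using RU R by auto
    then show "((\<lambda>u. B.flux (0, (s, u))) has_real_derivative wB (s, u)) (at u)"
      using line[OF smw(2), of "(s, 0)" u ?eu] by (simp add: wB_def)
  next
    fix s assume s: "s \<in> {a1<..<b1}"
    then have sI: "s \<in> I1" using 1(2) by auto
    show "B.flux (0, (s, a2)) = B.flux (0, (s, b2))"
    proof (cases "L2 = 0")
      case True
      let ?W = "{a1<..<b1} \<times> I2 - K"
      have W: "open ?W" "?W \<subseteq> cell I1 L1 \<times> cell I2 L2 - K" "?W \<subseteq> U0"
        using K(1) I 1 True by (auto intro!: open_Diff open_Times simp: compact_imp_closed cell_def U0_def)
      have "(s, a2) \<in> ?W" "(s, b2) \<in> ?W" using 2 True s by (auto simp: image_iff)
      then show ?thesis using vanish(2)[OF W] by simp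
    next
      case False
      then have L: "a2 = 0" "b2 = L2" "I2 = UNIV" using 2(5) I(8) by auto
      have "B.flux (0, (s, 0) + (0, L2)) = B.flux (0, (s, 0))"
        using per sI L by (intro B.flux_periodic) (auto simp: U0_def Q_def)
      then show ?thesis by (simp add: L)
    qed
  qed (use 2 in simp)
  note int = set_integrable_compact_subset[OF K(1) continuous_on_subset[OF _ Bd(3)] Bd(1,2)]
  note iw = int[OF cw(1)] int[OF cw(2)]
  have LA: "(LINT x:Bd|lborel. wA x) = 0" "(LINT x:Bd|lborel. wB x) = 0"
    using set_integral_box[OF continuous_on_subset[OF cw(1) RU] Bd(1) BdR w0(1)]
      set_integral_box[OF continuous_on_subset[OF cw(2) RU] Bd(1) BdR w0(2)] intA intB by simp_all
  have "second_variation ?M Bd F \<le> (LINT x:Bd|lborel. 2 * (\<beta> * wA x + \<alpha> * wB x) / (2 * sqrt (\<alpha> * \<beta>)))"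
    unfolding sv
  proof (intro set_integral_mono set_integrable_divide)
    show "set_integrable lborel Bd (\<lambda>x. dderiv (\<lambda>z. dderiv D z ?T) (0, x) ?T)"
      by (rule int) (intro cont0 smooth_on_dderiv sD)
    show "set_integrable lborel Bd (\<lambda>x. 2 * (\<beta> * wA x + \<alpha> * wB x))"
      using iw by (intro set_integrable_mult_right set_integral_add)
    show "dderiv (\<lambda>z. dderiv D z ?T) (0, x) ?T / (2 * sqrt (\<alpha> * \<beta>))
        \<le> 2 * (\<beta> * wA x + \<alpha> * wB x) / (2 * sqrt (\<alpha> * \<beta>))" if "x \<in> Bd" for x
      using D2[of x] that Bd \<alpha>\<beta> by (intro divide_right_mono) auto
  qed
  \<comment> \<open>Constancy of \<open>\<alpha>\<close> and \<open>\<beta>\<close> lets the two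
    flux derivatives be integrated separately, each along its own direction.\<close>
  also have "\<dots> = 2 * (\<beta> * (LINT x:Bd|lborel. wA x) + \<alpha> * (LINT x:Bd|lborel. wB x)) / (2 * sqrt (\<alpha> * \<beta>))"
    using iw by (simp add: set_integral_add)
  also have "\<dots> = 0" by (simp add: LA)
  finally show "second_variation ?M ((cell I1 L1 \<times> cell I2 L2) \<inter> K) F \<le> 0"
    by (simp add: Bd_def)
qed

theorem theorem4:
  fixes S1 :: "('a::{t2_space,second_countable_topology}, real^2, 'i) metric_mfd"
    and S2 :: "('b::{t2_space,second_countable_topology}, real^2, 'k) metric_mfd"
  assumes "lorentzian_surface S1" and "lorentzian_surface S2"
  shows
    "(curvature_condition 1 S1 S2 \<longrightarrow>
       ((\<forall>x. gauss_curvature S1 x \<le> 0) \<and> (\<forall>y. gauss_curvature S2 y \<le> 0) \<longrightarrow>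
         (\<forall>I1 L1 \<phi> I2 L2 \<psi>.
            geodesic S1 I1 L1 \<phi> \<and> geodesic S2 I2 L2 \<psi> \<and>
            spacelike S1 I1 \<phi> \<and> spacelike S2 I2 \<psi> \<and>
            minimal_surface (product_mfd 1 S1 S2) (I1 \<times> I2) (product_surface \<phi> \<psi>) \<and>
            lagrangian 1 S1 S2 (I1 \<times> I2) (product_surface \<phi> \<psi>) \<longrightarrow>
            stable_surface (product_mfd 1 S1 S2) I1 L1 I2 L2 (product_surface \<phi> \<psi>))) \<and>
       ((\<forall>x. gauss_curvature S1 x \<ge> 0) \<and> (\<forall>y. gauss_curvature S2 y \<ge> 0) \<longrightarrow>
         (\<forall>I1 L1 \<phi> I2 L2 \<psi>.
            geodesic S1 I1 L1 \<phi> \<and> geodesic S2 I2 L2 \<psi> \<and>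
            timelike S1 I1 \<phi> \<and> timelike S2 I2 \<psi> \<and>
            minimal_surface (product_mfd 1 S1 S2) (I1 \<times> I2) (product_surface \<phi> \<psi>) \<and>
            lagrangian 1 S1 S2 (I1 \<times> I2) (product_surface \<phi> \<psi>) \<longrightarrow>
            stable_surface (product_mfd 1 S1 S2) I1 L1 I2 L2 (product_surface \<phi> \<psi>))))
     \<and>
     (curvature_condition (-1) S1 S2 \<longrightarrow>
       (\<forall>x. gauss_curvature S1 x \<le> 0) \<and> (\<forall>y. gauss_curvature S2 y \<ge> 0) \<longrightarrow>
         (\<forall>I1 L1 \<phi> I2 L2 \<psi>.
            geodesic S1 I1 L1 \<phi> \<and> geodesic S2 I2 L2 \<psi> \<and>
            spacelike S1 I1 \<phi> \<and> timelike S2 I2 \<psi> \<and>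
            minimal_surface (product_mfd (-1) S1 S2) (I1 \<times> I2) (product_surface \<phi> \<psi>) \<and>
            lagrangian (-1) S1 S2 (I1 \<times> I2) (product_surface \<phi> \<psi>) \<longrightarrow>
            stable_surface (product_mfd (-1) S1 S2) I1 L1 I2 L2 (product_surface \<phi> \<psi>)))"
proof (intro conjI impI allI; elim conjE)
  \<comment> \<open>In each case a factor gets the sign 1 if its geodesic is spacelike and -1 if it
    is timelike; the product of the two signs is the coefficient in the product metric.\<close>
  show "stable_surface (product_mfd 1 S1 S2) I1 L1 I2 L2 (product_surface \<phi> \<psi>)"
    if "\<forall>x. gauss_curvature S1 x \<le> 0" "\<forall>y. gauss_curvature S2 y \<le> 0" "geodesic S1 I1 L1 \<phi>"
      "geodesic S2 I2 L2 \<psi>" "spacelike S1 I1 \<phi>" "spacelike S2 I2 \<psi>" for I1 L1 \<phi> I2 L2 \<psi>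
    by (rule product_geodesics_stable[OF assms, of 1 1]) (use that in \<open>auto simp: spacelike_def\<close>)
  show "stable_surface (product_mfd 1 S1 S2) I1 L1 I2 L2 (product_surface \<phi> \<psi>)"
    if "\<forall>x. gauss_curvature S1 x \<ge> 0" "\<forall>y. gauss_curvature S2 y \<ge> 0" "geodesic S1 I1 L1 \<phi>"
      "geodesic S2 I2 L2 \<psi>" "timelike S1 I1 \<phi>" "timelike S2 I2 \<psi>" for I1 L1 \<phi> I2 L2 \<psi>
    by (rule product_geodesics_stable[OF assms, of "-1" "-1"]) (use that in \<open>auto simp: timelike_def\<close>)
  show "stable_surface (product_mfd (-1) S1 S2) I1 L1 I2 L2 (product_surface \<phi> \<psi>)"
    if "\<forall>x. gauss_curvature S1 x \<le> 0" "\<forall>y. gauss_curvature S2 y \<ge> 0" "geodesic S1 I1 L1 \<phi>"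
      "geodesic S2 I2 L2 \<psi>" "spacelike S1 I1 \<phi>" "timelike S2 I2 \<psi>" for I1 L1 \<phi> I2 L2 \<psi>
    by (rule product_geodesics_stable[OF assms, of 1 "-1"]) (use that in \<open>auto simp: spacelike_def timelike_def\<close>)
qed

end
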